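(* Consider the $G_t/GI/N+GI$ queue with time-dependent arrival rate $\lambda(\cdot)$, and let the initial data satisfy $(\eta_0,\nu_0,X(0))\in\mathcal S_0$, where $\eta_0(dx)=\tilde q(0,x)\,dx=q(0,x)\,dx$ and $\nu_0(dx)=b(0,x)\,dx$. Then existence and uniqueness of Whitt's two-parameter fluid model with input data $(\lambda(\cdot),\tilde q(0,x),b(0,x))$ is equivalent to existence and uniqueness of Kang-Ramanan's measure-valued fluid model with input data $(\lambda(\cdot),\eta_0,\nu_0,X(0))$.
   Context: **Primitives.** $\lambda(\cdot)\ge 0$ is the arrival rate function on $[0,\infty)$ and $E(t)=\int_0^t\lambda(s)\,ds$. $G^s$ and $G^r$ are the service and patience time distribution functions, with $G^s(0+)=G^r(0+)=0$; $\bar G^s=1-G^s$, $\bar G^r=1-G^r$; $H^r=\inf\{x\in\mathbb R_+:G^r(x)=1\}$, $H^s=\inf\{x\in\mathbb R_+:G^s(x)=1\}$. It is assumed that $G^s,G^r$ have densities $g^s,g^r$ on $[0,\infty)$; the hazard rates are $h^r=g^r/\bar G^r$ on $[0,H^r)$ and $h^s=g^s/\bar G^s$ on $[0,H^s)$. $\mathcal C_b(\mathbb R_+)$ is the set of bounded continuous real functions on $\mathbb R_+=[0,\infty)$; $a\wedge b=\min(a,b)$, $a^+=[a]^+=\max(a,0)$. **The set $\mathcal S_0$** consists of triples $(\eta,\nu,x)$ with $\eta$ a nonnegative finite measure on $[0,\infty)$ with support in $[0,H^r)$, $\nu$ a nonnegative finite measure on $[0,\infty)$ with support in $[0,H^s)$,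 $x\in\mathbb R_+$, $1-\nu[0,H^s)=[1-x]^+$ and $\nu[0,H^s)+\eta[0,H^r)=x$. **Whitt's two-parameter fluid model.** Consider functions with Lebesgue integrable densities in the second variable: $B(t,y)=\int_0^y b(t,x)dx\le 1$, $\tilde Q(t,y)=\int_0^y\tilde q(t,x)dx\ge 0$, $Q(t,y)=\int_0^y q(t,x)dx\ge 0$, where $\tilde q(0,\cdot)=q(0,\cdot)$ has support in $[0,H^r)$ and $b(0,\cdot)$ has support in $[0,H^s)$. The pair $(B(t,y),Q(t,y))$ is a two-parameter fluid model (tracking elapsed times) with input data $(\lambda(\cdot),\tilde q(0,x),b(0,x))$ if: (i) $b(t+u,x+u)=b(t,x)\frac{\bar G^s(x+u)}{\bar G^s(x)}$ for $x\in[0,H^s)$, $t\ge0$, $u>0$. (ii) $\tilde q(t+u,x+u)=\tilde q(t,x)\frac{\bar G^r(x+u)}{\bar G^r(x)}$ for $x\in[0,H^r)$, $t\ge0$, $u>0$. (iii) There is a queue boundary function $w(t)$ such that $\tilde Q(t,w(t))=Q(t,\infty)$, and $q(t,x)=\tilde q(t,x)$ for $x\le w(t)$, $q(t,x)=0$ for $x>w(t)$. (iv) With $\sigma(t)=\int_{[0,H^s)}b(t,x)h^s(x)dx$: $b(t,0)=\lambda(t)$ if $B(t,\infty)<1$; $b(t,0)=\sigma(t)\wedge\lambda(t)$ if $B(t,\infty)=1$ and $Q(t,\infty)=0$; $b(t,0)=\sigma(t)$ if $B(t,\infty)=1$ and $Q(t,\infty)>0$. Also $\tilde q(t,0)=\lambda(t)$.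 And $q(t,0)=\lambda(t)$ if $Q(t,\infty)>0$ ($w(t)>0$); $q(t,0)=\lambda(t)-(\sigma(t)\wedge\lambda(t))$ if $B(t,\infty)=1$ and $Q(t,\infty)=0$; $q(t,0)=0$ if $B(t,\infty)<1$. (v) With $\alpha(t)=\int_{[0,H^r)}q(t,x)h^r(x)dx$, for $t\ge 0$: $\int_0^t\lambda(s)ds+\int_0^\infty q(0,x)dx=\int_0^\infty q(t,x)dx+\int_0^t b(s,0)ds+\int_0^t\alpha(s)ds$. **Kang-Ramanan's measure-valued fluid model.** For each $t$, $\eta_t$ and $\nu_t$ are nonnegative finite measures on $[0,\infty)$ with supports in $[0,H^r)$ and $[0,H^s)$ respectively. The triple $(\eta,\nu,X)$ is a measure-valued fluid model (tracking elapsed times) with input data $(\lambda(\cdot),\eta_0,\nu_0,X(0))$, $(\eta_0,\nu_0,X(0))\in\mathcal S_0$, if for every $\psi\in\mathcal C_b(\mathbb R_+)$ and $t\ge0$: $$\int_0^\infty\psi(x)\eta_t(dx)=\int_{[0,H^r)}\psi(x+t)\tfrac{\bar G^r(x+t)}{\bar G^r(x)}\eta_0(dx)+\int_0^t\psi(t-s)\bar G^r(t-s)\lambda(s)ds,$$ $$\int_0^\infty\psi(x)\nu_t(dx)=\int_{[0,H^s)}\psi(x+t)\tfrac{\bar G^s(x+t)}{\bar G^s(x)}\nu_0(dx)+\int_{[0,t]}\psi(t-s)\bar G^s(t-s)dK(s),$$ where $K(t)=B(t)+D(t)-B(0)=\nu_t[0,H^s)+D(t)-\nu_0[0,H^s)$;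 $D(t)=\int_0^t\big(\int_{[0,H^s)}h^s(x)\nu_s(dx)\big)ds$; $E(t)+Q(0)=Q(t)+K(t)+R(t)$; $R(t)=\int_0^t\big(\int_{[0,\chi(s)]}h^r(x)\eta_s(dx)\big)ds$; $\chi(s)=\inf\{x\in[0,H^r):\eta_s[0,x]\ge Q(s)\}$; $Q(t)=(X(t)-1)^+$; $B(t)=\nu_t[0,\infty)=X(t)\wedge1=1-(1-X(t))^+$; and $Q(t)(1-B(t))=0$.
   Formalization: In Whitt's model, (iii) and the input densities are imposed only at ages x>0, w(t) may be infinite, B(t,∞)<1 is required to force Q(t,∞)=0, and b, q̃, q are nonnegative and vanish outside [0,H) at all times; literally, (iii) and (iv) conflict at x=0. *)

theory Defs
  imports "HOL-Probability.Probability"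
begin

section \<open>Primitive data\<close>

text \<open>
  Functions and measures on the half line are represented by functions on the reals, whose values
  at negative arguments are never used, and by Borel measures on the reals that vanish on the
  negative numbers.
\<close>

definition density_measure :: "(real \<Rightarrow> real) \<Rightarrow> real measure" where
  "density_measure f = density lborel (\<lambda>x. ennreal (indicator {0..} x * f x))"

definition lifetime_distribution :: "(real \<Rightarrow> real) \<Rightarrow> (real \<Rightarrow> real) \<Rightarrow> bool" where
  "lifetime_distribution G g \<longleftrightarrow>
     set_borel_measurable borel {0..} g \<and> (\<forall>x\<ge>0. 0 \<le> g x) \<and>
     real_distribution (density_measure g) \<and> G = cdf (density_measure g) \<and>
     (G \<longlongrightarrow> 0) (at_right 0)"

definition endpoint :: "(real \<Rightarrow> real) \<Rightarrow> ereal" where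
  "endpoint G = Inf {ereal x | x. 0 \<le> x \<and> G x = 1}"

definition ages :: "(real \<Rightarrow> real) \<Rightarrow> real set" where
  "ages G = {x. 0 \<le> x \<and> ereal x < endpoint G}"

definition survival :: "(real \<Rightarrow> real) \<Rightarrow> real \<Rightarrow> real" where
  "survival G x = 1 - G x"

definition hazard :: "(real \<Rightarrow> real) \<Rightarrow> (real \<Rightarrow> real) \<Rightarrow> real \<Rightarrow> real" where
  "hazard G g x = g x / survival G x"

text \<open>
  Instantaneous rates are integrals of possibly unbounded hazard rates and can be infinite at
  exceptional times, so they take values in \<^typ>\<open>ennreal\<close>.
\<close>

definition locally_integrable :: "(real \<Rightarrow> ennreal) \<Rightarrow> bool" where
  "locally_integrable f \<longleftrightarrow>
     (\<lambda>s. f s * indicator {0..} s) \<in> borel_measurable borel \<and>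
     (\<forall>t\<ge>0. (\<integral>\<^sup>+s\<in>{0..t}. f s \<partial>lborel) < \<infinity>)"

definition time_integral :: "(real \<Rightarrow> ennreal) \<Rightarrow> real \<Rightarrow> real" where
  "time_integral f t = enn2real (\<integral>\<^sup>+s\<in>{0..t}. f s \<partial>lborel)"

section \<open>The two-parameter fluid model\<close>

definition cumulative :: "(real \<Rightarrow> real) \<Rightarrow> ereal \<Rightarrow> real" where
  "cumulative f y = (LBINT x:{x. 0 \<le> x \<and> ereal x \<le> y}. f x)"

text \<open>A density of a measure concentrated on the ages below the endpoint of the law \<open>G\<close>.\<close>

definition age_density :: "(real \<Rightarrow> real) \<Rightarrow> (real \<Rightarrow> real) \<Rightarrow> bool" where
  "age_density G f \<longleftrightarrow>
     set_integrable lborel {0..} f \<and> (\<forall>x\<ge>0. 0 \<le> f x) \<and> (\<forall>x\<ge>0. x \<notin> ages G \<longrightarrow> f x = 0)"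

definition density_rate ::
    "(real \<Rightarrow> real) \<Rightarrow> (real \<Rightarrow> real) \<Rightarrow> (real \<Rightarrow> real) \<Rightarrow> ennreal" where
  "density_rate G g f = (\<integral>\<^sup>+x\<in>ages G. ennreal (f x * hazard G g x) \<partial>lborel)"

definition ages_along :: "(real \<Rightarrow> real) \<Rightarrow> (real \<Rightarrow> real \<Rightarrow> real) \<Rightarrow> bool" where
  "ages_along G f \<longleftrightarrow>
     (\<forall>t\<ge>0. \<forall>x\<in>ages G. \<forall>u>0. f (t + u) (x + u) = f t x * (survival G (x + u) / survival G x))"

text \<open>
  The queue boundary is extended-real valued: when nobody has left a queue whose initial density
  has unbounded support, the boundary is infinite.  The value of \<open>q t\<close> at age \<open>0\<close> is prescribed by
  the boundary conditions below (it differs from \<open>q' t 0\<close> when the queue is empty), so truncation is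
  required at positive ages only.  Here \<open>q'\<close> is the density usually written with a tilde.
\<close>

definition queue_truncation ::
    "(real \<Rightarrow> real \<Rightarrow> real) \<Rightarrow> (real \<Rightarrow> real \<Rightarrow> real) \<Rightarrow> (real \<Rightarrow> ereal) \<Rightarrow> bool" where
  "queue_truncation q' q w \<longleftrightarrow>
     (\<forall>t\<ge>0. 0 \<le> w t \<and> cumulative (q' t) (w t) = cumulative (q t) \<infinity> \<and>
        (\<forall>x>0. (ereal x \<le> w t \<longrightarrow> q t x = q' t x) \<and> (w t < ereal x \<longrightarrow> q t x = 0)))"

text \<open>
  The first clause makes the three regimes below mutually exclusive and exhaustive: a queue can be
  present only when all servers are busy.  A time at which the service rate \<open>\<sigma>\<close> is infinite
  imposes no condition on \<open>b t 0\<close> in the overloaded regime; in the critical regime the minimum is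
  always finite.
\<close>

definition boundary_conditions ::
    "(real \<Rightarrow> real) \<Rightarrow> (real \<Rightarrow> real) \<Rightarrow> (real \<Rightarrow> real) \<Rightarrow>
     (real \<Rightarrow> real \<Rightarrow> real) \<Rightarrow> (real \<Rightarrow> real \<Rightarrow> real) \<Rightarrow> (real \<Rightarrow> real \<Rightarrow> real) \<Rightarrow> bool" where
  "boundary_conditions Gs gs lam b q' q \<longleftrightarrow>
     (\<forall>t\<ge>0.
        let \<sigma> = density_rate Gs gs (b t);
            Btot = cumulative (b t) \<infinity>;
            Qtot = cumulative (q t) \<infinity>
        in
          (Btot < 1 \<longrightarrow> Qtot = 0) \<and>
          (Btot < 1 \<longrightarrow> b t 0 = lam t) \<and>
          (Btot = 1 \<and> Qtot = 0 \<longrightarrow> ennreal (b t 0) = min \<sigma> (ennreal (lam t))) \<and>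
          (Btot = 1 \<and> Qtot > 0 \<and> \<sigma> < \<infinity> \<longrightarrow> ennreal (b t 0) = \<sigma>) \<and>
          q' t 0 = lam t \<and>
          (Qtot > 0 \<longrightarrow> q t 0 = lam t) \<and>
          (Btot = 1 \<and> Qtot = 0 \<longrightarrow> q t 0 = lam t - enn2real (min \<sigma> (ennreal (lam t)))) \<and>
          (Btot < 1 \<longrightarrow> q t 0 = 0))"

definition flow_conservation ::
    "(real \<Rightarrow> real) \<Rightarrow> (real \<Rightarrow> real) \<Rightarrow> (real \<Rightarrow> real) \<Rightarrow>
     (real \<Rightarrow> real \<Rightarrow> real) \<Rightarrow> (real \<Rightarrow> real \<Rightarrow> real) \<Rightarrow> bool" where
  "flow_conservation Gr gr lam b q \<longleftrightarrow>
     (let entry = (\<lambda>s. ennreal (b s 0));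
          \<alpha> = (\<lambda>s. density_rate Gr gr (q s))
      in locally_integrable entry \<and> locally_integrable \<alpha> \<and>
         (\<forall>t\<ge>0. (LBINT s:{0..t}. lam s) + cumulative (q 0) \<infinity> =
            cumulative (q t) \<infinity> + time_integral entry t + time_integral \<alpha> t))"

text \<open>
  The input densities \<open>q0\<close> and \<open>b0\<close> prescribe the initial densities at positive ages; the values at
  age \<open>0\<close> are prescribed, at time \<open>0\<close> as at any other time, by the boundary conditions.
\<close>

definition two_parameter_fluid_model ::
    "(real \<Rightarrow> real) \<Rightarrow> (real \<Rightarrow> real) \<Rightarrow> (real \<Rightarrow> real) \<Rightarrow> (real \<Rightarrow> real) \<Rightarrow>
     (real \<Rightarrow> real) \<Rightarrow> (real \<Rightarrow> real) \<Rightarrow> (real \<Rightarrow> real) \<Rightarrow>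
     (real \<Rightarrow> ereal \<Rightarrow> real) \<Rightarrow> (real \<Rightarrow> ereal \<Rightarrow> real) \<Rightarrow> bool" where
  "two_parameter_fluid_model Gs gs Gr gr lam q0 b0 B Q \<longleftrightarrow>
     (\<exists>b q' q w.
        (\<forall>t\<ge>0. age_density Gs (b t) \<and> age_density Gr (q' t) \<and> age_density Gr (q t)) \<and>
        (\<forall>t\<ge>0. \<forall>y\<ge>0. B t y = cumulative (b t) y \<and> B t y \<le> 1 \<and> Q t y = cumulative (q t) y) \<and>
        (\<forall>x>0. b 0 x = b0 x \<and> q' 0 x = q0 x \<and> q 0 x = q0 x) \<and>
        ages_along Gs b \<and>
        ages_along Gr q' \<and>
        queue_truncation q' q w \<and>
        boundary_conditions Gs gs lam b q' q \<and>
        flow_conservation Gr gr lam b q)"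

section \<open>The measure-valued fluid model\<close>

text \<open>
  The condition that a measure have its support in the half-open age interval means that it is
  concentrated there.
\<close>

definition age_measure :: "(real \<Rightarrow> real) \<Rightarrow> real measure \<Rightarrow> bool" where
  "age_measure G \<mu> \<longleftrightarrow>
     sets \<mu> = sets borel \<and> finite_measure \<mu> \<and> emeasure \<mu> (- ages G) = 0"

definition initial_states ::
    "(real \<Rightarrow> real) \<Rightarrow> (real \<Rightarrow> real) \<Rightarrow> (real measure \<times> real measure \<times> real) set" where
  "initial_states Gs Gr =
     {(\<eta>, \<nu>, x). age_measure Gr \<eta> \<and> age_measure Gs \<nu> \<and> 0 \<le> x \<and>
        1 - measure \<nu> (ages Gs) = max (1 - x) 0 \<and>
        measure \<nu> (ages Gs) + measure \<eta> (ages Gr) = x}"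

definition bounded_continuous :: "(real \<Rightarrow> real) \<Rightarrow> bool" where
  "bounded_continuous \<psi> \<longleftrightarrow> continuous_on {0..} \<psi> \<and> bounded (\<psi> ` {0..})"

definition departure_rate ::
    "(real \<Rightarrow> real) \<Rightarrow> (real \<Rightarrow> real) \<Rightarrow> (real \<Rightarrow> real measure) \<Rightarrow> real \<Rightarrow> ennreal" where
  "departure_rate Gs gs \<nu> s = (\<integral>\<^sup>+x\<in>ages Gs. ennreal (hazard Gs gs x) \<partial>\<nu> s)"

definition service_entry ::
    "(real \<Rightarrow> real) \<Rightarrow> (real \<Rightarrow> real) \<Rightarrow> (real \<Rightarrow> real measure) \<Rightarrow> real \<Rightarrow> real" where
  "service_entry Gs gs \<nu> t =
     measure (\<nu> t) (ages Gs) + time_integral (departure_rate Gs gs \<nu>) t - measure (\<nu> 0) (ages Gs)"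

definition queue_length :: "(real \<Rightarrow> real) \<Rightarrow> real \<Rightarrow> real" where
  "queue_length X t = max (X t - 1) 0"

text \<open>The infimum is taken in the extended reals, so it is infinite over the empty set.\<close>

definition queue_front ::
    "(real \<Rightarrow> real) \<Rightarrow> (real \<Rightarrow> real measure) \<Rightarrow> (real \<Rightarrow> real) \<Rightarrow> real \<Rightarrow> ereal" where
  "queue_front Gr \<eta> X s =
     Inf {ereal x | x. x \<in> ages Gr \<and> queue_length X s \<le> measure (\<eta> s) {0..x}}"

definition reneging_rate ::
    "(real \<Rightarrow> real) \<Rightarrow> (real \<Rightarrow> real) \<Rightarrow> (real \<Rightarrow> real measure) \<Rightarrow> (real \<Rightarrow> real) \<Rightarrow> real \<Rightarrow> ennreal"
  where
  "reneging_rate Gr gr \<eta> X s =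
     (\<integral>\<^sup>+x\<in>{x \<in> ages Gr. ereal x \<le> queue_front Gr \<eta> X s}. ennreal (hazard Gr gr x) \<partial>\<eta> s)"

text \<open>
  The measure \<open>dK\<close> of a nondecreasing right-continuous \<open>K\<close> on the half line.  As the process \<open>K\<close>
  used below vanishes at \<open>0\<close>, there is no atom at \<open>0\<close>.
\<close>

definition stieltjes_measure :: "(real \<Rightarrow> real) \<Rightarrow> real measure" where
  "stieltjes_measure K = interval_measure (\<lambda>s. K (max 0 s))"

definition measure_valued_fluid_model ::
    "(real \<Rightarrow> real) \<Rightarrow> (real \<Rightarrow> real) \<Rightarrow> (real \<Rightarrow> real) \<Rightarrow> (real \<Rightarrow> real) \<Rightarrow>
     (real \<Rightarrow> real) \<Rightarrow> real measure \<Rightarrow> real measure \<Rightarrow> real \<Rightarrow>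
     (real \<Rightarrow> real measure) \<Rightarrow> (real \<Rightarrow> real measure) \<Rightarrow> (real \<Rightarrow> real) \<Rightarrow> bool" where
  "measure_valued_fluid_model Gs gs Gr gr lam \<eta>0 \<nu>0 X0 \<eta> \<nu> X \<longleftrightarrow>
     (let K = service_entry Gs gs \<nu>;
          Q = queue_length X;
          B = (\<lambda>t. measure (\<nu> t) {0..});
          R = time_integral (reneging_rate Gr gr \<eta> X)
      in
        (\<eta>0, \<nu>0, X0) \<in> initial_states Gs Gr \<and>
        \<eta> 0 = \<eta>0 \<and> \<nu> 0 = \<nu>0 \<and> X 0 = X0 \<and>
        (\<forall>t\<ge>0. age_measure Gr (\<eta> t) \<and> age_measure Gs (\<nu> t)) \<and>
        locally_integrable (departure_rate Gs gs \<nu>) \<and>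
        locally_integrable (reneging_rate Gr gr \<eta> X) \<and>
        mono_on {0..} K \<and> (\<forall>t\<ge>0. continuous (at_right t) K) \<and>
        (\<forall>\<psi>. bounded_continuous \<psi> \<longrightarrow>
          (\<forall>t\<ge>0.
            (LINT x:{0..}|\<eta> t. \<psi> x) =
              (LINT x:ages Gr|\<eta>0. \<psi> (x + t) * (survival Gr (x + t) / survival Gr x)) +
              (LBINT s:{0..t}. \<psi> (t - s) * survival Gr (t - s) * lam s) \<and>
            (LINT x:{0..}|\<nu> t. \<psi> x) =
              (LINT x:ages Gs|\<nu>0. \<psi> (x + t) * (survival Gs (x + t) / survival Gs x)) +
              (LINT s:{0..t}|stieltjes_measure K. \<psi> (t - s) * survival Gs (t - s)))) \<and>
        (\<forall>t\<ge>0.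
          (LBINT s:{0..t}. lam s) + Q 0 = Q t + K t + R t \<and>
          B t = min (X t) 1 \<and> B t = 1 - max (1 - X t) 0 \<and>
          Q t * (1 - B t) = 0))"

end

theory Submission
  imports Defs
begin

text \<open>
  Both models transport mass along the characteristics \<open>x - t = const\<close>: a density that decays along
  them like the survival function \<open>S\<close> equals \<open>k (t - x) S x\<close> for \<open>x \<le> t\<close> and
  \<open>f (x - t) S x / S (x - t)\<close> for \<open>x > t\<close>, where \<open>k\<close> is its value at age \<open>0\<close> and \<open>f\<close> its initial value.
  Hence the densities of a two-parameter model are the densities of the measures of a
  measure-valued model with \<open>K' = b(\<cdot>, 0)\<close>, the formula for \<open>K\<close> being the mass balance of \<open>b\<close>.

  In the converse direction the point is that \<open>K\<close> is absolutely continuous with a derivative that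
  obeys the boundary conditions.  Flow conservation reads \<open>X = X 0 + \<integral> (\<lambda> - \<sigma> - \<rho>)\<close> with the
  service rate \<open>\<sigma>\<close> and the reneging rate \<open>\<rho>\<close>, so that \<open>min X 1\<close> has the derivative \<open>\<lambda> - \<sigma>\<close> on
  \<open>X < 1\<close> and \<open>0\<close> elsewhere.  Therefore \<open>K'\<close> is \<open>\<lambda>\<close> on \<open>X < 1\<close> and \<open>\<sigma>\<close> on \<open>X \<ge> 1\<close>, and
  \<open>\<sigma> = \<lambda>\<close> almost everywhere on the level set \<open>X = 1\<close>, where \<open>X' = 0\<close>.  The two constructions are
  inverse to each other, hence existence and uniqueness carry over.
\<close>

section \<open>Lifetime distributions\<close>

text \<open>Two mismatches shape the correspondence. The conditions on densities at age
  \<open>0\<close> hold at every time, while the measures determine \<open>K'\<close> only almost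
  everywhere; so the candidate for \<open>K'\<close> is dictated by the boundary conditions at each
  single time and only then shown to integrate to \<open>K\<close>. Similarly, the queue boundary
  and the queue front are different objects that may disagree where the potential queue carries no
  mass. Only the mass that they cut off matters for queue length and reneging.

  The potential queue consists of all arrivals that are still patient, whether or not they have
  entered service. It is transported from arrivals and initial data alone, so \<eta> is the same in
  every model. Hence \<nu> is read off from \<open>B\<close>, the state \<open>X\<close> from the
  total masses, and conversely \<open>Q\<close> is the minimum of the cumulative potential queue and
  the queue length. These readings carry uniqueness over even though densities and boundaries are
  not determined.

  A measure-valued model does not state that the queue fits into the potential queue. This has to be
  extracted from the dynamics before the front can be used as a boundary.\<close>

locale lifetime =
  fixes G g :: "real \<Rightarrow> real"
  assumes law: "lifetime_distribution G g"
begin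

lemma g_nonneg: "0 \<le> x \<Longrightarrow> 0 \<le> g x"
  using law by (auto simp: lifetime_distribution_def)

lemma g_measurable [measurable]: "(\<lambda>x. indicator {0..} x * g x) \<in> borel_measurable borel"
  using law by (simp add: lifetime_distribution_def set_borel_measurable_def)

sublocale real_distribution "density_measure g"
  using law by (simp add: lifetime_distribution_def)

lemma G_cdf: "G = cdf (density_measure g)"
  using law by (simp add: lifetime_distribution_def)

lemma G_mono: "x \<le> y \<Longrightarrow> G x \<le> G y"
  by (simp add: G_cdf cdf_nondecreasing)

lemma G_le_1: "G x \<le> 1"
  by (simp add: G_cdf cdf_bounded_prob)

lemma no_atom: "measure (density_measure g) {x} = 0"
proof -
  have "AE y in lborel. y \<noteq> x"
    by (rule AE_lborel_singleton)
  then have "AE y in lborel. ennreal (indicator {0..} y * g y) * indicator {x} y = 0"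
    by eventually_elim auto
  then have "emeasure (density_measure g) {x} = 0"
    unfolding density_measure_def
    by (subst emeasure_density) (simp_all add: nn_integral_0_iff_AE)
  then show ?thesis by (simp add: measure_def)
qed

lemma G_isCont: "isCont G x"
  by (simp add: G_cdf isCont_cdf no_atom)

lemma G_0: "G 0 = 0"
proof -
  have "(G \<longlongrightarrow> 0) (at_right 0)"
    using law unfolding lifetime_distribution_def by blast
  moreover have "(G \<longlongrightarrow> G 0) (at_right 0)"
    using G_isCont[of 0] by (auto simp: isCont_def intro: tendsto_mono[OF at_le])
  ultimately show ?thesis
    using tendsto_unique trivial_limit_at_right_real by blast
qed

lemma G_measurable [measurable]: "G \<in> borel_measurable borel"
  by (intro borel_measurable_mono monoI G_mono)

lemma survival_measurable [measurable]: "survival G \<in> borel_measurable borel"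
  by (simp add: survival_def[abs_def])

lemma survival_bounds: "0 \<le> survival G x" "survival G x \<le> 1"
  using G_le_1[of x] cdf_nonneg[of x] by (auto simp: survival_def G_cdf)

lemma survival_0: "survival G 0 = 1"
  by (simp add: survival_def G_0)

lemma survival_antimono: "x \<le> y \<Longrightarrow> survival G y \<le> survival G x"
  by (simp add: survival_def G_mono)

text \<open>\<open>G\<close> is monotone with values at most 1, so ages below the endpoint have
  positive survival. Conversely, continuity keeps \<open>G\<close> below 1 on a whole neighbourhood,
  which leaves room between the age and the endpoint. From here on positivity of
  \<open>survival G\<close> replaces the extended-real endpoint.\<close>

lemma ages_eq: "ages G = {x. 0 \<le> x \<and> 0 < survival G x}"
proof (intro set_eqI iffI)
  fix x assume "x \<in> ages G"
  then have x: "0 \<le> x" "ereal x < endpoint G" by (auto simp: ages_def)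
  have "G x \<noteq> 1"
  proof
    assume "G x = 1"
    then have "endpoint G \<le> ereal x"
      unfolding endpoint_def using x by (intro Inf_lower) auto
    then show False using x by simp
  qed
  then show "x \<in> {x. 0 \<le> x \<and> 0 < survival G x}"
    using x G_le_1[of x] by (simp add: survival_def)
next
  fix x assume "x \<in> {x. 0 \<le> x \<and> 0 < survival G x}"
  then have x: "0 \<le> x" "G x < 1" by (auto simp: survival_def)
  have "\<forall>\<^sub>F y in at x. G y < 1"
    using G_isCont[of x] x by (auto simp: isCont_def intro: order_tendstoD)
  then obtain d where d: "d > 0" "\<And>y. y \<noteq> x \<Longrightarrow> dist y x < d \<Longrightarrow> G y < 1"
    unfolding eventually_at by auto
  have "ereal (x + d) \<le> endpoint G"
    unfolding endpoint_def
  proof (rule Inf_greatest)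
    fix z assume "z \<in> {ereal x |x. 0 \<le> x \<and> G x = 1}"
    then obtain y where y: "z = ereal y" "G y = 1" by auto
    have "\<not> y \<le> x" using G_mono[of y x] x y by auto
    moreover have "\<not> dist y x < d" using d(2)[of y] y x by (cases "y = x") auto
    ultimately show "ereal (x + d) \<le> z" using y by (auto simp: dist_real_def)
  qed
  moreover have "ereal x < ereal (x + d)" using d by simp
  ultimately have "ereal x < endpoint G" by (rule less_le_trans[rotated])
  then show "x \<in> ages G"
    using x by (auto simp: ages_def)
qed

lemma ages_measurable [measurable]: "ages G \<in> sets borel"
  unfolding ages_eq by measurable

lemma zero_in_ages: "0 \<in> ages G"
  by (simp add: ages_eq survival_0)

lemma ages_nonneg: "x \<in> ages G \<Longrightarrow> 0 \<le> x"
  by (simp add: ages_eq)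

lemma ages_downward: "x \<in> ages G \<Longrightarrow> 0 \<le> y \<Longrightarrow> y \<le> x \<Longrightarrow> y \<in> ages G"
  using survival_antimono[of y x] by (auto simp: ages_eq)

lemma survival_pos: "x \<in> ages G \<Longrightarrow> 0 < survival G x"
  by (simp add: ages_eq)

lemma survival_eq_0: "0 \<le> x \<Longrightarrow> x \<notin> ages G \<Longrightarrow> survival G x = 0"
  using survival_bounds(1)[of x] by (auto simp: ages_eq)

lemma hazard_nonneg: "x \<in> ages G \<Longrightarrow> 0 \<le> hazard G g x"
  using g_nonneg[of x] survival_bounds by (simp add: hazard_def ages_nonneg)

lemma hazard_measurable [measurable]:
  "(\<lambda>x. indicator (ages G) x * hazard G g x) \<in> borel_measurable borel"
proof -
  have "(\<lambda>x. indicator (ages G) x * ((indicator {0..} x * g x) / survival G x)) \<in> borel_measurable borel"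
    by measurable
  also have "(\<lambda>x. indicator (ages G) x * ((indicator {0..} x * g x) / survival G x)) =
      (\<lambda>x. indicator (ages G) x * hazard G g x)"
    by (auto simp: fun_eq_iff hazard_def indicator_def ages_nonneg)
  finally show ?thesis .
qed

text \<open>The law has no mass beyond the point where \<open>G\<close> first reaches 1, so its
  density vanishes almost everywhere there; the level set is closed and therefore contains its
  infimum. Hazards live on \<open>ages G\<close> only, and this shows that restricting
  \<open>g\<close> to these ages loses nothing.\<close>

lemma AE_g_ages: "AE x in lborel. indicator {0..} x * g x = indicator (ages G) x * g x"
proof (cases "\<exists>x\<ge>0. G x = 1")
  case False
  then have "x \<in> ages G \<longleftrightarrow> 0 \<le> x" for x
    using G_le_1[of x] by (auto simp: ages_eq survival_def less_le)
  then show ?thesis by (auto simp: indicator_def)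
next
  case True
  define Z where "Z = {x. 0 \<le> x \<and> G x = 1}"
  define H where "H = Inf Z"
  have Z: "Z \<noteq> {}" "bdd_below Z" using True by (auto simp: Z_def)
  have "Z = {0..} \<inter> G -` {1}" by (auto simp: Z_def)
  moreover have "closed (G -` {1})"
    by (intro continuous_closed_vimage) (auto simp: G_isCont)
  ultimately have "closed Z" by auto
  then have "H \<in> Z" unfolding H_def using Z by (rule closed_contains_Inf[rotated 2])
  then have "G H = 1" by (simp add: Z_def)
  then have "measure (density_measure g) {H<..} = 0"
    using prob_compl[of "{..H}"] by (simp add: G_cdf cdf_def Compl_eq_Diff_UNIV[symmetric])
  then have "emeasure (density_measure g) {H<..} = 0"
    by (simp add: emeasure_eq_measure)
  then have "(\<integral>\<^sup>+x. ennreal (indicator {0..} x * g x) * indicator {H<..} x \<partial>lborel) = 0"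
    unfolding density_measure_def by (subst (asm) emeasure_density) auto
  then have "AE x in lborel. ennreal (indicator {0..} x * g x) * indicator {H<..} x = 0"
    by (subst (asm) nn_integral_0_iff_AE) auto
  moreover have "AE x in lborel. x \<noteq> H" by (rule AE_lborel_singleton)
  ultimately show ?thesis
  proof eventually_elim
    case (elim x)
    consider "x < 0" | "0 \<le> x" "x < H" | "0 \<le> x" "H < x" using elim by fastforce
    then show ?case
    proof cases
      case 1 then show ?thesis by (auto simp: indicator_def dest: ages_nonneg)
    next
      case 2
      then have "x \<notin> Z" using Z unfolding H_def using cInf_lower[of x Z] by auto
      then have "x \<in> ages G" using 2 G_le_1[of x] by (auto simp: Z_def ages_eq survival_def)
      then show ?thesis using 2 by simp
    next
      case 3
      then show ?thesis using elim g_nonneg[of x] by (auto simp: indicator_def)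
    qed
  qed
qed

lemma g_ages_measurable [measurable]: "(\<lambda>x. indicator (ages G) x * g x) \<in> borel_measurable borel"
proof -
  have "(\<lambda>x. indicator (ages G) x * (indicator {0..} x * g x)) \<in> borel_measurable borel"
    by measurable
  also have "(\<lambda>x. indicator (ages G) x * (indicator {0..} x * g x)) = (\<lambda>x. indicator (ages G) x * g x)"
    by (auto simp: fun_eq_iff indicator_def ages_nonneg)
  finally show ?thesis .
qed

text \<open>The density accumulated while ageing from \<open>x\<close> to \<open>x + t\<close> is
  the survival lost on the way. With \<open>x\<close> an initial age, or \<open>x = 0\<close> for a
  newcomer, it supplies the departure terms of the mass balance.\<close>

lemma nn_integral_g_ages:
  assumes "0 \<le> x" "0 \<le> t"
  shows "(\<integral>\<^sup>+s. ennreal (indicator (ages G) (x + s) * g (x + s)) * indicator {0..t} s \<partial>lborel) =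
    ennreal (survival G x - survival G (x + t))"
proof -
  have "(\<integral>\<^sup>+s. ennreal (indicator (ages G) (x + s) * g (x + s)) * indicator {0..t} s \<partial>lborel) =
     (\<integral>\<^sup>+s. (\<lambda>y. ennreal (indicator (ages G) y * g y) * indicator {x..x+t} y) (x + 1 * s) \<partial>lborel)"
    by (intro nn_integral_cong) (auto simp: indicator_def)
  also have "\<dots> = (\<integral>\<^sup>+y. ennreal (indicator (ages G) y * g y) * indicator {x..x+t} y \<partial>lborel)"
    by (subst (2) nn_integral_real_affine[where c=1 and t=x]) auto
  \<comment> \<open>Differences of a distribution function measure left-open intervals; the left
    endpoint is a null set.\<close>
  also have "\<dots> = (\<integral>\<^sup>+y. ennreal (indicator {0..} y * g y) * indicator {x<..x+t} y \<partial>lborel)"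
    using AE_g_ages AE_lborel_singleton[of x]
    by (intro nn_integral_cong_AE, eventually_elim) (auto simp: indicator_def)
  also have "\<dots> = emeasure (density_measure g) {x<..x+t}"
    unfolding density_measure_def by (subst emeasure_density) auto
  also have "\<dots> = ennreal (survival G x - survival G (x + t))"
    using assms by (simp add: emeasure_Ioc survival_def G_cdf)
  finally show ?thesis .
qed

end

section \<open>Measures and time integrals on the half line\<close>

text \<open>Finiteness is asked of half-lines only, since the Stieltjes measure of an unbounded
  entry process has infinite total mass.\<close>

lemma measure_eqI_atMost:
  fixes M N :: "real measure"
  assumes "sets M = sets borel" "sets N = sets borel"
    and eq: "\<And>t. emeasure M {..t} = emeasure N {..t}"
    and fin: "\<And>t. emeasure M {..t} \<noteq> \<infinity>"
  shows "M = N"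
proof (rule measure_eqI_generator_eq[where \<Omega>=UNIV and E="range (\<lambda>a. {..a::real})"
      and A="\<lambda>i. {..real i}"])
  show "Int_stable (range (\<lambda>a. {..a::real}))"
    by (auto simp: Int_stable_def min_def)
  have "sets borel = sigma_sets UNIV (range (\<lambda>a. {..a::real}))"
    by (subst borel_eq_atMost) simp
  then show "sets M = sigma_sets UNIV (range (\<lambda>a. {..a::real}))"
    "sets N = sigma_sets UNIV (range (\<lambda>a. {..a::real}))"
    using assms(1,2) by auto
  show "(\<Union>i. {..real i}) = UNIV"
    using real_arch_simple by auto
qed (use eq fin in auto)

lemma cts_step_bounds:
  assumes "a < b"
  shows "0 \<le> cts_step a b x" "cts_step a b x \<le> 1"
  using assms by (auto simp: cts_step_def divide_simps)

text \<open>Ramps that fall from 1 at \<open>t\<close> to 0 at \<open>t + 1 / Suc n\<close> decrease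
  to the indicator of \<open>{..t}\<close>, so the test integrals determine the distribution
  functions. They see the half-line only; the negative numbers are handled by assuming them
  null.\<close>

lemma measure_eqI_bounded_continuous:
  fixes M N :: "real measure"
  assumes M: "finite_measure M" "sets M = sets borel" "emeasure M {..<0} = 0"
    and N: "finite_measure N" "sets N = sets borel" "emeasure N {..<0} = 0"
    and eq: "\<And>\<psi>. bounded_continuous \<psi> \<Longrightarrow> (LINT x:{0..}|M. \<psi> x) = (LINT x:{0..}|N. \<psi> x)"
  shows "M = N"
proof (rule measure_eqI_atMost)
  fix t :: real
  interpret M: finite_measure M by fact
  interpret N: finite_measure N by fact
  note [measurable_cong] = M(2) N(2)
  have step: "cts_step t (t + 1 / real (Suc n)) \<in> borel_measurable borel" for n
    by (intro borel_measurable_continuous_onI uniformly_continuous_imp_continuous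
        cts_step_uniformly_continuous) simp
  note [measurable] = step
  have lim: "(\<lambda>n. LINT x:{0..}|L. cts_step t (t + 1 / real (Suc n)) x) \<longlonglongrightarrow> measure L ({0..} \<inter> {..t})"
    if L: "finite_measure L" and [measurable_cong]: "sets L = sets borel" for L :: "real measure"
  proof -
    interpret L: finite_measure L by fact
    have "(\<lambda>n. LINT x|L. indicator {0..} x *\<^sub>R cts_step t (t + 1 / real (Suc n)) x) \<longlonglongrightarrow>
      (LINT x|L. indicator ({0..} \<inter> {..t}) x)"
    proof (rule integral_dominated_convergence[where w="\<lambda>_. 1"])
      show "AE x in L. (\<lambda>n. indicator {0..} x *\<^sub>R cts_step t (t + 1 / real (Suc n)) x) \<longlonglongrightarrow>
          indicator ({0..} \<inter> {..t}) x"
      proof (rule AE_I2)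
        fix x
        show "(\<lambda>n. indicator {0..} x *\<^sub>R cts_step t (t + 1 / real (Suc n)) x) \<longlonglongrightarrow>
          indicator ({0..} \<inter> {..t}) x"
        proof (cases "x \<le> t")
          case True
          then show ?thesis by (simp add: cts_step_def indicator_def)
        next
          case False
          then have "0 < x - t" by simp
          then obtain n0 where n0: "inverse (real (Suc n0)) < x - t"
            using reals_Archimedean by blast
          have "\<forall>\<^sub>F n in sequentially. cts_step t (t + 1 / real (Suc n)) x = 0"
            using eventually_ge_at_top[of n0]
          proof eventually_elim
            case (elim n)
            then have "1 / real (Suc n) \<le> inverse (real (Suc n0))"
              by (simp add: divide_simps)
            then have "t + 1 / real (Suc n) \<le> x" using n0 by simp
            then show ?case using False by (simp add: cts_step_def)
          qed
          then have "\<forall>\<^sub>F n in sequentially. indicator {0..} x *\<^sub>R cts_step t (t + 1 / real (Suc n)) x =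
            indicator ({0..} \<inter> {..t}) x"
            by eventually_elim (use False in simp)
          then show ?thesis by (rule tendsto_eventually)
        qed
      qed
      show "AE x in L. norm (indicator {0..} x *\<^sub>R cts_step t (t + 1 / real (Suc n)) x) \<le> 1" for n
        using cts_step_bounds[of t "t + 1 / real (Suc n)" for n] by (auto simp: indicator_def)
    qed (auto simp del: of_nat_Suc)
    then show ?thesis
      by (simp add: set_lebesgue_integral_def)
  qed
  have "bounded_continuous (cts_step t (t + 1 / real (Suc n)))" for n
    unfolding bounded_continuous_def
  proof
    show "continuous_on {0..} (cts_step t (t + 1 / real (Suc n)))"
      by (rule continuous_on_subset[OF uniformly_continuous_imp_continuous
            [OF cts_step_uniformly_continuous]]) simp_all
    show "bounded (cts_step t (t + 1 / real (Suc n)) ` {0..})"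
      unfolding bounded_iff 
      by (rule exI[of _ 1]) (auto simp: abs_le_iff cts_step_bounds order_trans[OF _ cts_step_bounds(1)])
  qed
  then have "measure M ({0..} \<inter> {..t}) = measure N ({0..} \<inter> {..t})"
    using lim[OF M(1,2)] lim[OF N(1,2)] eq by (simp add: LIMSEQ_unique)
  then have "emeasure M ({0..} \<inter> {..t}) = emeasure N ({0..} \<inter> {..t})"
    by (simp add: M.emeasure_eq_measure N.emeasure_eq_measure)
  moreover have "emeasure L {..t} = emeasure L ({0..} \<inter> {..t})"
    if L: "sets L = sets borel" "emeasure L {..<0} = 0" for L :: "real measure"
  proof (rule emeasure_eq_AE)
    have "{..<0} \<in> null_sets L" using L by (intro null_setsI) auto
    then have "AE x in L. x \<notin> {..<0}" by (rule AE_not_in)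
    then show "AE x in L. (x \<in> {..t}) = (x \<in> {0..} \<inter> {..t})" by eventually_elim auto
  qed (use L in auto)
  ultimately show "emeasure M {..t} = emeasure N {..t}"
    using M N by simp
  show "emeasure M {..t} \<noteq> \<infinity>"
    by (simp add: M.emeasure_eq_measure)
qed (use assms in auto)

section \<open>Indefinite integrals and their Stieltjes measures\<close>

lemma set_lborel_integral_Ioc:
  fixes f :: "real \<Rightarrow> real"
  assumes "set_integrable lborel {0..t} f" "0 \<le> r" "r \<le> t"
  shows "(LBINT s:{0..t}. f s) = (LBINT s:{0..r}. f s) + (LBINT s:{r<..t}. f s)"
proof -
  have "{0..t} = {0..r} \<union> {r<..t}" using assms by auto
  then show ?thesis
    using assms(1) by (auto intro!: set_integral_Un intro: set_integrable_subset)
qed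

lemma continuous_on_LBINT:
  fixes f :: "real \<Rightarrow> real"
  assumes int: "\<And>t. 0 \<le> t \<Longrightarrow> set_integrable lborel {0..t} f"
  shows "continuous_on {0..} (\<lambda>t. LBINT s:{0..t}. f s)"
  unfolding continuous_on_eq_continuous_within
proof
  fix x :: real assume x: "x \<in> {0..}"
  have "continuous_on {0..x+1} (\<lambda>t. integral {0..t} f)"
    using set_borel_integral_eq_integral(1)[OF int[of "x + 1"]] x
    by (intro indefinite_integral_continuous_1) auto
  then have "continuous_on {0..x+1} (\<lambda>t. LBINT s:{0..t}. f s)"
    by (rule continuous_on_eq) (use set_borel_integral_eq_integral(2)[OF int] in auto)
  then have "continuous (at x within {0..x+1}) (\<lambda>t. LBINT s:{0..t}. f s)"
    using x by (auto simp: continuous_on_eq_continuous_within)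
  moreover have "at x within {0..x+1} = at x within {0..}"
    using x by (intro at_within_nhd[of x "{..<x+1}"]) auto
  ultimately show "continuous (at x within {0..}) (\<lambda>t. LBINT s:{0..t}. f s)"
    by simp
qed

text \<open>Both measures have the primitive of \<open>k\<close> as distribution function. Freezing
  it at its value 0 on the negative numbers gives the limit 0 at minus infinity and no atom at
  0.\<close>

lemma stieltjes_measure_eq_density:
  fixes k :: "real \<Rightarrow> real"
  assumes [measurable]: "k \<in> borel_measurable borel"
    and nonneg: "\<And>s. 0 \<le> k s" and neg: "\<And>s. s < 0 \<Longrightarrow> k s = 0"
    and int: "\<And>t. 0 \<le> t \<Longrightarrow> set_integrable lborel {0..t} k"
    and K: "\<And>t. 0 \<le> t \<Longrightarrow> K t = (LBINT s:{0..t}. k s)"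
  shows "stieltjes_measure K = density lborel (\<lambda>s. ennreal (k s))"
proof (rule measure_eqI_atMost)
  define F where "F s = K (max 0 s)" for s
  have F: "F s = (LBINT s:{0..max 0 s}. k s)" for s
    by (simp add: F_def K)
  have mono: "F x \<le> F y" if "x \<le> y" for x y
    unfolding F using that set_lborel_integral_Ioc[OF int, of "max 0 y" "max 0 x"]
    by (auto simp: set_lebesgue_integral_def nonneg)
  have "continuous_on UNIV ((\<lambda>t. LBINT s:{0..t}. k s) \<circ> max 0)"
    by (intro continuous_on_compose continuous_intros continuous_on_subset[OF continuous_on_LBINT[OF int]])
       auto
  then have cont: "isCont F x" for x
    by (simp add: F[abs_def] comp_def continuous_on_eq_continuous_at)
  have F0: "F s = 0" if "s \<le> 0" for s
    using that AE_lborel_singleton[of "0::real"] unfolding F set_lebesgue_integral_def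
    by (intro integral_eq_zero_AE) (auto elim!: eventually_mono simp: max_absorb1)
  have bot: "(F \<longlongrightarrow> 0) at_bot"
    by (rule tendsto_eventually) (auto simp: eventually_at_bot_linorder intro!: exI[of _ 0] F0)
  have "emeasure (interval_measure F) {..t} = F t" for t
    by (rule emeasure_interval_measure_Iic[OF mono _ bot])
       (auto intro: continuous_within_subset cont)
  moreover have "emeasure (density lborel (\<lambda>s. ennreal (k s))) {..t} = F t" for t
  proof -
    have "emeasure (density lborel (\<lambda>s. ennreal (k s))) {..t} =
        (\<integral>\<^sup>+s. ennreal (k s) * indicator {..t} s \<partial>lborel)"
      by (rule emeasure_density) auto
    also have "\<dots> = (\<integral>\<^sup>+s. ennreal (indicator {0..max 0 t} s *\<^sub>R k s) \<partial>lborel)"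
      using AE_lborel_singleton[of 0]
      by (intro nn_integral_cong_AE, eventually_elim) (auto simp: indicator_def neg not_le)
    also have "\<dots> = F t"
      using int[of "max 0 t"] unfolding F set_lebesgue_integral_def
      by (intro nn_integral_eq_integral) (auto simp: set_integrable_def nonneg)
    finally show ?thesis .
  qed
  moreover have "stieltjes_measure K = interval_measure F"
    by (simp add: stieltjes_measure_def F_def[abs_def])
  ultimately show
    "emeasure (stieltjes_measure K) {..t} = emeasure (density lborel (\<lambda>s. ennreal (k s))) {..t}"
    "emeasure (stieltjes_measure K) {..t} \<noteq> \<infinity>" for t
    by simp_all
qed (simp_all add: stieltjes_measure_def)

text \<open>Equal primitives generate the same Stieltjes measure, and densities with respect to a
  sigma-finite measure are unique up to null sets. No differentiation of the primitives is
  involved.\<close>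

lemma AE_eq_of_LBINT_eq:
  fixes f g :: "real \<Rightarrow> real"
  assumes [measurable]: "set_borel_measurable borel {0..} f" "set_borel_measurable borel {0..} g"
    and nonneg: "\<And>s. 0 \<le> s \<Longrightarrow> 0 \<le> f s" "\<And>s. 0 \<le> s \<Longrightarrow> 0 \<le> g s"
    and int: "\<And>t. 0 \<le> t \<Longrightarrow> set_integrable lborel {0..t} f"
      "\<And>t. 0 \<le> t \<Longrightarrow> set_integrable lborel {0..t} g"
    and eq: "\<And>t. 0 \<le> t \<Longrightarrow> (LBINT s:{0..t}. f s) = (LBINT s:{0..t}. g s)"
  shows "AE s in lborel. 0 \<le> s \<longrightarrow> f s = g s"
proof -
  have dens: "stieltjes_measure (\<lambda>t. LBINT s:{0..t}. h s) = density lborel (\<lambda>s. ennreal (indicator {0..} s * h s))"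
    if h: "set_borel_measurable borel {0..} h" "\<And>s. 0 \<le> s \<Longrightarrow> 0 \<le> h s"
      "\<And>t. 0 \<le> t \<Longrightarrow> set_integrable lborel {0..t} h" for h :: "real \<Rightarrow> real"
  proof (rule stieltjes_measure_eq_density)
    show "(\<lambda>s. indicator {0..} s * h s) \<in> borel_measurable borel"
      using h(1) by (simp add: set_borel_measurable_def)
    have *: "indicator {0..t} s *\<^sub>R (indicator {0..} s * h s) = indicator {0..t} s *\<^sub>R h s" for s t :: real
      by (simp add: indicator_def)
    show "set_integrable lborel {0..t} (\<lambda>s. indicator {0..} s * h s)" if "0 \<le> t" for t
      using h(3)[OF that] unfolding set_integrable_def * .
    show "(LBINT s:{0..t}. h s) = (LBINT s:{0..t}. indicator {0..} s * h s)" for t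
      unfolding set_lebesgue_integral_def * ..
  qed (auto simp: indicator_def h)
  have "stieltjes_measure (\<lambda>t. LBINT s:{0..t}. f s) = stieltjes_measure (\<lambda>t. LBINT s:{0..t}. g s)"
    unfolding stieltjes_measure_def using eq by simp
  then have "density lborel (\<lambda>s. ennreal (indicator {0..} s * f s)) =
      density lborel (\<lambda>s. ennreal (indicator {0..} s * g s))"
    using dens[of f] dens[of g] assms by simp
  then have "AE s in lborel. ennreal (indicator {0..} s * f s) = ennreal (indicator {0..} s * g s)"
    using assms(1,2) by (intro sigma_finite_measure.density_unique[OF sigma_finite_lborel]) (auto simp: set_borel_measurable_def)
  then show ?thesis
    by eventually_elim (auto simp: nonneg)
qed

text \<open>Finite integrals over bounded intervals force the rate to be finite almost everywhere.
  \<open>enn2real\<close> turns the exceptional infinite values into 0, which no integral notices,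
  so real-valued calculus becomes available.\<close>

lemma locally_integrable_enn2real:
  assumes "locally_integrable r"
  shows "set_borel_measurable borel {0..} (\<lambda>s. enn2real (r s))"
    and "\<And>t. 0 \<le> t \<Longrightarrow> set_integrable lborel {0..t} (\<lambda>s. enn2real (r s))"
    and "AE s in lborel. 0 \<le> s \<longrightarrow> r s = ennreal (enn2real (r s))"
    and "\<And>t. 0 \<le> t \<Longrightarrow> time_integral r t = (LBINT s:{0..t}. enn2real (r s))"
    and "\<And>t. 0 \<le> t \<Longrightarrow> ennreal (time_integral r t) = (\<integral>\<^sup>+s\<in>{0..t}. r s \<partial>lborel)"
proof -
  have m [measurable]: "(\<lambda>s. r s * indicator {0..} s) \<in> borel_measurable borel"
    and fin: "\<And>t. 0 \<le> t \<Longrightarrow> (\<integral>\<^sup>+s\<in>{0..t}. r s \<partial>lborel) < \<infinity>"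
    using assms by (auto simp: locally_integrable_def)
  have "(\<lambda>s. enn2real (r s * indicator {0..} s)) \<in> borel_measurable borel"
    by measurable
  also have "(\<lambda>s. enn2real (r s * indicator {0..} s)) = (\<lambda>s. indicator {0..} s *\<^sub>R enn2real (r s))"
    by (auto simp: indicator_def)
  finally show m': "set_borel_measurable borel {0..} (\<lambda>s. enn2real (r s))"
    unfolding set_borel_measurable_def .
  have mt: "(\<lambda>s. r s * indicator {0..t} s) \<in> borel_measurable borel" for t :: real
  proof -
    have "(\<lambda>s. (r s * indicator {0..} s) * indicator {..t} s) \<in> borel_measurable borel"
      by measurable
    also have "(\<lambda>s. (r s * indicator {0..} s) * indicator {..t} s) = (\<lambda>s. r s * indicator {0..t} s)"
      by (auto simp: indicator_def)
    finally show ?thesis .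
  qed
  \<comment> \<open>Countably many bounded intervals yield one null set for the whole
    half-line.\<close>
  have "AE s in lborel. r s * indicator {0..real n} s \<noteq> \<infinity>" for n
    using fin[of "real n"] mt by (intro nn_integral_noteq_infinite) auto
  then have "AE s in lborel. \<forall>n. r s * indicator {0..real n} s \<noteq> \<infinity>"
    by (simp add: AE_all_countable)
  then show AE: "AE s in lborel. 0 \<le> s \<longrightarrow> r s = ennreal (enn2real (r s))"
  proof eventually_elim
    case (elim s)
    obtain n where "s \<le> real n" using real_arch_simple by blast
    then show ?case using elim[rule_format, of n] by (auto simp: less_top)
  qed
  fix t :: real assume t: "0 \<le> t"
  have mt': "(\<lambda>s. indicator {0..t} s *\<^sub>R enn2real (r s)) \<in> borel_measurable borel"
  proof -
    have "(\<lambda>s. indicator {..t} s *\<^sub>R (indicator {0..} s *\<^sub>R enn2real (r s))) \<in> borel_measurable borel"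
      using m' unfolding set_borel_measurable_def by measurable
    also have "(\<lambda>s. indicator {..t} s *\<^sub>R (indicator {0..} s *\<^sub>R enn2real (r s))) =
      (\<lambda>s. indicator {0..t} s *\<^sub>R enn2real (r s))"
      by (auto simp: indicator_def)
    finally show ?thesis .
  qed
  have eq: "(\<integral>\<^sup>+s. ennreal (indicator {0..t} s *\<^sub>R enn2real (r s)) \<partial>lborel) = (\<integral>\<^sup>+s\<in>{0..t}. r s \<partial>lborel)"
    using AE by (intro nn_integral_cong_AE, eventually_elim) (auto simp: indicator_def)
  show "set_integrable lborel {0..t} (\<lambda>s. enn2real (r s))"
    unfolding set_integrable_def using mt' fin[OF t] eq
    by (intro integrableI_nonneg) auto
  show "time_integral r t = (LBINT s:{0..t}. enn2real (r s))"
    unfolding time_integral_def set_lebesgue_integral_def eq[symmetric]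
    using mt' by (intro enn2real_nn_integral_eq_integral) auto
  show "ennreal (time_integral r t) = (\<integral>\<^sup>+s\<in>{0..t}. r s \<partial>lborel)"
    using fin[OF t] unfolding time_integral_def by simp
qed

lemma locally_integrable_ennreal:
  fixes f :: "real \<Rightarrow> real"
  assumes "set_borel_measurable borel {0..} f" "\<And>s. 0 \<le> s \<Longrightarrow> 0 \<le> f s"
    and "\<And>t. 0 \<le> t \<Longrightarrow> set_integrable lborel {0..t} f"
  shows "locally_integrable (\<lambda>s. ennreal (f s))"
  unfolding locally_integrable_def
proof (intro conjI allI impI)
  have "(\<lambda>s. ennreal (indicator {0..} s *\<^sub>R f s)) \<in> borel_measurable borel"
    using assms(1) unfolding set_borel_measurable_def by measurable
  also have "(\<lambda>s. ennreal (indicator {0..} s *\<^sub>R f s)) = (\<lambda>s. ennreal (f s) * indicator {0..} s)"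
    by (auto simp: indicator_def)
  finally show "(\<lambda>s. ennreal (f s) * indicator {0..} s) \<in> borel_measurable borel" .
  fix t :: real assume "0 \<le> t"
  have "(\<integral>\<^sup>+s\<in>{0..t}. ennreal (f s) \<partial>lborel) = (\<integral>\<^sup>+s. ennreal (indicator {0..t} s *\<^sub>R f s) \<partial>lborel)"
    by (intro nn_integral_cong) (auto simp: indicator_def)
  also have "\<dots> = ennreal (LBINT s:{0..t}. f s)"
    unfolding set_lebesgue_integral_def using assms(3)[OF \<open>0 \<le> t\<close>] assms(2)
    by (intro nn_integral_eq_integral) (auto simp: set_integrable_def indicator_def)
  finally show "(\<integral>\<^sup>+s\<in>{0..t}. ennreal (f s) \<partial>lborel) < \<infinity>" by simp
qed

section \<open>The chain rule for absolutely continuous functions\<close>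

text \<open>On each cell of a partition the increment of \<open>\<phi> (X u)\<close> is
  \<open>\<phi>'\<close> at an intermediate time, multiplied by the integral of \<open>f\<close>
  over the cell. The sum is the integral of a bounded step function against \<open>f\<close>;
  refining the partition and dominated convergence give the claim. Continuity of \<open>X\<close> is
  enough, no derivative of \<open>X\<close> is taken.\<close>

lemma LBINT_chain_rule:
  fixes f X \<phi> \<phi>' :: "real \<Rightarrow> real"
  assumes t: "0 \<le> t" and f: "set_integrable lborel {0..t} f"
    and X: "\<And>s. 0 \<le> s \<Longrightarrow> s \<le> t \<Longrightarrow> X s = X 0 + (LBINT u:{0..s}. f u)"
    and contX: "continuous_on {0..t} X"
    and deriv: "\<And>x. (\<phi> has_real_derivative \<phi>' x) (at x)"
    and cont': "\<And>x. isCont \<phi>' x"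
    and bound: "\<And>x. \<bar>\<phi>' x\<bar> \<le> 1"
  shows "\<phi> (X t) - \<phi> (X 0) = (LBINT u:{0..t}. \<phi>' (X u) * f u)"
proof (cases "t = 0")
  case True
  have "(LBINT u:{0..0}. \<phi>' (X u) * f u) = 0"
    using AE_lborel_singleton[of "0::real"] unfolding set_lebesgue_integral_def
    by (intro integral_eq_zero_AE, eventually_elim) simp
  then show ?thesis using True by simp
next
  case False
  then have t: "0 < t" using t by simp
  \<comment> \<open>The mean value theorem yields a level between \<open>X a\<close> and
    \<open>X b\<close>; the intermediate value theorem turns the level into a time at which
    \<open>X\<close> attains it.\<close>
  have mean: "\<exists>c. a \<le> c \<and> c \<le> b \<and> \<phi> (X b) - \<phi> (X a) = \<phi>' (X c) * (X b - X a)"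
    if ab: "0 \<le> a" "a < b" "b \<le> t" for a b
  proof -
    have c_ab: "continuous_on {a..b} X"
      by (rule continuous_on_subset[OF contX]) (use ab in auto)
    show ?thesis
    proof (cases "X a" "X b" rule: linorder_cases)
      case equal
      then show ?thesis using ab by (intro exI[of _ a]) auto
    next
      case less
      obtain z where z: "X a < z" "z < X b" "\<phi> (X b) - \<phi> (X a) = (X b - X a) * \<phi>' z"
        using MVT2[OF less, of \<phi> \<phi>'] deriv by auto
      obtain c where "a \<le> c" "c \<le> b" "X c = z"
        using IVT'[of X a z b] z ab c_ab by auto
      then show ?thesis using z by (intro exI[of _ c]) (auto simp: mult.commute)
    next
      case greater
      obtain z where z: "X b < z" "z < X a" "\<phi> (X a) - \<phi> (X b) = (X a - X b) * \<phi>' z"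
        using MVT2[OF greater, of \<phi> \<phi>'] deriv by auto
      obtain c where "a \<le> c" "c \<le> b" "X c = z"
        using IVT2'[of X b z a] z ab c_ab by auto
      then show ?thesis using z by (intro exI[of _ c]) (auto simp: algebra_simps)
    qed
  qed
  define p where "p n i = t * real i / real (Suc n)" for n i :: nat
  have p_mono: "p n i < p n (Suc i)" for n i
    using t by (simp add: p_def divide_strict_right_mono)
  have p_0: "p n 0 = 0" and p_t: "p n (Suc n) = t" and p_nonneg: "0 \<le> p n i" for n i
    using t by (simp_all add: p_def)
  have p_le: "p n i \<le> t" if "i \<le> Suc n" for n i
    using t that by (simp add: p_def divide_simps)
  have "\<forall>n i. \<exists>c. i \<le> n \<longrightarrow> p n i \<le> c \<and> c \<le> p n (Suc i) \<and>
      \<phi> (X (p n (Suc i))) - \<phi> (X (p n i)) = \<phi>' (X c) * (X (p n (Suc i)) - X (p n i))"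
    using mean[OF p_nonneg p_mono p_le] by (metis Suc_le_mono)
  from this[unfolded choice_iff] obtain c where "\<forall>n i. i \<le> n \<longrightarrow> p n i \<le> c n i \<and> c n i \<le> p n (Suc i) \<and>
      \<phi> (X (p n (Suc i))) - \<phi> (X (p n i)) = \<phi>' (X (c n i)) * (X (p n (Suc i)) - X (p n i))" ..
  then have c: "\<And>n i. i \<le> n \<Longrightarrow> p n i \<le> c n i \<and> c n i \<le> p n (Suc i) \<and>
      \<phi> (X (p n (Suc i))) - \<phi> (X (p n i)) = \<phi>' (X (c n i)) * (X (p n (Suc i)) - X (p n i))"
    by blast
  \<comment> \<open>The step function by which \<open>f\<close> gets multiplied. Left-open cells are
    disjoint and cover all positive times up to \<open>t\<close>, so exactly one summand survives at
    each such time.\<close>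
  define \<theta> where "\<theta> n u = (\<Sum>i\<le>n. \<phi>' (X (c n i)) * indicator {p n i<..p n (Suc i)} u)" for n u
  have \<theta>_eq: "\<theta> n u = \<phi>' (X (c n i))" if i: "i \<le> n" "p n i < u" "u \<le> p n (Suc i)" for n i u
  proof -
    have unique: "j = i" if "p n j < u" "u \<le> p n (Suc j)" for j
    proof (rule ccontr)
      have mono: "p n a \<le> p n b" if "a \<le> b" for a b
        using t that by (simp add: p_def divide_right_mono)
      assume "j \<noteq> i"
      then have "Suc j \<le> i \<or> Suc i \<le> j" by auto
      then show False using mono[of "Suc j" i] mono[of "Suc i" j] that i by auto
    qed
    have "\<phi>' (X (c n j)) * indicator {p n j<..p n (Suc j)} u = (if j = i then \<phi>' (X (c n i)) else 0)" for j
      using unique[of j] i by (cases "j = i") (auto simp: indicator_def)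
    then have "\<theta> n u = (\<Sum>j\<le>n. if j = i then \<phi>' (X (c n i)) else 0)"
      unfolding \<theta>_def by simp
    then show ?thesis using i by simp
  qed
  have ex_cell: "\<exists>i\<le>n. p n i < u \<and> u \<le> p n (Suc i)" if u: "0 < u" "u \<le> t" for n u
  proof -
    define i where "i = (LEAST i. u \<le> p n (Suc i))"
    have "u \<le> p n (Suc n)" using u p_t by simp
    then have "u \<le> p n (Suc i)" "i \<le> n"
      unfolding i_def by (auto intro: LeastI Least_le)
    moreover have "p n i < u"
    proof (cases i)
      case 0 then show ?thesis using u by (simp add: p_0)
    next
      case (Suc j)
      then have "\<not> u \<le> p n (Suc j)" unfolding i_def using not_less_Least by (metis lessI)
      then show ?thesis using Suc by simp
    qed
    ultimately show ?thesis by auto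
  qed
  have sum: "(LBINT u:{0..t}. \<theta> n u * f u) = \<phi> (X t) - \<phi> (X 0)" for n
  proof -
    have int: "set_integrable lborel {p n i<..p n (Suc i)} f" if "i \<le> n" for i
      using p_nonneg[of n i] p_le[of "Suc i" n] that by (intro set_integrable_subset[OF f]) auto
    have incr: "X (p n (Suc i)) - X (p n i) = (LBINT u:{p n i<..p n (Suc i)}. f u)" if "i \<le> n" for i
      using set_lborel_integral_Ioc[of "p n (Suc i)" f "p n i"] X[of "p n i"] X[of "p n (Suc i)"]
        set_integrable_subset[OF f, of "{0..p n (Suc i)}"] p_mono[of n i] p_nonneg[of n] p_le[of _ n] that
        p_le[of "Suc i" n] p_le[of i n] p_nonneg[of n "Suc i"]
      by (simp add: less_imp_le)
    have "(LBINT u:{0..t}. \<theta> n u * f u) =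
        (LBINT u. \<Sum>i\<le>n. \<phi>' (X (c n i)) * (indicator {p n i<..p n (Suc i)} u *\<^sub>R f u))"
      unfolding set_lebesgue_integral_def
    proof (intro Bochner_Integration.integral_cong refl)
      fix u :: real
      have "indicator {0..t} u *\<^sub>R (\<theta> n u * f u) =
          (\<Sum>i\<le>n. indicator {0..t} u * (\<phi>' (X (c n i)) * (indicator {p n i<..p n (Suc i)} u * f u)))"
        unfolding \<theta>_def by (simp only: real_scaleR_def sum_distrib_left sum_distrib_right mult.assoc)
      also have "\<dots> = (\<Sum>i\<le>n. \<phi>' (X (c n i)) * (indicator {p n i<..p n (Suc i)} u *\<^sub>R f u))"
      proof (intro sum.cong refl)
        fix i assume "i \<in> {..n}"
        then have "u \<in> {p n i<..p n (Suc i)} \<Longrightarrow> u \<in> {0..t}"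
          using p_nonneg[of n i] p_le[of "Suc i" n] by auto
        then show "indicator {0..t} u * (\<phi>' (X (c n i)) * (indicator {p n i<..p n (Suc i)} u * f u)) =
            \<phi>' (X (c n i)) * (indicator {p n i<..p n (Suc i)} u *\<^sub>R f u)"
          by (cases "u \<in> {p n i<..p n (Suc i)}") auto
      qed
      finally show "indicator {0..t} u *\<^sub>R (\<theta> n u * f u) =
          (\<Sum>i\<le>n. \<phi>' (X (c n i)) * (indicator {p n i<..p n (Suc i)} u *\<^sub>R f u))" .
    qed
    also have "\<dots> = (\<Sum>i\<le>n. \<phi>' (X (c n i)) * (LBINT u:{p n i<..p n (Suc i)}. f u))"
      unfolding set_lebesgue_integral_def using int
      by (subst Bochner_Integration.integral_sum) (auto simp: set_integrable_def)
    also have "\<dots> = (\<Sum>i\<le>n. \<phi> (X (p n (Suc i))) - \<phi> (X (p n i)))"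
      using c incr by (intro sum.cong) auto
    also have "\<dots> = \<phi> (X (p n (Suc n))) - \<phi> (X (p n 0))"
      using sum_lessThan_telescope[of "\<lambda>i. \<phi> (X (p n i))" "Suc n"] by (simp add: lessThan_Suc_atMost)
    finally show ?thesis by (simp only: p_0 p_t)
  qed
  have lim: "(\<lambda>n. \<theta> n u) \<longlonglongrightarrow> \<phi>' (X u)" if u: "0 < u" "u \<le> t" for u
  proof -
    obtain i where i: "\<And>n. i n \<le> n" "\<And>n. p n (i n) < u" "\<And>n. u \<le> p n (Suc (i n))"
      using ex_cell[OF u] by metis
    have c_in: "c n (i n) \<in> {0..t}" for n
      using c[OF i(1)[of n]] p_nonneg[of n "i n"] p_le[of "Suc (i n)" n] i(1)[of n] by auto
    have "\<bar>c n (i n) - u\<bar> \<le> t * inverse (real (Suc n))" for n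
    proof -
      have "p n (Suc (i n)) - p n (i n) = t * inverse (real (Suc n))"
        by (simp add: p_def divide_inverse algebra_simps)
      then show ?thesis using c[OF i(1)[of n]] i(2,3)[of n] by linarith
    qed
    moreover have "(\<lambda>n. t * inverse (real (Suc n))) \<longlonglongrightarrow> t * 0"
      by (intro tendsto_intros LIMSEQ_inverse_real_of_nat)
    ultimately have "(\<lambda>n. c n (i n) - u) \<longlonglongrightarrow> 0"
      by (intro Lim_null_comparison[of "\<lambda>n. c n (i n) - u"]) auto
    then have "(\<lambda>n. c n (i n)) \<longlonglongrightarrow> u" by (simp add: LIM_zero_iff)
    then have "(\<lambda>n. X (c n (i n))) \<longlonglongrightarrow> X u"
      using contX u c_in unfolding continuous_on_sequentially comp_def by auto
    then have "(\<lambda>n. \<phi>' (X (c n (i n)))) \<longlonglongrightarrow> \<phi>' (X u)"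
      using cont' by (rule isCont_tendsto_compose[rotated])
    then show ?thesis by (simp add: \<theta>_eq[OF i])
  qed
  have \<theta>_bound: "\<bar>\<theta> n u\<bar> \<le> 1" if "0 < u" "u \<le> t" for n u
    using ex_cell[OF that, of n] \<theta>_eq[of _ n u] bound by auto
  have fm: "(\<lambda>u. indicator {0..t} u * f u) \<in> borel_measurable borel"
    using f by (simp add: set_integrable_def borel_measurable_integrable)
  have \<theta>_meas: "\<theta> n \<in> borel_measurable borel" for n
    unfolding \<theta>_def by measurable
  have m1: "(\<lambda>u. indicator {0..t} u *\<^sub>R (\<theta> n u * f u)) \<in> borel_measurable lborel" for n
  proof -
    have "(\<lambda>u. \<theta> n u * (indicator {0..t} u * f u)) \<in> borel_measurable borel"
      using fm \<theta>_meas by measurable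
    then show ?thesis by (simp add: mult_ac)
  qed
  have "(\<lambda>n. LBINT u:{0..t}. \<theta> n u * f u) \<longlonglongrightarrow> (LBINT u:{0..t}. \<phi>' (X u) * f u)"
    unfolding set_lebesgue_integral_def
  proof (rule integral_dominated_convergence[where w="\<lambda>u. \<bar>indicator {0..t} u * f u\<bar>"])
    show "integrable lborel (\<lambda>u. \<bar>indicator {0..t} u * f u\<bar>)"
      using f by (simp add: set_integrable_def)
    show lim': "AE u in lborel. (\<lambda>n. indicator {0..t} u *\<^sub>R (\<theta> n u * f u)) \<longlonglongrightarrow>
        indicator {0..t} u *\<^sub>R (\<phi>' (X u) * f u)"
      using AE_lborel_singleton[of "0::real"]
      by eventually_elim (auto simp: indicator_def intro!: tendsto_intros lim)
    show "AE u in lborel. norm (indicator {0..t} u *\<^sub>R (\<theta> n u * f u)) \<le> \<bar>indicator {0..t} u * f u\<bar>" for n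
      using AE_lborel_singleton[of "0::real"]
    proof eventually_elim
      case (elim u)
      then show ?case
        using mult_right_mono[OF \<theta>_bound[of u n], of "\<bar>f u\<bar>"]
        by (auto simp: indicator_def abs_mult)
    qed
    show "(\<lambda>u. indicator {0..t} u *\<^sub>R (\<phi>' (X u) * f u)) \<in> borel_measurable lborel"
    proof -
      have "continuous_on {0..t} (\<lambda>u. \<phi>' (X u))"
        by (rule continuous_on_compose2[OF _ contX, of UNIV])
           (auto intro: continuous_at_imp_continuous_on cont')
      then have "(\<lambda>u. indicator {0..t} u *\<^sub>R \<phi>' (X u)) \<in> borel_measurable borel"
        by (intro borel_measurable_continuous_on_indicator) auto
      then have "(\<lambda>u. (indicator {0..t} u *\<^sub>R \<phi>' (X u)) * (indicator {0..t} u * f u)) \<in> borel_measurable borel"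
        using fm by measurable
      also have "(\<lambda>u. (indicator {0..t} u *\<^sub>R \<phi>' (X u)) * (indicator {0..t} u * f u)) =
          (\<lambda>u. indicator {0..t} u *\<^sub>R (\<phi>' (X u) * f u))"
        by (auto simp: indicator_def)
      finally show ?thesis by simp
    qed
  qed (rule m1)
  then show ?thesis
    unfolding sum by (rule LIMSEQ_unique[OF tendsto_const])
qed

text \<open>The bound 1 on the derivatives makes \<open>f\<close> a dominating function, so the
  chain rule passes to non-smooth limits. The limit \<open>l\<close> need not be a derivative of
  \<open>L\<close>: for level sets \<open>L\<close> vanishes while \<open>l\<close> is an
  indicator.\<close>

lemma LBINT_chain_rule_limit:
  fixes f X l L :: "real \<Rightarrow> real" and \<phi> \<phi>' :: "nat \<Rightarrow> real \<Rightarrow> real"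
  assumes t: "0 \<le> t" and f: "set_integrable lborel {0..t} f"
    and X: "\<And>s. 0 \<le> s \<Longrightarrow> s \<le> t \<Longrightarrow> X s = X 0 + (LBINT u:{0..s}. f u)"
    and contX: "continuous_on {0..t} X"
    and deriv: "\<And>n x. (\<phi> n has_real_derivative \<phi>' n x) (at x)"
    and cont': "\<And>n x. isCont (\<phi>' n) x"
    and bound: "\<And>n x. \<bar>\<phi>' n x\<bar> \<le> 1"
    and lim: "\<And>x. (\<lambda>n. \<phi> n x) \<longlonglongrightarrow> L x"
    and lim': "\<And>x. (\<lambda>n. \<phi>' n x) \<longlonglongrightarrow> l x"
  shows "set_integrable lborel {0..t} (\<lambda>u. l (X u) * f u)"
    and "L (X t) - L (X 0) = (LBINT u:{0..t}. l (X u) * f u)"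
proof -
  have chain: "\<phi> n (X t) - \<phi> n (X 0) = (LBINT u:{0..t}. \<phi>' n (X u) * f u)" for n
    using t f X contX deriv cont' bound by (rule LBINT_chain_rule)
  have meas: "(\<lambda>u. indicator {0..t} u *\<^sub>R f u) \<in> borel_measurable borel"
    using f by (simp add: set_integrable_def borel_measurable_integrable)
  have measX: "(\<lambda>u. indicator {0..t} u *\<^sub>R X u) \<in> borel_measurable borel"
    using contX by (intro borel_measurable_continuous_on_indicator) auto
  have meas': "(\<lambda>u. indicator {0..t} u *\<^sub>R (\<phi>' n (X u) * f u)) \<in> borel_measurable lborel" for n
  proof -
    have [measurable]: "\<phi>' n \<in> borel_measurable borel"
      using cont' by (auto intro!: borel_measurable_continuous_onI continuous_at_imp_continuous_on)
    have "(\<lambda>u. \<phi>' n (indicator {0..t} u *\<^sub>R X u) * (indicator {0..t} u *\<^sub>R f u)) \<in> borel_measurable borel"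
      using meas measX by measurable
    also have "(\<lambda>u. \<phi>' n (indicator {0..t} u *\<^sub>R X u) * (indicator {0..t} u *\<^sub>R f u)) =
        (\<lambda>u. indicator {0..t} u *\<^sub>R (\<phi>' n (X u) * f u))"
      by (auto simp: indicator_def)
    finally show ?thesis by simp
  qed
  have w: "integrable lborel (\<lambda>u. \<bar>indicator {0..t} u *\<^sub>R f u\<bar>)"
    using f by (intro integrable_abs) (simp add: set_integrable_def)
  have AE_lim: "AE u in lborel. (\<lambda>n. indicator {0..t} u *\<^sub>R (\<phi>' n (X u) * f u)) \<longlonglongrightarrow>
      indicator {0..t} u *\<^sub>R (l (X u) * f u)"
    by (intro AE_I2 tendsto_intros lim')
  have m_l: "(\<lambda>u. indicator {0..t} u *\<^sub>R (l (X u) * f u)) \<in> borel_measurable lborel"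
    by (rule borel_measurable_LIMSEQ_real[where u="\<lambda>n u. indicator {0..t} u *\<^sub>R (\<phi>' n (X u) * f u)", OF _ meas']) (intro tendsto_intros lim')
  have AE_w: "AE u in lborel. norm (indicator {0..t} u *\<^sub>R (\<phi>' n (X u) * f u)) \<le> \<bar>indicator {0..t} u *\<^sub>R f u\<bar>" for n
    using mult_right_mono[OF bound, of "\<bar>f u\<bar>" n "X u" for u]
    by (auto simp: indicator_def abs_mult)
  note dominated = m_l meas' w AE_lim AE_w
  show "set_integrable lborel {0..t} (\<lambda>u. l (X u) * f u)"
    unfolding set_integrable_def
    by (rule integrable_dominated_convergence[OF dominated])
  have "(\<lambda>n. LBINT u:{0..t}. \<phi>' n (X u) * f u) \<longlonglongrightarrow> (LBINT u:{0..t}. l (X u) * f u)"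
    unfolding set_lebesgue_integral_def
    by (rule integral_dominated_convergence[OF dominated])
  moreover have "(\<lambda>n. \<phi> n (X t) - \<phi> n (X 0)) \<longlonglongrightarrow> L (X t) - L (X 0)"
    by (intro tendsto_diff lim)
  ultimately show "L (X t) - L (X 0) = (LBINT u:{0..t}. l (X u) * f u)"
    unfolding chain by (simp add: LIMSEQ_unique)
qed

text \<open>
  Substitutes for the almost everywhere vanishing of \<open>X'\<close> on level sets, without Lebesgue's
  differentiation theorem: \<open>arctan (m (x - a)) / m\<close> tends to \<open>0\<close>, its derivative to the indicator of \<open>a\<close>.
\<close>

lemma LBINT_level_set_eq_0:
  fixes f X :: "real \<Rightarrow> real"
  assumes t: "0 \<le> t" and f: "set_integrable lborel {0..t} f"
    and X: "\<And>s. 0 \<le> s \<Longrightarrow> s \<le> t \<Longrightarrow> X s = X 0 + (LBINT u:{0..s}. f u)"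
    and contX: "continuous_on {0..t} X"
  shows "set_integrable lborel {0..t} (\<lambda>u. of_bool (X u = a) * f u)"
    and "(LBINT u:{0..t}. of_bool (X u = a) * f u) = 0"
proof -
  define m where "m n = real (Suc n)" for n
  have m: "0 < m n" for n by (simp add: m_def)
  have m_lim: "filterlim m at_top sequentially"
    unfolding m_def by (intro filterlim_compose[OF filterlim_real_sequentially filterlim_Suc])
  define \<phi>' where "\<phi>' n x = 1 / (1 + (m n * (x - a))\<^sup>2)" for n x
  define \<phi> where "\<phi> n x = arctan (m n * (x - a)) / m n" for n x
  have pos: "0 < 1 + (m n * (x - a))\<^sup>2" for n x
    by (simp add: add_pos_nonneg)
  have deriv: "(\<phi> n has_real_derivative \<phi>' n x) (at x)" for n x
    unfolding \<phi>_def[abs_def] \<phi>'_def using m[of n]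
    by (auto intro!: derivative_eq_intros simp: divide_simps)
  have cont': "isCont (\<phi>' n) x" for n x
    unfolding \<phi>'_def[abs_def] using pos[of n x] by (intro continuous_intros) simp
  have bound: "\<bar>\<phi>' n x\<bar> \<le> 1" for n x
    unfolding \<phi>'_def using pos[of n x] by (simp add: divide_simps)
  have lim': "(\<lambda>n. \<phi>' n x) \<longlonglongrightarrow> of_bool (x = a)" for x
  proof (cases "x = a")
    case True then show ?thesis by (simp add: \<phi>'_def)
  next
    case False
    have "filterlim (\<lambda>n. 1 + (x - a)\<^sup>2 * (m n)\<^sup>2) at_top sequentially"
      using False by (intro filterlim_tendsto_add_at_top[OF tendsto_const]
        filterlim_tendsto_pos_mult_at_top[OF tendsto_const] filterlim_pow_at_top m_lim) auto
    then have "(\<lambda>n. 1 / (1 + (x - a)\<^sup>2 * (m n)\<^sup>2)) \<longlonglongrightarrow> 0"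
      by (intro real_tendsto_divide_at_top[OF tendsto_const])
    then show ?thesis using False by (simp add: \<phi>'_def power_mult_distrib mult.commute)
  qed
  have lim: "(\<lambda>n. \<phi> n x) \<longlonglongrightarrow> 0" for x
  proof (rule Lim_null_comparison[of _ "\<lambda>n. pi / m n"])
    have "\<bar>arctan y\<bar> \<le> pi" for y
      using arctan_bounded[of y] pi_gt_zero by (auto simp: abs_le_iff)
    then show "\<forall>\<^sub>F n in sequentially. norm (\<phi> n x) \<le> pi / m n"
      using m by (auto simp: \<phi>_def divide_right_mono less_imp_le)
    show "(\<lambda>n. pi / m n) \<longlonglongrightarrow> 0"
      by (intro real_tendsto_divide_at_top[OF tendsto_const] m_lim)
  qed
  show "set_integrable lborel {0..t} (\<lambda>u. of_bool (X u = a) * f u)"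
    "(LBINT u:{0..t}. of_bool (X u = a) * f u) = 0"
    using LBINT_chain_rule_limit[OF t f X contX deriv cont' bound lim lim'] by simp_all
qed

lemma min_eq_LBINT:
  fixes f X :: "real \<Rightarrow> real"
  assumes t: "0 \<le> t" and f: "set_integrable lborel {0..t} f"
    and X: "\<And>s. 0 \<le> s \<Longrightarrow> s \<le> t \<Longrightarrow> X s = X 0 + (LBINT u:{0..s}. f u)"
    and contX: "continuous_on {0..t} X"
  shows "set_integrable lborel {0..t} (\<lambda>u. of_bool (X u < a) * f u)"
    and "min (X t) a - min (X 0) a = (LBINT u:{0..t}. of_bool (X u < a) * f u)"
proof -
  define m where "m n = inverse (real (Suc n))" for n
  have m: "0 < m n" for n by (simp add: m_def)
  have m_lim: "m \<longlonglongrightarrow> 0"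
    unfolding m_def by (rule LIMSEQ_inverse_real_of_nat)
  \<comment> \<open>a smooth approximation of \<open>\<bar>x - a\<bar>\<close>, as \<open>min x a = (x + a - \<bar>x - a\<bar>) / 2\<close>\<close>
  define r where "r n x = sqrt ((x - a)\<^sup>2 + m n)" for n x
  have pos: "0 < (x - a)\<^sup>2 + m n" for n x
    using m by (simp add: add_nonneg_pos)
  then have r_pos: "0 < r n x" for n x
    by (simp add: r_def)
  have deriv: "(r n has_real_derivative (x - a) / r n x) (at x)" for n x
    unfolding r_def[abs_def] using pos[of x n]
    by (auto intro!: derivative_eq_intros simp: divide_simps)
  have contr: "isCont (r n) x" for n x
    using deriv by (rule DERIV_isCont)
  have cont': "isCont (\<lambda>x. (x - a) / r n x) x" for n x
    using r_pos[of n x] by (intro continuous_intros contr) simp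
  have bound: "\<bar>(x - a) / r n x\<bar> \<le> 1" for n x
  proof -
    have "\<bar>x - a\<bar> \<le> r n x"
      unfolding r_def using m[of n] by (intro real_le_rsqrt) simp
    then show ?thesis using r_pos[of n x] by (simp add: abs_divide)
  qed
  have lim: "(\<lambda>n. r n x) \<longlonglongrightarrow> \<bar>x - a\<bar>" for x
  proof -
    have "(\<lambda>n. sqrt ((x - a)\<^sup>2 + m n)) \<longlonglongrightarrow> sqrt ((x - a)\<^sup>2 + 0)"
      by (intro tendsto_intros m_lim)
    then show ?thesis by (simp add: r_def)
  qed
  have lim': "(\<lambda>n. (x - a) / r n x) \<longlonglongrightarrow> sgn (x - a)" for x
  proof (cases "x = a")
    case False
    then have "(\<lambda>n. (x - a) / r n x) \<longlonglongrightarrow> (x - a) / \<bar>x - a\<bar>"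
      by (intro tendsto_divide tendsto_const lim) simp
    then show ?thesis by (simp add: real_sgn_eq)
  qed simp
  have sgn: "set_integrable lborel {0..t} (\<lambda>u. sgn (X u - a) * f u)"
    "\<bar>X t - a\<bar> - \<bar>X 0 - a\<bar> = (LBINT u:{0..t}. sgn (X u - a) * f u)"
    using LBINT_chain_rule_limit[OF t f X contX deriv cont' bound lim lim'] by simp_all
  note level = LBINT_level_set_eq_0[OF t f X contX, of a]
  \<comment> \<open>The smoothed absolute value has derivative tending to 0 at the kink, so
    \<open>(1 - sgn (X u - a)) / 2\<close> is one half on the level set. The last term removes this
    half.\<close>
  have eq: "of_bool (X u < a) * f u =
      (f u - sgn (X u - a) * f u - of_bool (X u = a) * f u) / 2" for u
    by (cases "X u" a rule: linorder_cases) (auto simp: algebra_simps)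
  show "set_integrable lborel {0..t} (\<lambda>u. of_bool (X u < a) * f u)"
    unfolding eq using f sgn(1) level(1) by (intro set_integrable_divide set_integral_diff) auto
  have "(LBINT u:{0..t}. of_bool (X u < a) * f u) =
      ((LBINT u:{0..t}. f u) - (\<bar>X t - a\<bar> - \<bar>X 0 - a\<bar>) - 0) / 2"
    unfolding eq using f sgn level by (simp add: set_integral_diff)
  also have "\<dots> = min (X t) a - min (X 0) a"
    using X[of t] t by (auto simp: min_def abs_if field_simps)
  finally show "min (X t) a - min (X 0) a = (LBINT u:{0..t}. of_bool (X u < a) * f u)" ..
qed

section \<open>Transport along the characteristics\<close>

text \<open>Entry rate and initial density are extended by zero to the whole line, so that shifts
  and reflections of the integration variable need no adjusted domains.\<close>

locale aging = lifetime +
  fixes k f :: "real \<Rightarrow> real"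
  assumes k_measurable [measurable]: "k \<in> borel_measurable borel"
    and k_nonneg: "\<And>s. 0 \<le> k s" and k_neg: "\<And>s. s < 0 \<Longrightarrow> k s = 0"
    and k_integrable: "\<And>t. 0 \<le> t \<Longrightarrow> set_integrable lborel {0..t} k"
    and f_integrable: "integrable lborel f"
    and f_nonneg: "\<And>x. 0 \<le> f x" and f_ages: "\<And>x. x \<notin> ages G \<Longrightarrow> f x = 0"
begin

text \<open>The diagonal \<open>x = t\<close> is assigned to the newcomers. Thus the value at age 0
  is \<open>k t\<close> at every time, including time 0, and \<open>f\<close> is attained at time 0
  only at positive ages.\<close>

definition transport :: "real \<Rightarrow> real \<Rightarrow> real" where
  "transport t x = (if x < 0 then 0 else if x \<le> t then k (t - x) * survival G x
     else f (x - t) * (survival G x / survival G (x - t)))"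

lemma f_measurable [measurable]: "f \<in> borel_measurable borel"
  using f_integrable by (simp add: borel_measurable_integrable)

lemma transport_measurable [measurable]: "case_prod transport \<in> borel_measurable (borel \<Otimes>\<^sub>M borel)"
  unfolding transport_def by measurable

lemma transport_measurable1 [measurable]: "transport t \<in> borel_measurable borel"
  unfolding transport_def by measurable

lemma transport_nonneg: "0 \<le> transport t x"
  unfolding transport_def using k_nonneg f_nonneg survival_bounds by simp

lemma transport_neg: "x < 0 \<Longrightarrow> transport t x = 0"
  by (simp add: transport_def)

lemma transport_ages: "x \<notin> ages G \<Longrightarrow> transport t x = 0"
  using survival_eq_0[of x] by (auto simp: transport_def)

text \<open>Ages beyond \<open>t\<close> are relabelled by the age at time 0, ages up to
  \<open>t\<close> by the time of entry.\<close>

lemma nn_integral_transport: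
  assumes [measurable]: "\<phi> \<in> borel_measurable borel" and t: "0 \<le> t"
  shows "(\<integral>\<^sup>+x. \<phi> x * ennreal (transport t x) \<partial>lborel) =
    (\<integral>\<^sup>+x. \<phi> (x + t) * ennreal (f x * (survival G (x + t) / survival G x)) \<partial>lborel) +
    (\<integral>\<^sup>+s. \<phi> (t - s) * ennreal (survival G (t - s) * k s) * indicator {0..t} s \<partial>lborel)"
proof -
  have "(\<integral>\<^sup>+x. \<phi> x * ennreal (transport t x) \<partial>lborel) =
      (\<integral>\<^sup>+x. \<phi> x * ennreal (transport t x) * indicator {t<..} x +
             \<phi> x * ennreal (transport t x) * indicator {0..t} x \<partial>lborel)"
    using t by (intro nn_integral_cong) (auto simp: indicator_def transport_neg)
  also have "\<dots> = (\<integral>\<^sup>+x. \<phi> x * ennreal (transport t x) * indicator {t<..} x \<partial>lborel) +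
      (\<integral>\<^sup>+x. \<phi> x * ennreal (transport t x) * indicator {0..t} x \<partial>lborel)"
    by (intro nn_integral_add) auto
  also have "(\<integral>\<^sup>+x. \<phi> x * ennreal (transport t x) * indicator {t<..} x \<partial>lborel) =
      (\<integral>\<^sup>+x. \<phi> (t + 1 * x) * ennreal (transport t (t + 1 * x)) * indicator {t<..} (t + 1 * x) \<partial>lborel)"
    by (subst nn_integral_real_affine[where c=1 and t=t]) auto
  also have "\<dots> = (\<integral>\<^sup>+x. \<phi> (x + t) * ennreal (f x * (survival G (x + t) / survival G x)) \<partial>lborel)"
  proof (intro nn_integral_cong_AE)
    show "AE x in lborel. \<phi> (t + 1 * x) * ennreal (transport t (t + 1 * x)) * indicator {t<..} (t + 1 * x) =
        \<phi> (x + t) * ennreal (f x * (survival G (x + t) / survival G x))"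
      using AE_lborel_singleton[of "0::real"]
    proof eventually_elim
      case (elim x)
      show ?case
      proof (cases "0 < x")
        case True
        then show ?thesis using t by (simp add: transport_def add.commute)
      next
        case False
        then have "x \<notin> ages G" using elim ages_nonneg by fastforce
        then show ?thesis using False by (simp add: f_ages)
      qed
    qed
  qed
  also have "(\<integral>\<^sup>+x. \<phi> x * ennreal (transport t x) * indicator {0..t} x \<partial>lborel) =
      (\<integral>\<^sup>+s. \<phi> (t + (-1) * s) * ennreal (transport t (t + (-1) * s)) * indicator {0..t} (t + (-1) * s) \<partial>lborel)"
    by (subst nn_integral_real_affine[where c="-1" and t=t]) auto
  also have "\<dots> = (\<integral>\<^sup>+s. \<phi> (t - s) * ennreal (survival G (t - s) * k s) * indicator {0..t} s \<partial>lborel)"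
    by (intro nn_integral_cong) (auto simp: indicator_def transport_def mult.commute)
  finally show ?thesis .
qed

text \<open>Hazard times survival is the lifetime density, so the survival factor of the transported
  density cancels. What remains are the conditional density of the residual lifetime of the initial
  mass and a convolution of the entry rate with \<open>g\<close>.\<close>

lemma density_rate_transport:
  assumes s: "0 \<le> s"
  shows "density_rate G g (transport s) =
    (\<integral>\<^sup>+x. ennreal (f x / survival G x) * ennreal (indicator (ages G) (x + s) * g (x + s)) \<partial>lborel) +
    (\<integral>\<^sup>+u. ennreal (k u) * ennreal (indicator (ages G) (s - u) * g (s - u)) * indicator {0..s} u \<partial>lborel)"
proof -
  have eq: "ennreal (indicator (ages G) y * hazard G g y) * ennreal (c * survival G y) =
      ennreal c * ennreal (indicator (ages G) y * g y)" if "0 \<le> c" for c y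
    using survival_pos[of y] hazard_nonneg[of y] that
    by (auto simp: indicator_def ennreal_mult[symmetric] hazard_def survival_bounds g_nonneg ages_nonneg)
  have "density_rate G g (transport s) =
      (\<integral>\<^sup>+x. ennreal (indicator (ages G) x * hazard G g x) * ennreal (transport s x) \<partial>lborel)"
    unfolding density_rate_def using hazard_nonneg
    by (intro nn_integral_cong) (auto simp: indicator_def ennreal_mult transport_nonneg mult.commute)
  also have "\<dots> =
    (\<integral>\<^sup>+x. ennreal (indicator (ages G) (x + s) * hazard G g (x + s)) *
       ennreal (f x * (survival G (x + s) / survival G x)) \<partial>lborel) +
    (\<integral>\<^sup>+u. ennreal (indicator (ages G) (s - u) * hazard G g (s - u)) *
       ennreal (survival G (s - u) * k u) * indicator {0..s} u \<partial>lborel)"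
    using s by (intro nn_integral_transport) auto
  also have "(\<integral>\<^sup>+x. ennreal (indicator (ages G) (x + s) * hazard G g (x + s)) *
       ennreal (f x * (survival G (x + s) / survival G x)) \<partial>lborel) =
     (\<integral>\<^sup>+x. ennreal (f x / survival G x) * ennreal (indicator (ages G) (x + s) * g (x + s)) \<partial>lborel)"
    using eq[of "f x / survival G x" "x + s" for x]
    by (intro nn_integral_cong) (simp add: f_nonneg survival_bounds mult.commute)
  also have "(\<integral>\<^sup>+u. ennreal (indicator (ages G) (s - u) * hazard G g (s - u)) *
       ennreal (survival G (s - u) * k u) * indicator {0..s} u \<partial>lborel) =
     (\<integral>\<^sup>+u. ennreal (k u) * ennreal (indicator (ages G) (s - u) * g (s - u)) * indicator {0..s} u \<partial>lborel)"
    using eq[of "k u" "s - u" for u]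
    by (intro nn_integral_cong) (simp add: k_nonneg mult.commute)
  finally show ?thesis .
qed

lemma density_rate_transport_measurable:
  "(\<lambda>s. density_rate G g (transport s) * indicator {0..} s) \<in> borel_measurable borel"
proof -
  have "(\<lambda>s. \<integral>\<^sup>+x. ennreal (indicator (ages G) x * hazard G g x) * ennreal (transport s x) \<partial>lborel)
      \<in> borel_measurable borel"
    by measurable
  also have "(\<lambda>s. \<integral>\<^sup>+x. ennreal (indicator (ages G) x * hazard G g x) * ennreal (transport s x) \<partial>lborel) =
      (\<lambda>s. density_rate G g (transport s))"
    unfolding density_rate_def using hazard_nonneg
    by (intro ext nn_integral_cong) (auto simp: indicator_def ennreal_mult transport_nonneg mult.commute)
  finally show ?thesis by measurable
qed

text \<open>By Tonelli each unit of mass can be followed separately: initial mass of age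
  \<open>x\<close> has left by time \<open>t\<close> with the fraction
  \<open>1 - survival G (x + t) / survival G x\<close>, mass entered at time \<open>u\<close> with
  the fraction \<open>1 - survival G (t - u)\<close>. The complementary fractions are still present.
  Working with extended values requires no prior integrability and yields it afterwards.\<close>

lemma nn_mass_balance:
  assumes t: "0 \<le> t"
  shows "(\<integral>\<^sup>+x. ennreal (transport t x) \<partial>lborel) + (\<integral>\<^sup>+s\<in>{0..t}. density_rate G g (transport s) \<partial>lborel) =
    (\<integral>\<^sup>+x. ennreal (f x) \<partial>lborel) + (\<integral>\<^sup>+s\<in>{0..t}. ennreal (k s) \<partial>lborel)"
proof -
  let ?gA = "\<lambda>x. ennreal (indicator (ages G) x * g x)"
  \<comment> \<open>The range of the entry time depends on the current time. Expressing it as a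
    condition on the pair gives one jointly measurable integrand, as needed to exchange the
    integrals.\<close>
  have "(\<integral>\<^sup>+s\<in>{0..t}. density_rate G g (transport s) \<partial>lborel) =
    (\<integral>\<^sup>+s. (\<integral>\<^sup>+x. ennreal (f x / survival G x) * ?gA (x + s) * indicator {0..t} s \<partial>lborel) +
      (\<integral>\<^sup>+u. ennreal (k u) * ?gA (s - u) * (if 0 \<le> u \<and> u \<le> s then 1 else 0) * indicator {0..t} s \<partial>lborel) \<partial>lborel)"
    by (intro nn_integral_cong)
       (auto simp: indicator_def density_rate_transport intro!: arg_cong2[where f="(+)"] nn_integral_cong)
  also have "\<dots> = (\<integral>\<^sup>+s. \<integral>\<^sup>+x. ennreal (f x / survival G x) * ?gA (x + s) * indicator {0..t} s \<partial>lborel \<partial>lborel) +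
    (\<integral>\<^sup>+s. \<integral>\<^sup>+u. ennreal (k u) * ?gA (s - u) * (if 0 \<le> u \<and> u \<le> s then 1 else 0) * indicator {0..t} s \<partial>lborel \<partial>lborel)"
    by (rule nn_integral_add) measurable
  also have "(\<integral>\<^sup>+s. \<integral>\<^sup>+x. ennreal (f x / survival G x) * ?gA (x + s) * indicator {0..t} s \<partial>lborel \<partial>lborel) =
     (\<integral>\<^sup>+x. \<integral>\<^sup>+s. ennreal (f x / survival G x) * ?gA (x + s) * indicator {0..t} s \<partial>lborel \<partial>lborel)"
    by (rule lborel_pair.Fubini') measurable
  also have "\<dots> = (\<integral>\<^sup>+x. ennreal (f x / survival G x) * ennreal (survival G x - survival G (x + t)) \<partial>lborel)"
  proof (intro nn_integral_cong)
    fix x :: real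
    show "(\<integral>\<^sup>+s. ennreal (f x / survival G x) * ?gA (x + s) * indicator {0..t} s \<partial>lborel) =
      ennreal (f x / survival G x) * ennreal (survival G x - survival G (x + t))"
    proof (cases "x \<in> ages G")
      case True
      then show ?thesis
        using t by (simp add: nn_integral_cmult mult.assoc nn_integral_g_ages ages_nonneg)
    qed (simp add: f_ages)
  qed
  also have "(\<integral>\<^sup>+s. \<integral>\<^sup>+u. ennreal (k u) * ?gA (s - u) * (if 0 \<le> u \<and> u \<le> s then 1 else 0) * indicator {0..t} s \<partial>lborel \<partial>lborel) =
     (\<integral>\<^sup>+u. \<integral>\<^sup>+s. ennreal (k u) * ?gA (s - u) * (if 0 \<le> u \<and> u \<le> s then 1 else 0) * indicator {0..t} s \<partial>lborel \<partial>lborel)"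
    by (rule lborel_pair.Fubini') measurable
  also have "\<dots> = (\<integral>\<^sup>+u. ennreal (k u) * ennreal (1 - survival G (t - u)) * indicator {0..t} u \<partial>lborel)"
  proof (intro nn_integral_cong)
    fix u :: real
    have "(\<integral>\<^sup>+s. ennreal (k u) * ?gA (s - u) * (if 0 \<le> u \<and> u \<le> s then 1 else 0) * indicator {0..t} s \<partial>lborel) =
      (\<integral>\<^sup>+s. ennreal (k u) * (?gA (s - u) * ((if 0 \<le> u \<and> u \<le> s then 1 else 0) * indicator {0..t} s)) \<partial>lborel)"
      by (simp add: mult.assoc)
    also have "\<dots> = ennreal (k u) * (\<integral>\<^sup>+s. ?gA (s - u) * ((if 0 \<le> u \<and> u \<le> s then 1 else 0) * indicator {0..t} s) \<partial>lborel)"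
      by (rule nn_integral_cmult) measurable
    also have "(\<integral>\<^sup>+s. ?gA (s - u) * ((if 0 \<le> u \<and> u \<le> s then 1 else 0) * indicator {0..t} s) \<partial>lborel) =
      (\<integral>\<^sup>+v. ?gA (0 + v) * indicator {0..t - u} v \<partial>lborel) * indicator {0..t} u"
    proof (cases "u \<in> {0..t}")
      case True
      have "(\<integral>\<^sup>+s. ?gA (s - u) * ((if 0 \<le> u \<and> u \<le> s then 1 else 0) * indicator {0..t} s) \<partial>lborel) =
        (\<integral>\<^sup>+v. ?gA ((u + 1 * v) - u) * ((if 0 \<le> u \<and> u \<le> u + 1 * v then 1 else 0) * indicator {0..t} (u + 1 * v)) \<partial>lborel)"
        by (subst nn_integral_real_affine[where c=1 and t=u]) auto
      also have "\<dots> = (\<integral>\<^sup>+v. ?gA (0 + v) * indicator {0..t - u} v \<partial>lborel)"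
        using True by (intro nn_integral_cong) (auto simp: indicator_def)
      finally show ?thesis using True by simp
    next
      case False
      then have "?gA (s - u) * ((if 0 \<le> u \<and> u \<le> s then 1 else 0) * indicator {0..t} s) = 0" for s
        by (auto simp: indicator_def)
      then have "(\<integral>\<^sup>+s. ?gA (s - u) * ((if 0 \<le> u \<and> u \<le> s then 1 else 0) * indicator {0..t} s) \<partial>lborel) =
          (\<integral>\<^sup>+(s::real). 0 \<partial>lborel)"
        by (rule nn_integral_cong)
      then show ?thesis using False by simp
    qed
    also have "\<dots> = ennreal (1 - survival G (t - u)) * indicator {0..t} u"
      using nn_integral_g_ages[of 0 "t - u"] by (cases "u \<in> {0..t}") (simp_all add: survival_0)
    finally show "(\<integral>\<^sup>+s. ennreal (k u) * ?gA (s - u) * (if 0 \<le> u \<and> u \<le> s then 1 else 0) * indicator {0..t} s \<partial>lborel) =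
      ennreal (k u) * ennreal (1 - survival G (t - u)) * indicator {0..t} u"
      by (simp add: mult.assoc)
  qed
  finally have rate: "(\<integral>\<^sup>+s\<in>{0..t}. density_rate G g (transport s) \<partial>lborel) =
    (\<integral>\<^sup>+x. ennreal (f x / survival G x) * ennreal (survival G x - survival G (x + t)) \<partial>lborel) +
    (\<integral>\<^sup>+u. ennreal (k u) * ennreal (1 - survival G (t - u)) * indicator {0..t} u \<partial>lborel)" .
  have mass: "(\<integral>\<^sup>+x. ennreal (transport t x) \<partial>lborel) =
    (\<integral>\<^sup>+x. ennreal (f x * (survival G (x + t) / survival G x)) \<partial>lborel) +
    (\<integral>\<^sup>+s. ennreal (survival G (t - s) * k s) * indicator {0..t} s \<partial>lborel)"
    using nn_integral_transport[of "\<lambda>_. 1", OF _ t] by simp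
  \<comment> \<open>Outside \<open>ages G\<close> the quotients have denominator 0, but
    \<open>f\<close> vanishes there.\<close>
  have "(\<integral>\<^sup>+x. ennreal (f x * (survival G (x + t) / survival G x)) \<partial>lborel) +
      (\<integral>\<^sup>+x. ennreal (f x / survival G x) * ennreal (survival G x - survival G (x + t)) \<partial>lborel) =
      (\<integral>\<^sup>+x. ennreal (f x) \<partial>lborel)"
  proof (subst nn_integral_add[symmetric]; (measurable)?)
    show "(\<integral>\<^sup>+x. ennreal (f x * (survival G (x + t) / survival G x)) +
        ennreal (f x / survival G x) * ennreal (survival G x - survival G (x + t)) \<partial>lborel) =
        (\<integral>\<^sup>+x. ennreal (f x) \<partial>lborel)"
    proof (intro nn_integral_cong)
      fix x :: real
      show "ennreal (f x * (survival G (x + t) / survival G x)) +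
        ennreal (f x / survival G x) * ennreal (survival G x - survival G (x + t)) = ennreal (f x)"
      proof (cases "x \<in> ages G")
        case True
        then have "f x * (survival G (x + t) / survival G x) +
            f x / survival G x * (survival G x - survival G (x + t)) = f x"
          using survival_pos[OF True] by (simp add: field_simps)
        then show ?thesis
          using t survival_antimono[of x "x + t"] survival_bounds
          by (simp add: ennreal_mult[symmetric] ennreal_plus[symmetric] f_nonneg del: ennreal_plus)
      qed (simp add: f_ages)
    qed
  qed
  moreover have "(\<integral>\<^sup>+s. ennreal (survival G (t - s) * k s) * indicator {0..t} s \<partial>lborel) +
      (\<integral>\<^sup>+u. ennreal (k u) * ennreal (1 - survival G (t - u)) * indicator {0..t} u \<partial>lborel) =
      (\<integral>\<^sup>+s\<in>{0..t}. ennreal (k s) \<partial>lborel)"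
  proof (subst nn_integral_add[symmetric]; (measurable)?)
    have "ennreal (survival G (t - s) * k s) + ennreal (k s) * ennreal (1 - survival G (t - s)) = ennreal (k s)" for s
    proof -
      have "survival G (t - s) * k s + k s * (1 - survival G (t - s)) = k s"
        by (simp add: algebra_simps)
      then show ?thesis
        using survival_bounds by (simp add: ennreal_mult[symmetric] ennreal_plus[symmetric] k_nonneg del: ennreal_plus)
    qed
    then show "(\<integral>\<^sup>+s. ennreal (survival G (t - s) * k s) * indicator {0..t} s +
        ennreal (k s) * ennreal (1 - survival G (t - s)) * indicator {0..t} s \<partial>lborel) =
        (\<integral>\<^sup>+s\<in>{0..t}. ennreal (k s) \<partial>lborel)"
      by (simp add: distrib_right[symmetric])
  qed
  ultimately show ?thesis
    unfolding rate mass by (metis (no_types, lifting) add.assoc add.commute)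
qed

end

section \<open>Measures with densities and integrals against them\<close>

lemma cumulative_top: "cumulative f \<infinity> = (LBINT x:{0..}. f x)"
  by (simp add: cumulative_def atLeast_def)

lemma cumulative_set_measurable: "{x. 0 \<le> x \<and> ereal x \<le> y} \<in> sets borel"
  by measurable

lemma density_measure_cong: "(\<And>x. 0 \<le> x \<Longrightarrow> f x = f' x) \<Longrightarrow> density_measure f = density_measure f'"
  unfolding density_measure_def
  by (intro arg_cong[where f="density lborel"] ext) (auto simp: indicator_def)

text \<open>Age 0 is a null set. Hence initial measures are fixed by the densities at positive ages,
  whatever the boundary conditions prescribe at age 0.\<close>

lemma density_measure_cong_pos:
  assumes "set_borel_measurable borel {0..} f" "set_borel_measurable borel {0..} f'"
    and eq: "\<And>x. 0 < x \<Longrightarrow> f x = f' x"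
  shows "density_measure f = density_measure f'"
  unfolding density_measure_def
proof (rule density_cong)
  show "AE x in lborel. ennreal (indicator {0..} x * f x) = ennreal (indicator {0..} x * f' x)"
    using AE_lborel_singleton[of "0::real"] by eventually_elim (auto simp: indicator_def eq)
qed (use assms(1,2) in \<open>auto simp: set_borel_measurable_def\<close>)

lemma density_rate_cong_pos:
  assumes eq: "\<And>x. 0 < x \<Longrightarrow> f x = f' x" and ages: "ages G \<subseteq> {0..}"
  shows "density_rate G g f = density_rate G g f'"
  unfolding density_rate_def
proof (intro nn_integral_cong_AE)
  show "AE x in lborel. ennreal (f x * hazard G g x) * indicator (ages G) x =
      ennreal (f' x * hazard G g x) * indicator (ages G) x"
    using AE_lborel_singleton[of "0::real"]
  proof eventually_elim
    case (elim x)
    then show ?case using ages eq[of x] by (cases "0 < x") (auto simp: indicator_def)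
  qed
qed

lemma cumulative_cong_pos:
  assumes eq: "\<And>x. 0 < x \<Longrightarrow> f x = f' x"
    and f: "set_borel_measurable borel {0..} f" "set_borel_measurable borel {0..} f'"
  shows "cumulative f y = cumulative f' y"
  unfolding cumulative_def set_lebesgue_integral_def
proof (rule integral_cong_AE)
  have *: "(\<lambda>x. indicator {x. 0 \<le> x \<and> ereal x \<le> y} x *\<^sub>R h x) \<in> borel_measurable lborel"
    if "set_borel_measurable borel {0..} h" for h :: "real \<Rightarrow> real"
  proof -
    have "(\<lambda>x. indicator {x. 0 \<le> x \<and> ereal x \<le> y} x *\<^sub>R (indicator {0..} x *\<^sub>R h x)) \<in> borel_measurable borel"
      using that cumulative_set_measurable[of y] unfolding set_borel_measurable_def by measurable
    also have "(\<lambda>x. indicator {x. 0 \<le> x \<and> ereal x \<le> y} x *\<^sub>R (indicator {0..} x *\<^sub>R h x)) =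
      (\<lambda>x. indicator {x. 0 \<le> x \<and> ereal x \<le> y} x *\<^sub>R h x)"
      by (auto simp: indicator_def)
    finally show ?thesis by simp
  qed
  then show "(\<lambda>x. indicator {x. 0 \<le> x \<and> ereal x \<le> y} x *\<^sub>R f x) \<in> borel_measurable lborel"
    "(\<lambda>x. indicator {x. 0 \<le> x \<and> ereal x \<le> y} x *\<^sub>R f' x) \<in> borel_measurable lborel"
    using f by auto
  show "AE x in lborel. indicator {x. 0 \<le> x \<and> ereal x \<le> y} x *\<^sub>R f x =
      indicator {x. 0 \<le> x \<and> ereal x \<le> y} x *\<^sub>R f' x"
    using AE_lborel_singleton[of "0::real"] by eventually_elim (auto simp: indicator_def eq)
qed

lemma set_integral_density_measure:
  fixes h :: "real \<Rightarrow> real"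
  assumes f: "set_borel_measurable borel {0..} f" "\<And>x. 0 \<le> x \<Longrightarrow> 0 \<le> f x"
    and A: "A \<subseteq> {0..}" and h: "set_borel_measurable borel A h"
  shows "(LINT x:A|density_measure f. h x) = (LBINT x:A. h x * f x)"
proof -
  have "(LINT x:A|density_measure f. h x) =
      (LINT x|lborel. (indicator {0..} x * f x) *\<^sub>R (indicator A x *\<^sub>R h x))"
    unfolding set_lebesgue_integral_def density_measure_def
    using f h by (intro integral_density) (auto simp: set_borel_measurable_def indicator_def)
  also have "\<dots> = (LBINT x:A. h x * f x)"
    unfolding set_lebesgue_integral_def
    using A by (intro Bochner_Integration.integral_cong) (auto simp: indicator_def)
  finally show ?thesis .
qed

lemma measure_density_measure:
  assumes f: "set_borel_measurable borel {0..} f" "\<And>x. 0 \<le> x \<Longrightarrow> 0 \<le> f x"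
    and A: "A \<subseteq> {0..}" "A \<in> sets borel"
  shows "measure (density_measure f) A = (LBINT x:A. f x)"
proof -
  have "measure (density_measure f) A = (LINT x:A|density_measure f. 1)"
    using A by (simp add: set_lebesgue_integral_def density_measure_def)
  also have "\<dots> = (LBINT x:A. 1 * f x)"
    using A f by (intro set_integral_density_measure) (auto simp: set_borel_measurable_def)
  finally show ?thesis by simp
qed

lemma age_density_measurable: "age_density G f \<Longrightarrow> set_borel_measurable borel {0..} f"
  using borel_measurable_integrable[of lborel "\<lambda>x. indicator {0..} x *\<^sub>R f x"]
  by (auto simp: age_density_def set_integrable_def set_borel_measurable_def)

lemma measure_age_density:
  assumes "age_density G f"
  shows "A \<in> sets borel \<Longrightarrow> A \<subseteq> {0..} \<Longrightarrow> measure (density_measure f) A = (LBINT x:A. f x)"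
    and "measure (density_measure f) {x. 0 \<le> x \<and> ereal x \<le> y} = cumulative f y"
    and "measure (density_measure f) {0..} = cumulative f \<infinity>"
proof -
  show *: "A \<in> sets borel \<Longrightarrow> A \<subseteq> {0..} \<Longrightarrow> measure (density_measure f) A = (LBINT x:A. f x)" for A
    using assms age_density_measurable[OF assms]
    by (intro measure_density_measure) (auto simp: age_density_def)
  show "measure (density_measure f) {x. 0 \<le> x \<and> ereal x \<le> y} = cumulative f y"
    unfolding cumulative_def by (intro * cumulative_set_measurable) auto
  show "measure (density_measure f) {0..} = cumulative f \<infinity>"
    unfolding cumulative_top by (intro *) auto
qed

lemma nn_integral_density_measure:
  assumes f: "set_borel_measurable borel {0..} f" "\<And>x. 0 \<le> x \<Longrightarrow> 0 \<le> f x"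
    and A: "A \<subseteq> {0..}" and h: "set_borel_measurable borel A h"
  shows "(\<integral>\<^sup>+x\<in>A. ennreal (h x) \<partial>density_measure f) = (\<integral>\<^sup>+x\<in>A. ennreal (f x * h x) \<partial>lborel)"
proof -
  have "(\<integral>\<^sup>+x\<in>A. ennreal (h x) \<partial>density_measure f) = (\<integral>\<^sup>+x. ennreal (indicator A x *\<^sub>R h x) \<partial>density_measure f)"
    by (intro nn_integral_cong) (auto simp: indicator_def)
  also have "\<dots> = (\<integral>\<^sup>+x. ennreal (indicator {0..} x * f x) * ennreal (indicator A x *\<^sub>R h x) \<partial>lborel)"
    unfolding density_measure_def
    using f h by (intro nn_integral_density) (auto simp: set_borel_measurable_def)
  also have "\<dots> = (\<integral>\<^sup>+x\<in>A. ennreal (f x * h x) \<partial>lborel)"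
    using A f(2) by (intro nn_integral_cong) (auto simp: indicator_def ennreal_mult')
  finally show ?thesis .
qed

context lifetime
begin

lemma hazard_set_measurable: "A \<in> sets borel \<Longrightarrow> A \<subseteq> ages G \<Longrightarrow> set_borel_measurable borel A (hazard G g)"
proof -
  assume [measurable]: "A \<in> sets borel" and A: "A \<subseteq> ages G"
  have "(\<lambda>x. indicator A x * (indicator (ages G) x * hazard G g x)) \<in> borel_measurable borel"
    by measurable
  also have "(\<lambda>x. indicator A x * (indicator (ages G) x * hazard G g x)) = (\<lambda>x. indicator A x *\<^sub>R hazard G g x)"
    using A by (auto simp: indicator_def fun_eq_iff)
  finally show ?thesis by (simp add: set_borel_measurable_def)
qed

lemma nn_integral_hazard:
  assumes "age_density G f" "A \<in> sets borel" "A \<subseteq> ages G"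
  shows "(\<integral>\<^sup>+x\<in>A. ennreal (hazard G g x) \<partial>density_measure f) = (\<integral>\<^sup>+x\<in>A. ennreal (f x * hazard G g x) \<partial>lborel)"
  using assms age_density_measurable[OF assms(1)] ages_nonneg
  by (intro nn_integral_density_measure hazard_set_measurable) (auto simp: age_density_def)

lemma age_measure_density_measure:
  assumes "age_density G f"
  shows "age_measure G (density_measure f)"
  unfolding age_measure_def
proof (intro conjI)
  note [measurable] = age_density_measurable[OF assms, unfolded set_borel_measurable_def real_scaleR_def]
  show "sets (density_measure f) = sets borel" by (simp add: density_measure_def)
  have "emeasure (density_measure f) (space (density_measure f)) =
      (\<integral>\<^sup>+x. ennreal (indicator {0..} x *\<^sub>R f x) \<partial>lborel)"
    unfolding density_measure_def by (subst emeasure_density) auto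
  also have "\<dots> = ennreal (LBINT x:{0..}. f x)"
    using assms unfolding set_lebesgue_integral_def
    by (intro nn_integral_eq_integral) (auto simp: age_density_def set_integrable_def indicator_def)
  finally show "finite_measure (density_measure f)"
    by (intro finite_measureI) simp
  have "emeasure (density_measure f) (- ages G) =
      (\<integral>\<^sup>+x. ennreal (indicator {0..} x * f x) * indicator (- ages G) x \<partial>lborel)"
    unfolding density_measure_def by (subst emeasure_density) auto
  also have "\<dots> = (\<integral>\<^sup>+(x::real). 0 \<partial>lborel)"
    using assms by (intro nn_integral_cong) (auto simp: indicator_def age_density_def)
  finally show "emeasure (density_measure f) (- ages G) = 0" by simp
qed

lemma measure_ages:
  assumes "age_measure G \<mu>"
  shows "measure \<mu> (ages G) = measure \<mu> {0..}"
proof -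
  interpret finite_measure \<mu> using assms by (simp add: age_measure_def)
  have sets: "sets \<mu> = sets borel" using assms by (simp add: age_measure_def)
  have "- ages G \<in> null_sets \<mu>"
    using assms by (intro null_setsI) (simp_all add: age_measure_def)
  then have "AE x in \<mu>. x \<notin> - ages G" by (rule AE_not_in)
  then have "AE x in \<mu>. x \<in> ages G \<longleftrightarrow> x \<in> {0..}"
    by eventually_elim (auto dest: ages_nonneg)
  then show ?thesis
    by (intro measure_eq_AE) (auto simp: sets)
qed

lemma age_measure_neg: "age_measure G \<mu> \<Longrightarrow> emeasure \<mu> {..<0} = 0"
  by (rule emeasure_eq_0[of "- ages G"]) (auto simp: age_measure_def dest: ages_nonneg)

end

context aging
begin

lemma f_neg: "x < 0 \<Longrightarrow> f x = 0"
  by (rule f_ages) (auto dest: ages_nonneg)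

lemma nn_k: "0 \<le> t \<Longrightarrow> (\<integral>\<^sup>+s\<in>{0..t}. ennreal (k s) \<partial>lborel) = ennreal (LBINT s:{0..t}. k s)"
proof -
  assume t: "0 \<le> t"
  have "(\<integral>\<^sup>+s\<in>{0..t}. ennreal (k s) \<partial>lborel) = (\<integral>\<^sup>+s. ennreal (indicator {0..t} s *\<^sub>R k s) \<partial>lborel)"
    by (intro nn_integral_cong) (auto simp: indicator_def)
  also have "\<dots> = ennreal (LBINT s:{0..t}. k s)"
    unfolding set_lebesgue_integral_def using k_integrable[OF t] k_nonneg
    by (intro nn_integral_eq_integral) (auto simp: set_integrable_def)
  finally show ?thesis .
qed

lemma nn_f: "(\<integral>\<^sup>+x. ennreal (f x) \<partial>lborel) = ennreal (LBINT x. f x)"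
  using f_integrable f_nonneg by (intro nn_integral_eq_integral) auto

text \<open>Both terms on the left of the mass balance are bounded by its right side, which is
  finite by the assumptions on \<open>k\<close> and \<open>f\<close>.\<close>

lemma
  assumes t: "0 \<le> t"
  shows transport_integrable: "integrable lborel (transport t)"
    and nn_rate_finite: "(\<integral>\<^sup>+s\<in>{0..t}. density_rate G g (transport s) \<partial>lborel) < \<infinity>"
proof -
  have "(\<integral>\<^sup>+x. ennreal (transport t x) \<partial>lborel) + (\<integral>\<^sup>+s\<in>{0..t}. density_rate G g (transport s) \<partial>lborel) < \<infinity>"
    unfolding nn_mass_balance[OF t] nn_k[OF t] nn_f by simp
  then show "integrable lborel (transport t)"
    "(\<integral>\<^sup>+s\<in>{0..t}. density_rate G g (transport s) \<partial>lborel) < \<infinity>"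
    by (auto intro!: integrableI_nonneg simp: transport_nonneg)
qed

lemma rate_locally_integrable: "locally_integrable (\<lambda>s. density_rate G g (transport s))"
  unfolding locally_integrable_def
  using density_rate_transport_measurable nn_rate_finite by blast

lemma mass_balance:
  assumes t: "0 \<le> t"
  shows "(LBINT x. transport t x) + time_integral (\<lambda>s. density_rate G g (transport s)) t =
    (LBINT x. f x) + (LBINT s:{0..t}. k s)"
proof -
  have "ennreal (LBINT x. transport t x) = (\<integral>\<^sup>+x. ennreal (transport t x) \<partial>lborel)"
    using transport_integrable[OF t] transport_nonneg by (intro nn_integral_eq_integral[symmetric]) auto
  then have "ennreal (LBINT x. transport t x) + ennreal (time_integral (\<lambda>s. density_rate G g (transport s)) t) =
      ennreal (LBINT x. f x) + ennreal (LBINT s:{0..t}. k s)"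
    using nn_mass_balance[OF t] locally_integrable_enn2real(5)[OF rate_locally_integrable t]
    by (simp add: nn_k[OF t] nn_f)
  moreover have "0 \<le> (LBINT s:{0..t}. k s)"
    by (simp add: set_lebesgue_integral_def k_nonneg)
  moreover have "0 \<le> time_integral (\<lambda>s. density_rate G g (transport s)) t"
    by (simp add: time_integral_def)
  ultimately show ?thesis
    using transport_nonneg f_nonneg by (simp flip: ennreal_plus)
qed

lemma age_density_transport: "0 \<le> t \<Longrightarrow> age_density G (transport t)"
  unfolding age_density_def set_integrable_def
  using transport_integrable[of t] integrable_mult_indicator[of "{0..}" lborel "transport t"]
  by (auto simp: transport_nonneg transport_ages)

lemma age_density_f: "age_density G f"
  unfolding age_density_def set_integrable_def
  using f_integrable integrable_mult_indicator[of "{0..}" lborel f]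
  by (auto simp: f_nonneg f_ages)

lemma LBINT_transport: "(LBINT x. transport t x) = cumulative (transport t) \<infinity>"
  unfolding cumulative_top set_lebesgue_integral_def
  by (intro Bochner_Integration.integral_cong) (auto simp: indicator_def transport_neg)

lemma LBINT_f: "(LBINT x. f x) = cumulative f \<infinity>"
  unfolding cumulative_top set_lebesgue_integral_def
  by (intro Bochner_Integration.integral_cong)
     (auto simp: indicator_def f_neg)

lemma ages_along_transport: "ages_along G transport"
  unfolding ages_along_def
proof (intro allI ballI impI)
  fix t x u :: real assume "0 \<le> t" and x: "x \<in> ages G" and u: "0 < u"
  have "0 < survival G x" "0 \<le> x" using x survival_pos ages_nonneg by auto
  then show "transport (t + u) (x + u) = transport t x * (survival G (x + u) / survival G x)"
    using u by (simp add: transport_def)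
qed

text \<open>Every point with age in \<open>ages G\<close> lies on a characteristic that started
  either at age 0 or at time 0. Characteristics that start outside \<open>ages G\<close> are not
  governed by \<open>ages_along\<close>, which is why vanishing there is assumed separately.\<close>

lemma ages_along_eq_transport:
  assumes b: "ages_along G b" and off: "\<And>t x. 0 \<le> t \<Longrightarrow> 0 \<le> x \<Longrightarrow> x \<notin> ages G \<Longrightarrow> b t x = 0"
    and k: "\<And>t. 0 \<le> t \<Longrightarrow> b t 0 = k t" and f: "\<And>x. 0 < x \<Longrightarrow> b 0 x = f x"
    and t: "0 \<le> t" and x: "0 \<le> x"
  shows "b t x = transport t x"
proof (cases "x \<in> ages G")
  case False
  then show ?thesis using off[OF t x] by (simp add: transport_ages)
next
  case True
  have along: "b (t + u) (x + u) = b t x * (survival G (x + u) / survival G x)"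
    if "0 \<le> t" "x \<in> ages G" "0 < u" for t x u
    using b that by (simp add: ages_along_def)
  consider "x = 0" | "0 < x" "x \<le> t" | "t < x" using x by linarith
  then show ?thesis
  proof cases
    case 1
    then show ?thesis using t k[OF t] by (simp add: transport_def survival_0)
  next
    case 2
    then have "b ((t - x) + x) (0 + x) = b (t - x) 0 * (survival G (0 + x) / survival G 0)"
      by (intro along zero_in_ages) auto
    then show ?thesis using 2 k[of "t - x"] by (simp add: transport_def survival_0)
  next
    case 3
    have xt: "x - t \<in> ages G" using ages_downward[OF True, of "x - t"] 3 t by simp
    show ?thesis
    \<comment> \<open>\<open>ages_along\<close> moves by strictly positive times, so time 0 needs
      the initial condition itself.\<close>
    proof (cases "t = 0")
      case True
      then show ?thesis using 3 f[of x] survival_pos[OF xt] x by (simp add: transport_def)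
    next
      case False
      then have "b (0 + t) ((x - t) + t) = b 0 (x - t) * (survival G ((x - t) + t) / survival G (x - t))"
        using t xt by (intro along) auto
      then show ?thesis using 3 f[of "x - t"] x by (simp add: transport_def)
    qed
  qed
qed

text \<open>The right side is the form of the measure-valued equations; it is the signed counterpart
  of \<open>nn_integral_transport\<close>, with integrability supplied by the bound on the test
  function.\<close>

lemma transport_integral:
  assumes \<psi>: "bounded_continuous \<psi>" and t: "0 \<le> t"
  shows "(LINT x:{0..}|density_measure (transport t). \<psi> x) =
    (LINT x:ages G|density_measure f. \<psi> (x + t) * (survival G (x + t) / survival G x)) +
    (LBINT s:{0..t}. \<psi> (t - s) * survival G (t - s) * k s)"
proof -
  have m [measurable]: "(\<lambda>x. indicator {0..} x * \<psi> x) \<in> borel_measurable borel"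
    using borel_measurable_continuous_on_indicator[of "{0..}" \<psi>] \<psi>
    by (simp add: bounded_continuous_def)
  obtain C where C: "\<And>x. 0 \<le> x \<Longrightarrow> \<bar>\<psi> x\<bar> \<le> C"
    using \<psi> unfolding bounded_continuous_def bounded_iff by auto
  \<comment> \<open>Test functions are controlled on the half-line only; cutting off makes them
    measurable and bounded on the whole line.\<close>
  define \<Psi> where "\<Psi> x = indicator {0..} x * \<psi> x" for x
  have [measurable]: "\<Psi> \<in> borel_measurable borel" unfolding \<Psi>_def by measurable
  have bound: "\<bar>\<Psi> x\<bar> \<le> \<bar>C\<bar>" for x using C[of x] by (auto simp: \<Psi>_def indicator_def)
  have int: "integrable lborel (\<lambda>x. \<Psi> x * transport t x)"
    by (rule Bochner_Integration.integrable_bound[OF integrable_mult_right[OF transport_integrable[OF t], of "\<bar>C\<bar>"]])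
       (auto simp: abs_mult transport_nonneg intro!: mult_right_mono bound)
  have "(LINT x:{0..}|density_measure (transport t). \<psi> x) = (LBINT x:{0..}. \<psi> x * transport t x)"
    using m by (intro set_integral_density_measure)
      (auto simp: set_borel_measurable_def transport_nonneg)
  also have "\<dots> = (LBINT x. \<Psi> x * transport t x)"
    unfolding set_lebesgue_integral_def \<Psi>_def by (simp add: mult.assoc)
  also have "\<dots> = (LBINT x. indicator {t<..} x * (\<Psi> x * transport t x) + indicator {0..t} x * (\<Psi> x * transport t x))"
    using t by (intro Bochner_Integration.integral_cong) (auto simp: indicator_def transport_neg)
  also have "\<dots> = (LBINT x. indicator {t<..} x * (\<Psi> x * transport t x)) +
      (LBINT x. indicator {0..t} x * (\<Psi> x * transport t x))"
    using int by (intro Bochner_Integration.integral_add)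
      (auto intro!: integrable_mult_indicator[where 'b=real, unfolded real_scaleR_def])
  also have "(LBINT x. indicator {t<..} x * (\<Psi> x * transport t x)) =
      \<bar>1\<bar> *\<^sub>R (LBINT x. indicator {t<..} (t + 1 * x) * (\<Psi> (t + 1 * x) * transport t (t + 1 * x)))"
    by (rule lborel_integral_real_affine) simp
  also have "\<dots> = (LBINT x:ages G. (\<psi> (x + t) * (survival G (x + t) / survival G x)) * f x)"
    unfolding set_lebesgue_integral_def real_scaleR_def abs_one mult_1
  proof (rule integral_cong_AE)
    show "(\<lambda>x. indicator {t<..} (t + x) * (\<Psi> (t + x) * transport t (t + x))) \<in> borel_measurable lborel"
      by measurable
    have "(\<lambda>x. indicator (ages G) x * (\<Psi> (x + t) * (survival G (x + t) / survival G x) * f x)) \<in> borel_measurable lborel"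
      by measurable
    also have "(\<lambda>x. indicator (ages G) x * (\<Psi> (x + t) * (survival G (x + t) / survival G x) * f x)) =
        (\<lambda>x. indicator (ages G) x * (\<psi> (x + t) * (survival G (x + t) / survival G x) * f x))"
      using t ages_nonneg by (fastforce simp: \<Psi>_def indicator_def)
    finally show "(\<lambda>x. indicator (ages G) x * (\<psi> (x + t) * (survival G (x + t) / survival G x) * f x)) \<in> borel_measurable lborel" .
    show "AE x in lborel. indicator {t<..} (t + x) * (\<Psi> (t + x) * transport t (t + x)) =
      indicator (ages G) x * (\<psi> (x + t) * (survival G (x + t) / survival G x) * f x)"
      using AE_lborel_singleton[of "0::real"]
    proof eventually_elim
      case (elim x)
      show ?case
      proof (cases "0 < x")
        case True
        then show ?thesis using t f_ages[of x]
          by (auto simp: transport_def \<Psi>_def add.commute indicator_def)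
      next
        case False
        then have "x \<notin> ages G" using elim ages_nonneg by fastforce
        then show ?thesis using False by simp
      qed
    qed
  qed
  also have "(LBINT x. indicator {0..t} x * (\<Psi> x * transport t x)) =
      \<bar>-1\<bar> *\<^sub>R (LBINT s. indicator {0..t} (t + (-1) * s) * (\<Psi> (t + (-1) * s) * transport t (t + (-1) * s)))"
    by (rule lborel_integral_real_affine) simp
  also have "\<dots> = (LBINT s:{0..t}. \<psi> (t - s) * survival G (t - s) * k s)"
    unfolding set_lebesgue_integral_def
    by (simp, intro Bochner_Integration.integral_cong)
       (auto simp: indicator_def \<Psi>_def transport_def)
  also have "(LBINT x:ages G. (\<psi> (x + t) * (survival G (x + t) / survival G x)) * f x) =
      (LINT x:ages G|density_measure f. \<psi> (x + t) * (survival G (x + t) / survival G x))"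
  proof (rule set_integral_density_measure[symmetric])
    show "ages G \<subseteq> {0..}" by (auto dest: ages_nonneg)
    have "(\<lambda>x. indicator (ages G) x * (\<Psi> (x + t) * (survival G (x + t) / survival G x))) \<in> borel_measurable borel"
      by measurable
    also have "(\<lambda>x. indicator (ages G) x * (\<Psi> (x + t) * (survival G (x + t) / survival G x))) =
        (\<lambda>x. indicator (ages G) x * (\<psi> (x + t) * (survival G (x + t) / survival G x)))"
      using t ages_nonneg by (fastforce simp: \<Psi>_def indicator_def)
    finally show "set_borel_measurable borel (ages G) (\<lambda>x. \<psi> (x + t) * (survival G (x + t) / survival G x))"
      by (simp add: set_borel_measurable_def)
  qed (auto simp: set_borel_measurable_def f_nonneg)
  finally show ?thesis .
qed

end

section \<open>Truncated densities and the queue front\<close>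

lemma set_borel_measurable_of_integrable:
  fixes f :: "real \<Rightarrow> real"
  assumes "\<And>t. 0 \<le> t \<Longrightarrow> set_integrable lborel {0..t} f"
  shows "set_borel_measurable borel {0..} f"
  unfolding set_borel_measurable_def
proof (rule borel_measurable_LIMSEQ_real[where u="\<lambda>n x. indicator {0..real n} x *\<^sub>R f x"])
  fix x :: real
  obtain n where n: "x \<le> real n" using real_arch_simple by blast
  have "\<forall>\<^sub>F m in sequentially. indicator {0..real m} x *\<^sub>R f x = indicator {0..} x *\<^sub>R f x"
    using eventually_ge_at_top[of n] by eventually_elim (use n in \<open>auto simp: indicator_def\<close>)
  then show "(\<lambda>n. indicator {0..real n} x *\<^sub>R f x) \<longlonglongrightarrow> indicator {0..} x *\<^sub>R f x"
    by (rule tendsto_eventually)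
next
  fix n :: nat
  show "(\<lambda>x. indicator {0..real n} x *\<^sub>R f x) \<in> borel_measurable borel"
    using borel_measurable_integrable[OF assms[of "real n", unfolded set_integrable_def]] by simp
qed

lemma locally_integrable_cong:
  assumes "locally_integrable h" "\<And>s. 0 \<le> s \<Longrightarrow> f s = h s"
  shows "locally_integrable f"
proof -
  have "f s * indicator A s = h s * indicator A s" if "A \<subseteq> {0..}" for A s
    using that assms(2)[of s] by (auto simp: indicator_def)
  then show ?thesis using assms(1) by (simp add: locally_integrable_def)
qed

lemma time_integral_cong:
  assumes "\<And>s. 0 \<le> s \<Longrightarrow> f s = h s"
  shows "time_integral f t = time_integral h t"
  unfolding time_integral_def using assms
  by (intro arg_cong[where f=enn2real] nn_integral_cong) (auto simp: indicator_def)

lemma age_density_set_integrable: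
  assumes "age_density G p" "A \<in> sets borel" "A \<subseteq> {0..}"
  shows "set_integrable lborel A p"
  using assms by (auto simp: age_density_def intro: set_integrable_subset)

lemma age_density_indicator_measurable:
  assumes "age_density G p" "A \<in> sets borel" "A \<subseteq> {0..}"
  shows "(\<lambda>x. indicator A x *\<^sub>R p x) \<in> borel_measurable lborel"
  using age_density_set_integrable[OF assms] unfolding set_integrable_def
  by (rule borel_measurable_integrable)

lemma cumulative_mono:
  assumes p: "age_density G p" and y: "y \<le> z"
  shows "cumulative p y \<le> cumulative p z"
proof -
  have "y < ereal x" if "z < ereal x" for x using y that by (rule le_less_trans)
  then have int: "set_integrable lborel {x. 0 \<le> x \<and> ereal x \<le> y} p" "set_integrable lborel {x. 0 \<le> x \<and> ereal x \<le> z} p"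
    using cumulative_set_measurable by (auto intro!: age_density_set_integrable[OF p])
  show ?thesis
    unfolding cumulative_def set_lebesgue_integral_def
    using int p y by (intro integral_mono) (auto simp: set_integrable_def indicator_def age_density_def)
qed

lemma cumulative_nonneg: "age_density G p \<Longrightarrow> 0 \<le> cumulative p y"
  unfolding cumulative_def set_lebesgue_integral_def
  by (intro integral_nonneg_AE AE_I2) (auto simp: indicator_def age_density_def)

lemma cumulative_ereal: "cumulative p (ereal y) = (LBINT x:{0..y}. p x)"
  by (simp add: cumulative_def atLeastAtMost_def atLeast_def atMost_def Int_def)

lemma cumulative_continuous:
  assumes "age_density G p"
  shows "continuous_on {0..} (\<lambda>y. cumulative p (ereal y))"
  unfolding cumulative_ereal
  by (intro continuous_on_LBINT age_density_set_integrable[OF assms]) auto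

lemma cumulative_0: "cumulative p 0 = 0"
  unfolding zero_ereal_def cumulative_ereal set_lebesgue_integral_def
  using AE_lborel_singleton[of "0::real"]
  by (intro integral_eq_zero_AE) (auto elim!: eventually_mono)

lemma cumulative_tendsto:
  assumes "age_density G p"
  shows "(\<lambda>n. cumulative p (ereal (real n))) \<longlonglongrightarrow> cumulative p \<infinity>"
  unfolding cumulative_ereal cumulative_top set_lebesgue_integral_def
proof (rule integral_dominated_convergence[where w="\<lambda>x. indicator {0..} x *\<^sub>R p x"])
  show "integrable lborel (\<lambda>x. indicator {0..} x *\<^sub>R p x)"
    using assms by (simp add: age_density_def set_integrable_def)
  then show "(\<lambda>x. indicator {0..} x *\<^sub>R p x) \<in> borel_measurable lborel"
    by (rule borel_measurable_integrable)
  show "(\<lambda>x. indicator {0..real n} x *\<^sub>R p x) \<in> borel_measurable lborel" for n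
    by (intro age_density_indicator_measurable[OF assms]) auto
  show "AE x in lborel. (\<lambda>n. indicator {0..real n} x *\<^sub>R p x) \<longlonglongrightarrow> indicator {0..} x *\<^sub>R p x"
  proof (rule AE_I2)
    fix x :: real
    obtain n where n: "x \<le> real n" using real_arch_simple by blast
    have "\<forall>\<^sub>F m in sequentially. indicator {0..real m} x *\<^sub>R p x = indicator {0..} x *\<^sub>R p x"
      using eventually_ge_at_top[of n] by eventually_elim (use n in \<open>auto simp: indicator_def\<close>)
    then show "(\<lambda>n. indicator {0..real n} x *\<^sub>R p x) \<longlonglongrightarrow> indicator {0..} x *\<^sub>R p x"
      by (rule tendsto_eventually)
  qed
  show "AE x in lborel. norm (indicator {0..real n} x *\<^sub>R p x) \<le> indicator {0..} x *\<^sub>R p x" for n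
    using assms by (intro AE_I2) (auto simp: indicator_def age_density_def)
qed

text \<open>The mass between the two levels is the integral of a nonnegative function and equals 0.
  This makes a queue boundary and the queue front interchangeable once they cut off equal
  masses.\<close>

lemma cumulative_eq_imp_AE:
  assumes p: "age_density G p" and eq: "cumulative p y = cumulative p z"
  shows "AE x in lborel. 0 \<le> x \<longrightarrow> p x \<noteq> 0 \<longrightarrow> (ereal x \<le> y \<longleftrightarrow> ereal x \<le> z)"
proof -
  have main: "AE x in lborel. 0 \<le> x \<longrightarrow> p x \<noteq> 0 \<longrightarrow> (ereal x \<le> y \<longleftrightarrow> ereal x \<le> z)"
    if yz: "y \<le> z" and eq: "cumulative p y = cumulative p z" for y z
  proof -
    let ?A = "{x. 0 \<le> x \<and> ereal x \<le> y}" and ?C = "{x. 0 \<le> x \<and> ereal x \<le> z}"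
    let ?D = "\<lambda>x. indicator ?C x *\<^sub>R p x - indicator ?A x *\<^sub>R p x"
    have int: "integrable lborel (\<lambda>x. indicator ?A x *\<^sub>R p x)" "integrable lborel (\<lambda>x. indicator ?C x *\<^sub>R p x)"
      using cumulative_set_measurable age_density_set_integrable[OF p, of ?A] age_density_set_integrable[OF p, of ?C]
      by (auto simp: set_integrable_def)
    have "integral\<^sup>L lborel ?D = 0"
      using int eq by (simp add: cumulative_def set_lebesgue_integral_def)
    moreover have "0 \<le> ?D x" for x
      using p yz by (auto simp: indicator_def age_density_def)
    ultimately have "AE x in lborel. ?D x = 0"
      using int by (subst (asm) integral_nonneg_eq_0_iff_AE) auto
    then show ?thesis
      using yz by eventually_elim (auto simp: indicator_def split: if_splits)
  qed
  show ?thesis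
  proof (cases "y \<le> z")
    case True
    then show ?thesis using eq by (rule main)
  next
    case False
    then have "AE x in lborel. 0 \<le> x \<longrightarrow> p x \<noteq> 0 \<longrightarrow> (ereal x \<le> z \<longleftrightarrow> ereal x \<le> y)"
      using eq by (intro main) auto
    then show ?thesis by eventually_elim auto
  qed
qed

text \<open>A snapshot of the queue at one time: \<open>p\<close> is the potential queue and
  \<open>w\<close> the boundary. Age 0 is exempt from truncation and keeps only a sign
  condition.\<close>

locale truncation = lifetime +
  fixes p q :: "real \<Rightarrow> real" and w :: ereal
  assumes p: "age_density G p" and w: "0 \<le> w"
    and below: "\<And>x. 0 < x \<Longrightarrow> ereal x \<le> w \<Longrightarrow> q x = p x"
    and above: "\<And>x. 0 < x \<Longrightarrow> w < ereal x \<Longrightarrow> q x = 0"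
    and q_0: "0 \<le> q 0"
begin

lemma AE_q: "AE x in lborel. indicator {0..} x *\<^sub>R q x = indicator {x. 0 \<le> x \<and> ereal x \<le> w} x *\<^sub>R p x"
  using AE_lborel_singleton[of "0::real"]
proof eventually_elim
  case (elim x)
  then show ?case using below[of x] above[of x]
    by (cases "0 < x"; cases "ereal x \<le> w") (auto simp: indicator_def)
qed

text \<open>An identity up to null sets does not give Borel measurability of \<open>q\<close>, so
  age 0 is split off exactly.\<close>

lemma q_eq: "(\<lambda>x. indicator {0..} x *\<^sub>R q x) =
    (\<lambda>x. if x = 0 then q 0 else indicator {x. 0 \<le> x \<and> ereal x \<le> w} x *\<^sub>R p x)"
proof
  fix x
  show "indicator {0..} x *\<^sub>R q x = (if x = 0 then q 0 else indicator {x. 0 \<le> x \<and> ereal x \<le> w} x *\<^sub>R p x)"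
    using below[of x] above[of x]
    by (cases "0 < x"; cases "ereal x \<le> w") (auto simp: indicator_def)
qed

lemma age_density_q: "age_density G q"
proof -
  have int: "integrable lborel (\<lambda>x. indicator {x. 0 \<le> x \<and> ereal x \<le> w} x *\<^sub>R p x)"
    using age_density_set_integrable[OF p cumulative_set_measurable] by (auto simp: set_integrable_def)
  have meas: "(\<lambda>x. indicator {0..} x *\<^sub>R q x) \<in> borel_measurable lborel"
    unfolding q_eq using borel_measurable_integrable[OF int] by measurable
  have "set_integrable lborel {0..} q"
    unfolding set_integrable_def
    using integrable_cong_AE[OF meas borel_measurable_integrable[OF int] AE_q] int by simp
  moreover have "0 \<le> q x \<and> (x \<notin> ages G \<longrightarrow> q x = 0)" if "0 \<le> x" for x
    using that p zero_in_ages q_0 below[of x] above[of x]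
    by (cases "x = 0"; cases "ereal x \<le> w") (auto simp: age_density_def)
  ultimately show ?thesis by (auto simp: age_density_def)
qed

lemma cumulative_q: "cumulative q y = cumulative p (min y w)"
  unfolding cumulative_def set_lebesgue_integral_def
proof (rule integral_cong_AE)
  show "(\<lambda>x. indicator {x. 0 \<le> x \<and> ereal x \<le> y} x *\<^sub>R q x) \<in> borel_measurable lborel"
    by (intro age_density_indicator_measurable[OF age_density_q] cumulative_set_measurable) auto
  show "(\<lambda>x. indicator {x. 0 \<le> x \<and> ereal x \<le> min y w} x *\<^sub>R p x) \<in> borel_measurable lborel"
    by (intro age_density_indicator_measurable[OF p] cumulative_set_measurable) auto
  show "AE x in lborel. indicator {x. 0 \<le> x \<and> ereal x \<le> y} x *\<^sub>R q x =
      indicator {x. 0 \<le> x \<and> ereal x \<le> min y w} x *\<^sub>R p x"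
    using AE_q by eventually_elim (auto simp: indicator_def split: if_splits)
qed

lemma cumulative_q_top: "cumulative q \<infinity> = cumulative p w"
  by (simp add: cumulative_q)

text \<open>By monotonicity, truncating in age amounts to truncating the cumulative mass. The
  two-parameter queue is thereby recovered from \<eta> and the queue length without reference to the
  boundary.\<close>

lemma cumulative_q_min: "cumulative q y = min (cumulative p y) (cumulative q \<infinity>)"
  using cumulative_mono[OF p, of y w] cumulative_mono[OF p, of w y]
  by (cases "y \<le> w") (auto simp: cumulative_q min_def)

text \<open>\<open>p\<close> has no mass between \<open>z\<close> and \<open>w\<close>, so any level
  of the right mass yields the same reneging rate. It is applied with the queue front as
  \<open>z\<close>.\<close>

lemma density_rate_q:
  assumes "cumulative p z = cumulative q \<infinity>"
  shows "density_rate G g q = (\<integral>\<^sup>+x\<in>{x \<in> ages G. ereal x \<le> z}. ennreal (hazard G g x) \<partial>density_measure p)"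
proof -
  have "cumulative p z = cumulative p w" using assms by (simp add: cumulative_q_top)
  note AE = cumulative_eq_imp_AE[OF p this]
  have "(\<integral>\<^sup>+x\<in>{x \<in> ages G. ereal x \<le> z}. ennreal (hazard G g x) \<partial>density_measure p) =
      (\<integral>\<^sup>+x\<in>{x \<in> ages G. ereal x \<le> z}. ennreal (p x * hazard G g x) \<partial>lborel)"
    by (rule nn_integral_hazard[OF p]) auto
  also have "\<dots> = density_rate G g q"
    unfolding density_rate_def
  proof (rule nn_integral_cong_AE)
    show "AE x in lborel. ennreal (p x * hazard G g x) * indicator {x \<in> ages G. ereal x \<le> z} x =
        ennreal (q x * hazard G g x) * indicator (ages G) x"
      using AE AE_q
      by eventually_elim (auto simp: indicator_def dest: ages_nonneg split: if_splits)
  qed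
  finally show ?thesis ..
qed

end

context lifetime
begin

lemma cumulative_outside_ages:
  assumes p: "age_density G p" and x: "0 \<le> x" "x \<notin> ages G"
  shows "cumulative p (ereal x) = cumulative p \<infinity>"
  unfolding cumulative_ereal cumulative_top set_lebesgue_integral_def
proof (intro Bochner_Integration.integral_cong refl)
  fix y
  have "y \<notin> ages G" if "x < y" using ages_downward[of y x] x that by auto
  then show "indicator {0..x} y *\<^sub>R p y = indicator {0..} y *\<^sub>R p y"
    using p x by (cases "y \<le> x") (auto simp: indicator_def age_density_def)
qed

text \<open>The cumulative mass is continuous and starts at 0, so it takes the value
  \<open>c\<close> exactly at the infimum. Restricting the infimum to \<open>ages G\<close> is
  harmless because the total mass is already reached outside.\<close>

lemma cumulative_front:
  assumes p: "age_density G p" and c: "0 \<le> c" "c \<le> cumulative p \<infinity>"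
  defines "front \<equiv> Inf {ereal x | x. x \<in> ages G \<and> c \<le> measure (density_measure p) {0..x}}"
  shows "0 \<le> front" and "cumulative p front = c"
proof -
  define F where "F x = cumulative p (ereal x)" for x
  define Z where "Z = {x \<in> ages G. c \<le> F x}"
  have F: "measure (density_measure p) {0..x} = F x" for x
    unfolding F_def cumulative_ereal by (rule measure_age_density(1)[OF p]) auto
  have front: "front = Inf (ereal ` Z)"
    unfolding front_def F Z_def by (rule arg_cong[where f=Inf]) auto
  have contF: "continuous_on {0..} F"
    unfolding F_def by (rule cumulative_continuous[OF p])
  have F0: "F 0 = 0" using cumulative_0[of p] by (simp add: F_def zero_ereal_def)
  have Fmono: "F x \<le> F y" if "x \<le> y" for x y
    unfolding F_def using that by (intro cumulative_mono[OF p]) simp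
  have mean: "\<exists>y\<ge>0. y \<le> x \<and> F y = d" if "0 \<le> x" "0 \<le> d" "d \<le> F x" for x d
    using IVT'[of F 0 d x] that F0 continuous_on_subset[OF contF, of "{0..x}"] by auto
  show "0 \<le> front"
    unfolding front by (rule Inf_greatest) (auto simp: Z_def dest: ages_nonneg)
  show "cumulative p front = c"
  proof (cases "Z = {}")
    case True
    \<comment> \<open>the front is infinite, and \<open>c\<close> has to be the total mass\<close>
    have "\<not> c < cumulative p \<infinity>"
    proof
      assume "c < cumulative p \<infinity>"
      \<comment> \<open>A level strictly between \<open>c\<close> and the total mass is attained at
        some point, which must lie in \<open>ages G\<close> since the cumulative mass is not yet
        total there.\<close>
      then obtain d where d: "c < d" "d < cumulative p \<infinity>" using dense by blast
      have "\<forall>\<^sub>F n in sequentially. d < F (real n)"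
        using order_tendstoD(1)[OF cumulative_tendsto[OF p] d(2)] by (simp add: F_def)
      then obtain n where "d < F (real n)"
        using eventually_happens trivial_limit_sequentially by blast
      then obtain y where y: "0 \<le> y" "F y = d"
        using mean[of "real n" d] c d by auto
      then have "y \<in> ages G"
        using cumulative_outside_ages[OF p, of y] d by (auto simp: F_def)
      then have "y \<in> Z" using y d by (simp add: Z_def)
      then show False using True by simp
    qed
    then show ?thesis using c True by (simp add: front top_ereal_def)
  next
    case False
    define x0 where "x0 = Inf Z"
    have bdd: "bdd_below Z" by (auto simp: Z_def dest: ages_nonneg intro!: bdd_belowI[of _ 0])
    have x0_le: "x0 \<le> z" if "z \<in> Z" for z unfolding x0_def using that bdd by (rule cInf_lower)
    have x0_nonneg: "0 \<le> x0"
      unfolding x0_def using False by (rule cInf_greatest) (auto simp: Z_def dest: ages_nonneg)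
    \<comment> \<open>\<open>ages G\<close> may be half-open, so \<open>Z\<close> is not obviously
      closed. Dropping the age condition gives a closed set that contains the infimum; its age
      condition follows from \<open>ages_downward\<close>.\<close>
    define V where "V = {x \<in> {0..}. c \<le> F x}"
    have "closed V"
      unfolding V_def using contF by (intro continuous_closed_preimage_constant continuous_on_closed_Collect_le) (auto intro: continuous_intros)
    moreover have "Z \<subseteq> V" by (auto simp: Z_def V_def dest: ages_nonneg)
    ultimately have "closure Z \<subseteq> V" by (rule closure_minimal[rotated])
    then have "x0 \<in> V" unfolding x0_def using closure_contains_Inf[OF False bdd] by auto
    moreover have "x0 \<in> ages G"
      using False x0_le x0_nonneg ages_downward by (auto simp: Z_def)
    ultimately have x0: "x0 \<in> Z" by (simp add: V_def Z_def)
    have "front = ereal x0"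
      unfolding front using x0 x0_le by (intro Inf_eqI) auto
    moreover have "F x0 = c"
    proof -
      obtain y where y: "0 \<le> y" "y \<le> x0" "F y = c"
        using mean[of x0 c] c x0 x0_nonneg by (auto simp: Z_def)
      have "y \<in> ages G" using x0 y ages_downward[of x0 y] by (simp add: Z_def)
      then have "x0 \<le> y" using y by (intro x0_le) (simp add: Z_def)
      then show ?thesis using y by simp
    qed
    ultimately show ?thesis by (simp add: F_def)
  qed
qed

end

section \<open>Transport as the solution of the measure equations\<close>

context aging
begin

lemma stieltjes_integral:
  assumes K: "\<And>t. 0 \<le> t \<Longrightarrow> K t = (LBINT s:{0..t}. k s)" and \<psi>: "bounded_continuous \<psi>"
  shows "(LINT s:{0..t}|stieltjes_measure K. \<psi> (t - s) * survival G (t - s)) =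
    (LBINT s:{0..t}. \<psi> (t - s) * survival G (t - s) * k s)"
proof -
  have m [measurable]: "(\<lambda>x. indicator {0..} x * \<psi> x) \<in> borel_measurable borel"
    using borel_measurable_continuous_on_indicator[of "{0..}" \<psi>] \<psi>
    by (simp add: bounded_continuous_def)
  have meas: "(\<lambda>s. indicator {0..t} s *\<^sub>R (\<psi> (t - s) * survival G (t - s))) \<in> borel_measurable borel"
  proof -
    have "(\<lambda>s. indicator {0..t} s * ((indicator {0..} (t - s) * \<psi> (t - s)) * survival G (t - s))) \<in> borel_measurable borel"
      by measurable
    also have "(\<lambda>s. indicator {0..t} s * ((indicator {0..} (t - s) * \<psi> (t - s)) * survival G (t - s))) =
        (\<lambda>s. indicator {0..t} s *\<^sub>R (\<psi> (t - s) * survival G (t - s)))"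
      by (auto simp: fun_eq_iff indicator_def)
    finally show ?thesis .
  qed
  have "stieltjes_measure K = density lborel (\<lambda>s. ennreal (k s))"
    by (rule stieltjes_measure_eq_density) (auto simp: k_nonneg k_neg k_integrable K)
  then have "(LINT s:{0..t}|stieltjes_measure K. \<psi> (t - s) * survival G (t - s)) =
      (LBINT s. k s *\<^sub>R (indicator {0..t} s *\<^sub>R (\<psi> (t - s) * survival G (t - s))))"
    unfolding set_lebesgue_integral_def
    using meas by (simp add: integral_density k_nonneg)
  also have "\<dots> = (LBINT s:{0..t}. \<psi> (t - s) * survival G (t - s) * k s)"
    unfolding set_lebesgue_integral_def
    by (intro Bochner_Integration.integral_cong) (auto simp: mult_ac)
  finally show ?thesis .
qed

lemma transport_0: "0 < x \<Longrightarrow> transport 0 x = f x"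
  using survival_pos[of x] f_ages[of x] by (cases "x \<in> ages G") (auto simp: transport_def)

text \<open>The right side of the equation is the integral of \<psi> against the transported
  density, and bounded continuous functions determine a measure. In particular the solution has a
  density.\<close>

lemma measure_eq_density_transport:
  assumes \<mu>: "age_measure G \<mu>" and t: "0 \<le> t"
    and eq: "\<And>\<psi>. bounded_continuous \<psi> \<Longrightarrow> (LINT x:{0..}|\<mu>. \<psi> x) =
      (LINT x:ages G|density_measure f. \<psi> (x + t) * (survival G (x + t) / survival G x)) +
      (LBINT s:{0..t}. \<psi> (t - s) * survival G (t - s) * k s)"
  shows "\<mu> = density_measure (transport t)"
proof -
  have "age_measure G (density_measure (transport t))"
    by (rule age_measure_density_measure[OF age_density_transport[OF t]])
  then show ?thesis
    using \<mu> eq t by (intro measure_eqI_bounded_continuous age_measure_neg)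
      (auto simp: age_measure_def transport_integral)
qed

end

section \<open>The correspondence between the models\<close>

locale fluid =
  fixes lam Gs gs Gr gr q0 b0 :: "real \<Rightarrow> real" and \<eta>0 \<nu>0 :: "real measure" and X0 :: real
  assumes lam_nonneg: "\<And>t. 0 \<le> t \<Longrightarrow> 0 \<le> lam t"
    and lam_integrable: "\<And>t. 0 \<le> t \<Longrightarrow> set_integrable lborel {0..t} lam"
    and service: "lifetime_distribution Gs gs"
    and patience: "lifetime_distribution Gr gr"
    and b0: "age_density Gs b0"
    and q0: "age_density Gr q0"
    and initial: "(\<eta>0, \<nu>0, X0) \<in> initial_states Gs Gr"
    and eta0: "\<eta>0 = density_measure q0"
    and nu0: "\<nu>0 = density_measure b0"
begin

sublocale service: lifetime Gs gs by unfold_locales (rule service)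

sublocale patience: lifetime Gr gr by unfold_locales (rule patience)

definition arrival :: "real \<Rightarrow> real" where "arrival t = indicator {0..} t * lam t"

definition q0_ext :: "real \<Rightarrow> real" where "q0_ext x = indicator {0..} x * q0 x"

definition b0_ext :: "real \<Rightarrow> real" where "b0_ext x = indicator {0..} x * b0 x"

lemma indicator_set_integrable:
  fixes h :: "real \<Rightarrow> real"
  shows "set_integrable lborel {0..t} (\<lambda>s. indicator {0..} s * h s) \<longleftrightarrow> set_integrable lborel {0..t} h"
  unfolding set_integrable_def by (intro Bochner_Integration.integrable_cong) (auto simp: indicator_def)

lemma indicator_set_integral:
  fixes h :: "real \<Rightarrow> real"
  shows "(LBINT s:{0..t}. indicator {0..} s * h s) = (LBINT s:{0..t}. h s)"
  unfolding set_lebesgue_integral_def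
  by (intro Bochner_Integration.integral_cong) (auto simp: indicator_def)

lemma agingI:
  assumes G: "lifetime_distribution G g" and h: "set_borel_measurable borel {0..} h" "\<And>s. 0 \<le> s \<Longrightarrow> 0 \<le> h s"
    "\<And>t. 0 \<le> t \<Longrightarrow> set_integrable lborel {0..t} h" and p: "age_density G p"
  shows "aging G g (\<lambda>s. indicator {0..} s * h s) (\<lambda>x. indicator {0..} x * p x)"
proof -
  interpret lifetime G g by unfold_locales (rule G)
  show ?thesis
  proof unfold_locales
    show "(\<lambda>s. indicator {0..} s * h s) \<in> borel_measurable borel"
      using h(1) by (simp add: set_borel_measurable_def)
    show "set_integrable lborel {0..t} (\<lambda>s. indicator {0..} s * h s)" if "0 \<le> t" for t
      unfolding indicator_set_integrable by (rule h(3)[OF that])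
    show "integrable lborel (\<lambda>x. indicator {0..} x * p x)"
      using p by (simp add: age_density_def set_integrable_def)
    show "0 \<le> indicator {0..} s * h s" for s using h(2)[of s] by (simp add: indicator_def)
    show "0 \<le> indicator {0..} x * p x" "x \<notin> ages G \<Longrightarrow> indicator {0..} x * p x = 0" for x
      using p by (auto simp: indicator_def age_density_def)
  qed simp
qed

lemma lam_measurable: "set_borel_measurable borel {0..} lam"
  by (rule set_borel_measurable_of_integrable[OF lam_integrable])

text \<open>Only data enter here: the potential queue does not depend on the service process, hence
  is common to all models.\<close>

sublocale queue: aging Gr gr arrival q0_ext
  unfolding arrival_def[abs_def] q0_ext_def[abs_def]
  by (rule agingI[OF patience lam_measurable lam_nonneg lam_integrable q0])

lemma LBINT_arrival: "(LBINT s:{0..t}. arrival s) = (LBINT s:{0..t}. lam s)"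
  unfolding arrival_def[abs_def] by (rule indicator_set_integral)

lemma density_measure_q0_ext: "density_measure q0_ext = \<eta>0"
  unfolding eta0 by (rule density_measure_cong) (simp add: q0_ext_def)

lemma density_measure_b0_ext: "density_measure b0_ext = \<nu>0"
  unfolding nu0 by (rule density_measure_cong) (simp add: b0_ext_def)

lemma cumulative_q0_ext: "cumulative q0_ext y = cumulative q0 y"
  unfolding cumulative_def set_lebesgue_integral_def
  by (intro Bochner_Integration.integral_cong) (auto simp: q0_ext_def indicator_def)

lemma cumulative_b0_ext: "cumulative b0_ext y = cumulative b0 y"
  unfolding cumulative_def set_lebesgue_integral_def
  by (intro Bochner_Integration.integral_cong) (auto simp: b0_ext_def indicator_def)

text \<open>The conditions on initial states are those of non-idling: a queue is present only when
  all servers are busy.\<close>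

lemma initial_masses:
  "0 \<le> X0" "cumulative b0 \<infinity> = min X0 1" "cumulative q0 \<infinity> = max (X0 - 1) 0"
proof -
  have "measure \<nu>0 (ages Gs) = cumulative b0 \<infinity>" "measure \<eta>0 (ages Gr) = cumulative q0 \<infinity>"
    using service.measure_ages[OF service.age_measure_density_measure[OF b0]]
      patience.measure_ages[OF patience.age_measure_density_measure[OF q0]]
      measure_age_density(3)[OF b0] measure_age_density(3)[OF q0]
    by (simp_all add: eta0 nu0)
  then show "0 \<le> X0" "cumulative b0 \<infinity> = min X0 1" "cumulative q0 \<infinity> = max (X0 - 1) 0"
    using initial by (auto simp: initial_states_def)
qed

text \<open>The second part expresses \<open>B\<close> and \<open>Q\<close> through the
  measure-valued model, so that uniqueness of the latter determines them. The state \<open>X\<close>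
  is taken to be the total mass in service and in queue.\<close>

lemma measure_valued_of_two_parameter:
  assumes "two_parameter_fluid_model Gs gs Gr gr lam q0 b0 B Q"
  shows "\<exists>\<eta> \<nu> X. measure_valued_fluid_model Gs gs Gr gr lam \<eta>0 \<nu>0 X0 \<eta> \<nu> X \<and>
    (\<forall>t\<ge>0. \<forall>y\<ge>0. B t y = measure (\<nu> t) {x. 0 \<le> x \<and> ereal x \<le> y} \<and>
      Q t y = min (measure (\<eta> t) {x. 0 \<le> x \<and> ereal x \<le> y}) (queue_length X t))"
proof -
  from assms obtain b q' q w where
    dens0: "\<forall>t\<ge>0. age_density Gs (b t) \<and> age_density Gr (q' t) \<and> age_density Gr (q t)"
    and BQ0: "\<forall>t\<ge>0. \<forall>y\<ge>0. B t y = cumulative (b t) y \<and> B t y \<le> 1 \<and> Q t y = cumulative (q t) y"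
    and init0: "\<forall>x>0. b 0 x = b0 x \<and> q' 0 x = q0 x \<and> q 0 x = q0 x"
    and along: "ages_along Gs b" "ages_along Gr q'"
    and trunc: "queue_truncation q' q w"
    and bdry: "boundary_conditions Gs gs lam b q' q"
    and flow: "flow_conservation Gr gr lam b q"
    unfolding two_parameter_fluid_model_def by blast
  have dens: "age_density Gs (b t)" "age_density Gr (q' t)" "age_density Gr (q t)" if "0 \<le> t" for t
    using dens0 that by auto
  have BQ: "B t y = cumulative (b t) y" "B t y \<le> 1" "Q t y = cumulative (q t) y" if "0 \<le> t" "0 \<le> y" for t y
    using BQ0 that by blast+
  have init: "b 0 x = b0 x" "q' 0 x = q0 x" "q 0 x = q0 x" if "0 < x" for x
    using init0 that by auto
  let ?Qtot = "\<lambda>t. cumulative (q t) \<infinity>" and ?Btot = "\<lambda>t. cumulative (b t) \<infinity>"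
  have Q_busy: "?Btot t < 1 \<Longrightarrow> ?Qtot t = 0" and q'_0: "q' t 0 = lam t" if "0 \<le> t" for t
    using bdry that by (auto simp: boundary_conditions_def Let_def)
  have entry: "locally_integrable (\<lambda>s. ennreal (b s 0))"
    and alpha: "locally_integrable (\<lambda>s. density_rate Gr gr (q s))"
    and balance: "\<And>t. 0 \<le> t \<Longrightarrow> (LBINT s:{0..t}. lam s) + ?Qtot 0 =
      ?Qtot t + time_integral (\<lambda>s. ennreal (b s 0)) t + time_integral (\<lambda>s. density_rate Gr gr (q s)) t"
    using flow by (auto simp: flow_conservation_def Let_def)
  have b_nonneg: "0 \<le> b s 0" if "0 \<le> s" for s using dens(1)[OF that] by (simp add: age_density_def)
  \<comment> \<open>Flow conservation treats the entry rate as extended-valued; as \<open>b\<close>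
    is nonnegative, the conversion to and fro is the identity. Measurability and integrability of
    the entry rate have their source here.\<close>
  have enn: "indicator A s * enn2real (ennreal (b s 0)) = indicator A s * b s 0" if "A \<subseteq> {0..}" for A s
    using b_nonneg[of s] that by (auto simp: indicator_def)
  have b_meas: "set_borel_measurable borel {0..} (\<lambda>s. b s 0)"
    using locally_integrable_enn2real(1)[OF entry] by (simp add: set_borel_measurable_def enn)
  have b_int: "set_integrable lborel {0..t} (\<lambda>s. b s 0)" if "0 \<le> t" for t
    using locally_integrable_enn2real(2)[OF entry that] by (simp add: set_integrable_def enn)
  have b_time: "time_integral (\<lambda>s. ennreal (b s 0)) t = (LBINT s:{0..t}. b s 0)" if "0 \<le> t" for t
    using locally_integrable_enn2real(4)[OF entry that] by (simp add: set_lebesgue_integral_def enn)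
  define k where "k s = indicator {0..} s * b s 0" for s
  interpret server: aging Gs gs k b0_ext
    unfolding k_def[abs_def] b0_ext_def[abs_def]
    by (rule agingI[OF service b_meas b_nonneg b_int b0])
  have b_eq: "b t x = server.transport t x" if "0 \<le> t" "0 \<le> x" for t x
    using along(1) _ _ _ that
  proof (rule server.ages_along_eq_transport)
    show "b t x = 0" if "0 \<le> t" "0 \<le> x" "x \<notin> ages Gs" for t x
      using dens(1)[OF that(1)] that by (simp add: age_density_def)
  qed (auto simp: k_def b0_ext_def init)
  have q'_eq: "q' t x = queue.transport t x" if "0 \<le> t" "0 \<le> x" for t x
    using along(2) _ _ _ that
  proof (rule queue.ages_along_eq_transport)
    show "q' t x = 0" if "0 \<le> t" "0 \<le> x" "x \<notin> ages Gr" for t x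
      using dens(2)[OF that(1)] that by (simp add: age_density_def)
  qed (auto simp: arrival_def q0_ext_def init q'_0)
  have dm_b: "density_measure (b t) = density_measure (server.transport t)" if "0 \<le> t" for t
    using b_eq[OF that] by (rule density_measure_cong)
  have dm_q': "density_measure (q' t) = density_measure (queue.transport t)" if "0 \<le> t" for t
    using q'_eq[OF that] by (rule density_measure_cong)
  have cum_b: "?Btot t = cumulative (server.transport t) \<infinity>" if "0 \<le> t" for t
    using b_eq[OF that] unfolding cumulative_top set_lebesgue_integral_def
    by (intro Bochner_Integration.integral_cong) (auto simp: indicator_def)
  have rate_b: "density_rate Gs gs (b t) = density_rate Gs gs (server.transport t)" if "0 \<le> t" for t
    using b_eq[OF that] service.ages_nonneg by (intro density_rate_cong_pos) auto
  have tr: "truncation Gr gr (q' t) (q t) (w t)" if "0 \<le> t" for t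
    using trunc that dens(2,3)[OF that] by unfold_locales (auto simp: queue_truncation_def age_density_def)
  define \<eta> where "\<eta> t = density_measure (q' t)" for t
  define \<nu> where "\<nu> t = density_measure (b t)" for t
  define X where "X t = ?Btot t + ?Qtot t" for t
  have B_le: "?Btot t \<le> 1" if "0 \<le> t" for t using BQ(1,2)[OF that, of \<infinity>] by simp
  have Q_nonneg: "0 \<le> ?Qtot t" if "0 \<le> t" for t
    by (rule cumulative_nonneg[OF dens(3)[OF that]])
  \<comment> \<open>Since a queue requires full servers, the total mass splits back uniquely: the
    busy mass is \<open>min (X t) 1\<close> and the queue is the positive part of
    \<open>X t - 1\<close>.\<close>
  have regime: "?Btot t < 1 \<and> ?Qtot t = 0 \<or> ?Btot t = 1" if "0 \<le> t" for t
    using B_le[OF that] Q_busy[OF that] by fastforce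
  have queue_X: "queue_length X t = ?Qtot t" if "0 \<le> t" for t
    using regime[OF that] Q_nonneg[OF that] by (auto simp: queue_length_def X_def)
  have age: "age_measure Gr (\<eta> t)" "age_measure Gs (\<nu> t)" if "0 \<le> t" for t
    using dens that by (auto simp: \<eta>_def \<nu>_def intro: patience.age_measure_density_measure service.age_measure_density_measure)
  have \<nu>_mass: "measure (\<nu> t) {0..} = ?Btot t" if "0 \<le> t" for t
    unfolding \<nu>_def by (rule measure_age_density(3)[OF dens(1)[OF that]])
  have departure: "departure_rate Gs gs \<nu> t = density_rate Gs gs (server.transport t)" if "0 \<le> t" for t
    using service.nn_integral_hazard[OF dens(1)[OF that] service.ages_measurable subset_refl]
    unfolding rate_b[OF that, symmetric] by (simp add: departure_rate_def density_rate_def \<nu>_def)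
  have K: "service_entry Gs gs \<nu> t = (LBINT s:{0..t}. k s)" if t: "0 \<le> t" for t
  proof -
    have "time_integral (departure_rate Gs gs \<nu>) t = time_integral (\<lambda>s. density_rate Gs gs (server.transport s)) t"
      by (rule time_integral_cong[OF departure])
    moreover have "cumulative (b 0) \<infinity> = cumulative b0_ext \<infinity>"
      using age_density_measurable[OF dens(1)[of 0]] age_density_measurable[OF b0] init
      unfolding cumulative_b0_ext by (intro cumulative_cong_pos) auto
    ultimately show ?thesis
      unfolding service_entry_def
      using server.mass_balance[OF t] service.measure_ages[OF age(2)[OF t]] service.measure_ages[OF age(2)[of 0]]
      by (simp add: \<nu>_mass t server.LBINT_transport server.LBINT_f cum_b)
  qed
  have K_time: "service_entry Gs gs \<nu> t = time_integral (\<lambda>s. ennreal (b s 0)) t" if "0 \<le> t" for t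
    unfolding K[OF that] b_time[OF that] k_def[abs_def] by (rule indicator_set_integral)
  \<comment> \<open>The given boundary \<open>w t\<close> need not be the queue front, but both cut
    the queue length off the potential queue.\<close>
  have reneging: "reneging_rate Gr gr \<eta> X t = density_rate Gr gr (q t)" if t: "0 \<le> t" for t
  proof -
    interpret truncation Gr gr "q' t" "q t" "w t" by (rule tr[OF t])
    have "?Qtot t \<le> cumulative (q' t) \<infinity>"
      unfolding cumulative_q_top by (rule cumulative_mono[OF p]) simp
    then have "cumulative (q' t) (queue_front Gr \<eta> X t) = ?Qtot t"
      unfolding queue_front_def queue_X[OF t] \<eta>_def
      using Q_nonneg[OF t] by (intro patience.cumulative_front(2)[OF p])
    then show ?thesis
      unfolding reneging_rate_def \<eta>_def[of t] by (rule density_rate_q[symmetric])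
  qed
  have R: "time_integral (reneging_rate Gr gr \<eta> X) t = time_integral (\<lambda>s. density_rate Gr gr (q s)) t" for t
    by (rule time_integral_cong[OF reneging])
  have K_mono: "mono_on {0..} (service_entry Gs gs \<nu>)"
  proof (rule mono_onI)
    fix r t :: real assume "r \<in> {0..}" "t \<in> {0..}" "r \<le> t"
    then show "service_entry Gs gs \<nu> r \<le> service_entry Gs gs \<nu> t"
      using set_lborel_integral_Ioc[OF server.k_integrable, of t r]
      by (simp add: K set_lebesgue_integral_def server.k_nonneg)
  qed
  have K_cont: "continuous (at_right t) (service_entry Gs gs \<nu>)" if "0 \<le> t" for t
  proof -
    have "continuous_on {0..} (service_entry Gs gs \<nu>)"
      using continuous_on_LBINT[OF server.k_integrable] by (rule continuous_on_eq) (auto intro!: K[symmetric])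
    then have "continuous (at t within {0..}) (service_entry Gs gs \<nu>)"
      using that by (simp add: continuous_on_eq_continuous_within)
    then show ?thesis by (rule continuous_within_subset) (use that in auto)
  qed
  have \<eta>_0: "\<eta> 0 = \<eta>0"
    unfolding \<eta>_def eta0 using age_density_measurable[OF dens(2)[of 0]] age_density_measurable[OF q0] init
    by (intro density_measure_cong_pos) auto
  have \<nu>_0: "\<nu> 0 = \<nu>0"
    unfolding \<nu>_def nu0 using age_density_measurable[OF dens(1)[of 0]] age_density_measurable[OF b0] init
    by (intro density_measure_cong_pos) auto
  have X_0: "X 0 = X0"
  proof -
    have "?Btot 0 = cumulative b0 \<infinity>"
      using age_density_measurable[OF dens(1)[of 0]] age_density_measurable[OF b0] init
      by (intro cumulative_cong_pos) auto
    moreover have "?Qtot 0 = cumulative q0 \<infinity>"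
      using age_density_measurable[OF dens(3)[of 0]] age_density_measurable[OF q0] init
      by (intro cumulative_cong_pos) auto
    ultimately show ?thesis using initial_masses by (simp add: X_def)
  qed
  have "measure_valued_fluid_model Gs gs Gr gr lam \<eta>0 \<nu>0 X0 \<eta> \<nu> X"
    unfolding measure_valued_fluid_model_def Let_def
  proof (intro conjI allI impI)
    show "locally_integrable (departure_rate Gs gs \<nu>)"
      by (rule locally_integrable_cong[OF server.rate_locally_integrable departure])
    show "locally_integrable (reneging_rate Gr gr \<eta> X)"
      by (rule locally_integrable_cong[OF alpha reneging])
    fix \<psi> t assume \<psi>: "bounded_continuous \<psi>" and t: "(0::real) \<le> t"
    have "(LBINT s:{0..t}. \<psi> (t - s) * survival Gr (t - s) * arrival s) =
        (LBINT s:{0..t}. \<psi> (t - s) * survival Gr (t - s) * lam s)"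
      unfolding set_lebesgue_integral_def arrival_def
      by (intro Bochner_Integration.integral_cong) (auto simp: indicator_def)
    then show "(LINT x:{0..}|\<eta> t. \<psi> x) =
        (LINT x:ages Gr|\<eta>0. \<psi> (x + t) * (survival Gr (x + t) / survival Gr x)) +
        (LBINT s:{0..t}. \<psi> (t - s) * survival Gr (t - s) * lam s)"
      using queue.transport_integral[OF \<psi> t]
      by (simp add: \<eta>_def dm_q'[OF t] density_measure_q0_ext)
    show "(LINT x:{0..}|\<nu> t. \<psi> x) =
        (LINT x:ages Gs|\<nu>0. \<psi> (x + t) * (survival Gs (x + t) / survival Gs x)) +
        (LINT s:{0..t}|stieltjes_measure (service_entry Gs gs \<nu>). \<psi> (t - s) * survival Gs (t - s))"
      using server.transport_integral[OF \<psi> t] server.stieltjes_integral[OF K \<psi>, of t]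
      by (simp add: \<nu>_def[of t] dm_b[OF t] density_measure_b0_ext)
  next
    fix t :: real assume t: "0 \<le> t"
    show "(LBINT s:{0..t}. lam s) + queue_length X 0 =
        queue_length X t + service_entry Gs gs \<nu> t + time_integral (reneging_rate Gr gr \<eta> X) t"
      using balance[OF t] t by (simp add: queue_X K_time R)
    show "measure (\<nu> t) {0..} = min (X t) 1" "measure (\<nu> t) {0..} = 1 - max (1 - X t) 0"
      "queue_length X t * (1 - measure (\<nu> t) {0..}) = 0"
      using regime[OF t] Q_nonneg[OF t] by (auto simp: \<nu>_mass[OF t] queue_X[OF t] X_def)
  qed (use initial \<eta>_0 \<nu>_0 X_0 age K_mono K_cont in auto)
  moreover have "B t y = measure (\<nu> t) {x. 0 \<le> x \<and> ereal x \<le> y}" if "0 \<le> t" "0 \<le> y" for t y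
    using BQ[OF that] measure_age_density(2)[OF dens(1)[OF that(1)]] by (simp add: \<nu>_def)
  moreover have "Q t y = min (measure (\<eta> t) {x. 0 \<le> x \<and> ereal x \<le> y}) (queue_length X t)" if "0 \<le> t" "0 \<le> y" for t y
  proof -
    interpret truncation Gr gr "q' t" "q t" "w t" by (rule tr[OF that(1)])
    show ?thesis
      using BQ[OF that] measure_age_density(2)[OF dens(2)[OF that(1)], of y] cumulative_q_min[of y]
      by (simp add: \<eta>_def queue_X[OF that(1)])
  qed
  ultimately show ?thesis by blast
qed

end

section \<open>From measures back to densities\<close>

context fluid
begin

text \<open>\<open>Q\<close> shows only the truncated part of \<eta>, so \<eta> cannot be read off
  from \<open>(B, Q)\<close>; instead it is identified outright from the data. The remaining
  conclusions recover \<nu> from \<open>B\<close> and \<open>X\<close> from the total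
  masses.\<close>

lemma two_parameter_of_measure_valued:
  assumes "measure_valued_fluid_model Gs gs Gr gr lam \<eta>0 \<nu>0 X0 \<eta> \<nu> X"
  shows "\<exists>B Q. two_parameter_fluid_model Gs gs Gr gr lam q0 b0 B Q \<and>
    (\<forall>t\<ge>0. \<eta> t = density_measure (queue.transport t) \<and> age_measure Gs (\<nu> t) \<and>
      (\<forall>y\<ge>0. B t y = measure (\<nu> t) {x. 0 \<le> x \<and> ereal x \<le> y}) \<and> X t = B t \<infinity> + Q t \<infinity>)"
proof -
  define K where "K = service_entry Gs gs \<nu>"
  define \<sigma> where "\<sigma> = departure_rate Gs gs \<nu>"
  define \<rho> where "\<rho> = reneging_rate Gr gr \<eta> X"
  define Qt where "Qt = queue_length X"
  have mv: "\<eta> 0 = \<eta>0 \<and> \<nu> 0 = \<nu>0 \<and> X 0 = X0"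
    "\<forall>t\<ge>0. age_measure Gr (\<eta> t) \<and> age_measure Gs (\<nu> t)"
    "locally_integrable \<sigma>" "locally_integrable \<rho>" "mono_on {0..} K"
    "\<forall>\<psi>. bounded_continuous \<psi> \<longrightarrow> (\<forall>t\<ge>0.
            (LINT x:{0..}|\<eta> t. \<psi> x) =
              (LINT x:ages Gr|\<eta>0. \<psi> (x + t) * (survival Gr (x + t) / survival Gr x)) +
              (LBINT s:{0..t}. \<psi> (t - s) * survival Gr (t - s) * lam s) \<and>
            (LINT x:{0..}|\<nu> t. \<psi> x) =
              (LINT x:ages Gs|\<nu>0. \<psi> (x + t) * (survival Gs (x + t) / survival Gs x)) +
              (LINT s:{0..t}|stieltjes_measure K. \<psi> (t - s) * survival Gs (t - s)))"
    "\<forall>t\<ge>0. (LBINT s:{0..t}. lam s) + Qt 0 = Qt t + K t + time_integral \<rho> t \<and>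
          measure (\<nu> t) {0..} = min (X t) 1 \<and> measure (\<nu> t) {0..} = 1 - max (1 - X t) 0 \<and>
          Qt t * (1 - measure (\<nu> t) {0..}) = 0"
    using assms unfolding measure_valued_fluid_model_def Let_def K_def \<sigma>_def \<rho>_def Qt_def by blast+
  have X_0: "X 0 = X0" using mv(1) by simp
  have age: "age_measure Gr (\<eta> t)" "age_measure Gs (\<nu> t)" if "0 \<le> t" for t
    using mv(2) that by auto
  have balance: "(LBINT s:{0..t}. lam s) + Qt 0 = Qt t + K t + time_integral \<rho> t"
    and \<nu>_mass: "measure (\<nu> t) {0..} = min (X t) 1" if "0 \<le> t" for t
    using mv(7) that by blast+
  have Qt: "Qt t = max (X t - 1) 0" for t by (simp add: Qt_def queue_length_def)
  have Qt_nonneg: "0 \<le> Qt t" for t by (simp add: Qt)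
  have Qt_0: "Qt 0 = cumulative q0 \<infinity>"
    using initial_masses by (simp add: Qt X_0)

  define \<sigma>r where "\<sigma>r s = enn2real (\<sigma> s)" for s
  define \<rho>r where "\<rho>r s = enn2real (\<rho> s)" for s
  note \<sigma> = locally_integrable_enn2real[OF mv(3), folded \<sigma>r_def]
  note \<rho> = locally_integrable_enn2real[OF mv(4), folded \<rho>r_def]
  \<comment> \<open>Entries into service equal departures plus the growth of the busy mass.
    Regularity of \<open>K\<close> is thereby reduced to that of \<open>min (X t) 1\<close>.\<close>
  have K: "K t = min (X t) 1 - min (X 0) 1 + (LBINT s:{0..t}. \<sigma>r s)" if "0 \<le> t" for t
    using service.measure_ages[OF age(2)[OF that]] service.measure_ages[OF age(2)[of 0]]
      \<nu>_mass[OF that] \<nu>_mass[of 0] \<sigma>(4)[OF that]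
    by (simp add: K_def service_entry_def \<sigma>_def)
  have R: "time_integral \<rho> t = (LBINT s:{0..t}. \<rho>r s)" if "0 \<le> t" for t
    by (rule \<rho>(4)[OF that])

  have \<eta>: "\<eta> t = density_measure (queue.transport t)" if t: "0 \<le> t" for t
  proof (rule queue.measure_eq_density_transport[OF age(1)[OF t] t])
    fix \<psi> assume \<psi>: "bounded_continuous \<psi>"
    have "(LBINT s:{0..t}. \<psi> (t - s) * survival Gr (t - s) * arrival s) =
        (LBINT s:{0..t}. \<psi> (t - s) * survival Gr (t - s) * lam s)"
      unfolding set_lebesgue_integral_def arrival_def
      by (intro Bochner_Integration.integral_cong) (auto simp: indicator_def)
    then show "(LINT x:{0..}|\<eta> t. \<psi> x) =
      (LINT x:ages Gr|density_measure q0_ext. \<psi> (x + t) * (survival Gr (x + t) / survival Gr x)) +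
      (LBINT s:{0..t}. \<psi> (t - s) * survival Gr (t - s) * arrival s)"
      using mv(6) \<psi> t by (simp add: density_measure_q0_ext)
  qed
  have dens_q': "age_density Gr (queue.transport t)" if "0 \<le> t" for t
    by (rule queue.age_density_transport[OF that])

  \<comment> \<open>Adding the queue balance to the service balance cancels \<open>K\<close>, about
    whose regularity nothing is known yet; what is left exhibits \<open>X\<close> as an indefinite
    integral.\<close>
  define f where "f s = lam s - \<sigma>r s - \<rho>r s" for s
  have f_int: "set_integrable lborel {0..t} f" if "0 \<le> t" for t
    unfolding f_def using lam_integrable[OF that] \<sigma>(2)[OF that] \<rho>(2)[OF that]
    by (intro set_integral_diff) auto
  have X: "X t = X 0 + (LBINT s:{0..t}. f s)" if "0 \<le> t" for t
  proof -
    have "(LBINT s:{0..t}. f s) = (LBINT s:{0..t}. lam s) - (LBINT s:{0..t}. \<sigma>r s) - (LBINT s:{0..t}. \<rho>r s)"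
      unfolding f_def using lam_integrable[OF that] \<sigma>(2)[OF that] \<rho>(2)[OF that]
      by (simp add: set_integral_diff)
    moreover have "X t = min (X t) 1 + Qt t" "X 0 = min (X 0) 1 + Qt 0" by (auto simp: Qt)
    ultimately show ?thesis
      using balance[OF that] K[OF that] R[OF that] by linarith
  qed
  have contX: "continuous_on {0..} X"
    by (rule continuous_on_eq[OF continuous_on_add[OF continuous_on_const continuous_on_LBINT[OF f_int]]])
       (auto intro!: X[symmetric])
  have contX_t: "continuous_on {0..t} X" for t
    by (rule continuous_on_subset[OF contX]) auto

  \<comment> \<open>With an empty queue the front is at most 0, so at most age 0 could renege, and
    \<eta> has a density.\<close>
  have \<rho>_empty: "\<rho> s = 0" if "0 \<le> s" "X s \<le> 1" for s
  proof -
    let ?A = "{x \<in> ages Gr. ereal x \<le> queue_front Gr \<eta> X s}"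
    have "queue_front Gr \<eta> X s \<le> ereal 0"
      unfolding queue_front_def using patience.zero_in_ages that
      by (intro Inf_lower) (auto simp: queue_length_def)
    then have "x = 0" if "x \<in> ?A" for x
      using that patience.ages_nonneg[of x] order_trans[of "ereal x" _ "ereal 0"] by auto
    then have A: "?A \<subseteq> {0}" by blast
    have "\<rho> s = (\<integral>\<^sup>+x\<in>?A. ennreal (queue.transport s x * hazard Gr gr x) \<partial>lborel)"
      unfolding \<rho>_def reneging_rate_def \<eta>[OF \<open>0 \<le> s\<close>]
      by (rule patience.nn_integral_hazard[OF dens_q'[OF \<open>0 \<le> s\<close>]]) auto
    also have "\<dots> = (\<integral>\<^sup>+(x::real). 0 \<partial>lborel)"
    proof (rule nn_integral_cong_AE)
      show "AE x in lborel. ennreal (queue.transport s x * hazard Gr gr x) * indicator ?A x = 0"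
        using AE_lborel_singleton[of "0::real"]
      proof eventually_elim
        case (elim x)
        then have "x \<notin> ?A" using A by blast
        then show ?case by simp
      qed
    qed
    finally show ?thesis by simp
  qed

  \<comment> \<open>the derivative of \<open>K\<close>; in the last case \<open>\<sigma>r\<close> is \<open>0\<close> where \<open>\<sigma>\<close> is infinite\<close>
  define \<kappa> where "\<kappa> s = (if X s < 1 then lam s else if X s = 1 then enn2real (min (\<sigma> s) (ennreal (lam s))) else \<sigma>r s)" for s
  have \<kappa>_nonneg: "0 \<le> \<kappa> s" if "0 \<le> s" for s
    using lam_nonneg[OF that] by (simp add: \<kappa>_def \<sigma>r_def)
  have X_meas: "(\<lambda>s. indicator {0..} s *\<^sub>R X s) \<in> borel_measurable borel"
    by (rule borel_measurable_continuous_on_indicator[OF _ contX]) simp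
  have \<sigma>_meas: "(\<lambda>s. \<sigma> s * indicator {0..} s) \<in> borel_measurable borel"
    using mv(3) by (simp add: locally_integrable_def)
  \<comment> \<open>On this level set reneging vanishes, so the integrand \<open>f\<close> reduces
    to \<open>lam s - \<sigma>r s\<close>. Its integral over the level set is 0 up to every time,
    and equal primitives force equal integrands almost everywhere.\<close>
  have level: "AE s in lborel. 0 \<le> s \<longrightarrow> of_bool (X s = 1) * lam s = of_bool (X s = 1) * \<sigma>r s"
  proof (rule AE_eq_of_LBINT_eq)
    have m: "set_borel_measurable borel {0..} (\<lambda>s. of_bool (X s = 1) * h s)"
      if h: "set_borel_measurable borel {0..} h" for h :: "real \<Rightarrow> real"
    proof -
      have "(\<lambda>s. of_bool (indicator {0..} s *\<^sub>R X s = 1) * (indicator {0..} s *\<^sub>R h s)) \<in> borel_measurable borel"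
        using h X_meas unfolding set_borel_measurable_def of_bool_def by measurable
      also have "(\<lambda>s. of_bool (indicator {0..} s *\<^sub>R X s = 1) * (indicator {0..} s *\<^sub>R h s)) =
          (\<lambda>s. indicator {0..} s *\<^sub>R (of_bool (X s = 1) * h s))"
        by (auto simp: fun_eq_iff indicator_def)
      finally show ?thesis by (simp add: set_borel_measurable_def)
    qed
    show m1: "set_borel_measurable borel {0..} (\<lambda>s. of_bool (X s = 1) * lam s)"
      "set_borel_measurable borel {0..} (\<lambda>s. of_bool (X s = 1) * \<sigma>r s)"
      using m lam_measurable \<sigma>(1) by auto
    have int: "set_integrable lborel {0..t} (\<lambda>s. of_bool (X s = 1) * h s)"
      if h: "set_borel_measurable borel {0..} h" "set_integrable lborel {0..t} h" for h :: "real \<Rightarrow> real" and t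
    proof (rule set_integrable_bound[OF h(2)])
      have "(\<lambda>s. indicator {0..t} s *\<^sub>R (indicator {0..} s *\<^sub>R (of_bool (X s = 1) * h s))) \<in> borel_measurable borel"
        using m[OF h(1)] unfolding set_borel_measurable_def by measurable
      also have "(\<lambda>s. indicator {0..t} s *\<^sub>R (indicator {0..} s *\<^sub>R (of_bool (X s = 1) * h s))) =
          (\<lambda>s. indicator {0..t} s *\<^sub>R (of_bool (X s = 1) * h s))"
        by (auto simp: fun_eq_iff indicator_def)
      finally show "set_borel_measurable lborel {0..t} (\<lambda>s. of_bool (X s = 1) * h s)"
        by (simp add: set_borel_measurable_def)
    qed (auto simp: of_bool_def)
    show int1: "set_integrable lborel {0..t} (\<lambda>s. of_bool (X s = 1) * lam s)"
      "set_integrable lborel {0..t} (\<lambda>s. of_bool (X s = 1) * \<sigma>r s)" if "0 \<le> t" for t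
      using int lam_measurable \<sigma>(1) lam_integrable[OF that] \<sigma>(2)[OF that] by auto
    show "(LBINT s:{0..t}. of_bool (X s = 1) * lam s) = (LBINT s:{0..t}. of_bool (X s = 1) * \<sigma>r s)"
      if t: "0 \<le> t" for t
    proof -
      have "0 = (LBINT s:{0..t}. of_bool (X s = 1) * f s)"
        by (rule LBINT_level_set_eq_0(2)[symmetric, OF t f_int[OF t] _ contX_t]) (rule X)
      also have "\<dots> = (LBINT s:{0..t}. of_bool (X s = 1) * lam s - of_bool (X s = 1) * \<sigma>r s)"
        unfolding set_lebesgue_integral_def
        by (intro Bochner_Integration.integral_cong)
           (auto simp: indicator_def f_def \<rho>r_def \<rho>_empty algebra_simps)
      also have "\<dots> = (LBINT s:{0..t}. of_bool (X s = 1) * lam s) - (LBINT s:{0..t}. of_bool (X s = 1) * \<sigma>r s)"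
        using int1[OF t] by (simp add: set_integral_diff)
      finally show ?thesis by simp
    qed
  qed (auto simp: lam_nonneg \<sigma>r_def)
  \<comment> \<open>The left side is the derivative of \<open>min (X s) 1\<close> plus the service
    rate, that is, of \<open>K\<close>. In the critical regime the prescribed minimum agrees with it
    because its two arguments coincide almost everywhere.\<close>
  have \<kappa>_AE: "AE s in lborel. 0 \<le> s \<longrightarrow> of_bool (X s < 1) * f s + \<sigma>r s = \<kappa> s"
    using level \<sigma>(3)
  proof eventually_elim
    case (elim s)
    show ?case
    proof
      assume s: "0 \<le> s"
      consider "X s < 1" | "X s = 1" | "1 < X s" by linarith
      then show "of_bool (X s < 1) * f s + \<sigma>r s = \<kappa> s"
      proof cases
        case 1
        then show ?thesis using \<rho>_empty[OF s] by (simp add: \<kappa>_def f_def \<rho>r_def)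
      next
        case 2
        then have "\<sigma> s = ennreal (lam s)" "\<sigma>r s = lam s" using elim s by auto
        then show ?thesis using 2 lam_nonneg[OF s] by (simp add: \<kappa>_def)
      next
        case 3
        then show ?thesis by (simp add: \<kappa>_def)
      qed
    qed
  qed
  have \<kappa>_meas: "set_borel_measurable borel {0..} \<kappa>"
  proof -
    let ?X = "\<lambda>s. indicator {0..} s *\<^sub>R X s" and ?\<sigma> = "\<lambda>s. \<sigma> s * indicator {0..} s"
      and ?l = "\<lambda>s. indicator {0..} s *\<^sub>R lam s"
    have "(\<lambda>s. if s < 0 then 0 else if ?X s < 1 then ?l s
        else if ?X s = 1 then enn2real (min (?\<sigma> s) (ennreal (?l s))) else enn2real (?\<sigma> s)) \<in> borel_measurable borel"
      using X_meas \<sigma>_meas lam_measurable unfolding set_borel_measurable_def by measurable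
    also have "(\<lambda>s. if s < 0 then 0 else if ?X s < 1 then ?l s
        else if ?X s = 1 then enn2real (min (?\<sigma> s) (ennreal (?l s))) else enn2real (?\<sigma> s)) =
        (\<lambda>s. indicator {0..} s *\<^sub>R \<kappa> s)"
      by (auto simp: fun_eq_iff indicator_def \<kappa>_def \<sigma>r_def)
    finally show ?thesis by (simp add: set_borel_measurable_def)
  qed
  have \<kappa>_LBINT: "set_integrable lborel {0..t} \<kappa>" "(LBINT s:{0..t}. \<kappa> s) = K t" if t: "0 \<le> t" for t
  proof -
    note min = min_eq_LBINT[OF t f_int[OF t] _ contX_t, of 1, OF X]
    have int: "set_integrable lborel {0..t} (\<lambda>s. of_bool (X s < 1) * f s + \<sigma>r s)"
      using min(1) \<sigma>(2)[OF t] by (intro set_integral_add(1)) auto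
    have meas: "(\<lambda>s. indicator {0..t} s *\<^sub>R \<kappa> s) \<in> borel_measurable lborel"
    proof -
      have "(\<lambda>s. indicator {0..t} s *\<^sub>R (indicator {0..} s *\<^sub>R \<kappa> s)) \<in> borel_measurable borel"
        using \<kappa>_meas unfolding set_borel_measurable_def by measurable
      also have "(\<lambda>s. indicator {0..t} s *\<^sub>R (indicator {0..} s *\<^sub>R \<kappa> s)) = (\<lambda>s. indicator {0..t} s *\<^sub>R \<kappa> s)"
        by (auto simp: fun_eq_iff indicator_def)
      finally show ?thesis by simp
    qed
    have AE: "AE s in lborel. indicator {0..t} s *\<^sub>R (of_bool (X s < 1) * f s + \<sigma>r s) = indicator {0..t} s *\<^sub>R \<kappa> s"
      using \<kappa>_AE by eventually_elim (auto simp: indicator_def)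
    show "set_integrable lborel {0..t} \<kappa>"
      using int integrable_cong_AE[OF _ meas AE] unfolding set_integrable_def
      by (simp add: borel_measurable_integrable)
    have "(LBINT s:{0..t}. \<kappa> s) = (LBINT s:{0..t}. of_bool (X s < 1) * f s + \<sigma>r s)"
      unfolding set_lebesgue_integral_def
      using integral_cong_AE[OF _ meas AE] int by (simp add: set_integrable_def borel_measurable_integrable)
    also have "\<dots> = K t"
      using min \<sigma>(2)[OF t] t by (simp add: set_integral_add K)
    finally show "(LBINT s:{0..t}. \<kappa> s) = K t" .
  qed

  define k where "k s = indicator {0..} s * \<kappa> s" for s
  interpret server: aging Gs gs k b0_ext
    unfolding k_def[abs_def] b0_ext_def[abs_def]
    by (rule agingI[OF service \<kappa>_meas \<kappa>_nonneg \<kappa>_LBINT(1) b0])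
  have K_k: "K t = (LBINT s:{0..t}. k s)" if "0 \<le> t" for t
    unfolding k_def[abs_def] indicator_set_integral by (rule \<kappa>_LBINT(2)[OF that, symmetric])
  have \<nu>: "\<nu> t = density_measure (server.transport t)" if t: "0 \<le> t" for t
  proof (rule server.measure_eq_density_transport[OF age(2)[OF t] t])
    fix \<psi> assume \<psi>: "bounded_continuous \<psi>"
    show "(LINT x:{0..}|\<nu> t. \<psi> x) =
      (LINT x:ages Gs|density_measure b0_ext. \<psi> (x + t) * (survival Gs (x + t) / survival Gs x)) +
      (LBINT s:{0..t}. \<psi> (t - s) * survival Gs (t - s) * k s)"
      using mv(6) \<psi> t server.stieltjes_integral[OF K_k \<psi>, of t]
      by (simp add: density_measure_b0_ext)
  qed
  have dens_b: "age_density Gs (server.transport t)" if "0 \<le> t" for t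
    by (rule server.age_density_transport[OF that])
  have B_cum: "cumulative (server.transport t) \<infinity> = min (X t) 1" if "0 \<le> t" for t
    using measure_age_density(3)[OF dens_b[OF that]] \<nu>[OF that] \<nu>_mass[OF that] by simp

  have cum_0: "cumulative (queue.transport 0) \<infinity> = Qt 0"
    unfolding Qt_0 cumulative_q0_ext[symmetric]
    using queue.transport_0 age_density_measurable[OF dens_q'[of 0]] age_density_measurable[OF queue.age_density_f]
    by (intro cumulative_cong_pos) auto
  \<comment> \<open>If the queue exceeded the potential queue, the front would be infinite since the last time at
    which it did not, and the excess could not have grown: both would have lost mass at the same
    rate, and the queue, in addition, by entry into service.\<close>
  have Qt_le: "Qt t \<le> cumulative (queue.transport t) \<infinity>" if t: "0 \<le> t" for t
  proof (rule ccontr)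
    define S where "S s = cumulative (queue.transport s) \<infinity>" for s
    define \<tau> where "\<tau> s = enn2real (density_rate Gr gr (queue.transport s))" for s
    note \<tau> = locally_integrable_enn2real[OF queue.rate_locally_integrable, folded \<tau>_def]
    define D where "D s = Qt s - S s" for s
    \<comment> \<open>Subtracting the mass balance of the potential queue from flow conservation
      cancels the arrivals and the initial mass.\<close>
    have D: "D s = (LBINT u:{0..s}. \<tau> u) - K s - (LBINT u:{0..s}. \<rho>r u)" if "0 \<le> s" for s
      using queue.mass_balance[OF that] balance[OF that] R[OF that] \<tau>(4)[OF that] Qt_0
      by (simp add: D_def S_def queue.LBINT_transport queue.LBINT_f cumulative_q0_ext LBINT_arrival)
    have "continuous_on {0..} (\<lambda>s. (LBINT u:{0..s}. \<tau> u) - (LBINT u:{0..s}. \<kappa> u) - (LBINT u:{0..s}. \<rho>r u))"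
      by (intro continuous_intros continuous_on_LBINT \<tau>(2) \<kappa>_LBINT(1) \<rho>(2))
    then have contD: "continuous_on {0..} D"
      by (rule continuous_on_eq) (simp add: D \<kappa>_LBINT(2))
    assume "\<not> Qt t \<le> cumulative (queue.transport t) \<infinity>"
    then have Dt: "0 < D t" by (simp add: D_def S_def)
    define Z where "Z = {s \<in> {0..t}. D s \<le> 0}"
    have "0 \<in> Z" using t cum_0 by (simp add: Z_def D_def S_def)
    moreover have bdd: "bdd_above Z" by (auto simp: Z_def intro: bdd_aboveI[of _ t])
    moreover have "closed Z"
      unfolding Z_def
      by (intro continuous_on_closed_Collect_le continuous_on_subset[OF contD]) auto
    \<comment> \<open>The supremum of the times without excess belongs to them by continuity; it
      serves as the starting point of the comparison.\<close>
    ultimately have a: "Sup Z \<in> Z" by (intro closed_contains_Sup) auto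
    define a where "a = Sup Z"
    have a: "0 \<le> a" "a \<le> t" "D a \<le> 0" using a by (auto simp: Z_def a_def)
    have after: "0 < D s" if "a < s" "s \<le> t" for s
    proof (rule ccontr)
      assume "\<not> 0 < D s"
      then have "s \<in> Z" using that a by (simp add: Z_def)
      then have "s \<le> a" unfolding a_def using bdd by (rule cSup_upper)
      then show False using that by simp
    qed
    have full: "\<rho> s = density_rate Gr gr (queue.transport s)" if s: "a < s" "s \<le> t" for s
    proof -
      have s0: "0 \<le> s" using s a by simp
      have "measure (\<eta> s) {0..x} < Qt s" for x
      proof -
        have "measure (\<eta> s) {0..x} = cumulative (queue.transport s) (ereal x)"
          unfolding \<eta>[OF s0] cumulative_ereal
          by (rule measure_age_density(1)[OF dens_q'[OF s0]]) auto
        also have "\<dots> \<le> S s" unfolding S_def by (rule cumulative_mono[OF dens_q'[OF s0]]) simp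
        also have "\<dots> < Qt s" using after[OF s] by (simp add: D_def)
        finally show ?thesis .
      qed
      then have "{ereal x | x. x \<in> ages Gr \<and> queue_length X s \<le> measure (\<eta> s) {0..x}} = {}"
        by (auto simp: Qt_def dest: leD)
      then have "queue_front Gr \<eta> X s = \<infinity>"
        by (simp only: queue_front_def Inf_empty top_ereal_def)
      then have "\<rho> s = (\<integral>\<^sup>+x\<in>ages Gr. ennreal (hazard Gr gr x) \<partial>\<eta> s)"
        by (simp add: \<rho>_def reneging_rate_def)
      then show ?thesis
        using patience.nn_integral_hazard[OF dens_q'[OF s0] patience.ages_measurable subset_refl]
        by (simp add: \<eta>[OF s0] density_rate_def)
    qed
    have "(LBINT u:{a<..t}. \<rho>r u) = (LBINT u:{a<..t}. \<tau> u)"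
      unfolding set_lebesgue_integral_def
      by (intro Bochner_Integration.integral_cong) (auto simp: indicator_def \<rho>r_def \<tau>_def full)
    moreover have "K a \<le> K t" using mv(5) a by (intro mono_onD[OF mv(5)]) auto
    ultimately have "D t \<le> D a"
      using set_lborel_integral_Ioc[OF \<rho>(2)[OF t] a(1,2)] set_lborel_integral_Ioc[OF \<tau>(2)[OF t] a(1,2)]
      by (simp add: D t a(1))
    then show False using a Dt by simp
  qed

  \<comment> \<open>At time \<open>0\<close> the initial density is to be attained at all positive ages, also beyond the front.\<close>
  define w where "w t = (if t = 0 then \<infinity> else queue_front Gr \<eta> X t)" for t
  \<comment> \<open>Comparing \<open>X t\<close> with 1 distinguishes the three regimes that
    prescribe the value at age 0. In the critical one the minimum keeps the value nonnegative, as
    required of an age density.\<close>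
  define q where "q t x = (if 0 < x then if ereal x \<le> w t then queue.transport t x else 0
      else if 1 < X t then lam t else if X t = 1 then lam t - enn2real (min (\<sigma> t) (ennreal (lam t))) else 0)" for t x
  have front: "cumulative (queue.transport t) (queue_front Gr \<eta> X t) = Qt t" "0 \<le> queue_front Gr \<eta> X t"
    if t: "0 \<le> t" for t
    unfolding queue_front_def Qt_def[symmetric] \<eta>[OF t]
    using patience.cumulative_front[OF dens_q'[OF t] Qt_nonneg Qt_le[OF t]] by auto
  have min_le: "enn2real (min (\<sigma> t) (ennreal (lam t))) \<le> lam t" if "0 \<le> t" for t
    using lam_nonneg[OF that] by (intro enn2real_leI) auto
  have tr: "truncation Gr gr (queue.transport t) (q t) (w t)" if t: "0 \<le> t" for t
    using dens_q'[OF t] front(2)[OF t] lam_nonneg[OF t] min_le[OF t]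
    by unfold_locales (auto simp: q_def w_def)
  \<comment> \<open>The infinite boundary at time 0 is consistent, as the whole initial potential
    queue is in the queue by \<open>cum_0\<close>.\<close>
  have w_cum: "cumulative (queue.transport t) (w t) = Qt t" if "0 \<le> t" for t
    using front(1)[OF that] cum_0 by (simp add: w_def)
  have q_cum: "cumulative (q t) \<infinity> = Qt t" if "0 \<le> t" for t
    using truncation.cumulative_q_top[OF tr[OF that]] w_cum[OF that] by simp
  have rate_q: "density_rate Gr gr (q t) = \<rho> t" if t: "0 \<le> t" for t
    unfolding \<rho>_def reneging_rate_def \<eta>[OF t]
    by (rule truncation.density_rate_q[OF tr[OF t]]) (simp add: front(1)[OF t] q_cum[OF t])
  have rate_b: "density_rate Gs gs (server.transport t) = \<sigma> t" if t: "0 \<le> t" for t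
    using service.nn_integral_hazard[OF dens_b[OF t] service.ages_measurable subset_refl]
    by (simp add: \<sigma>_def departure_rate_def density_rate_def \<nu>[OF t])
  have b_0: "server.transport t 0 = \<kappa> t" if "0 \<le> t" for t
    using that by (simp add: server.transport_def k_def service.survival_0)
  have q'_0: "queue.transport t 0 = lam t" if "0 \<le> t" for t
    using that by (simp add: queue.transport_def arrival_def patience.survival_0)

  define B where "B t y = cumulative (server.transport t) y" for t y
  define Q where "Q t y = cumulative (q t) y" for t y
  have "two_parameter_fluid_model Gs gs Gr gr lam q0 b0 B Q"
    unfolding two_parameter_fluid_model_def
  proof (intro exI conjI allI impI)
    fix t :: real assume t: "0 \<le> t"
    show "age_density Gs (server.transport t)" "age_density Gr (queue.transport t)" "age_density Gr (q t)"
      using dens_b[OF t] dens_q'[OF t] truncation.age_density_q[OF tr[OF t]] by auto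
    fix y :: ereal
    show "B t y = cumulative (server.transport t) y" "Q t y = cumulative (q t) y"
      by (simp_all add: B_def Q_def)
    show "B t y \<le> 1"
      using cumulative_mono[OF dens_b[OF t], of y \<infinity>] B_cum[OF t] by (simp add: B_def)
  next
    fix x :: real assume x: "0 < x"
    show "server.transport 0 x = b0 x" "queue.transport 0 x = q0 x" "q 0 x = q0 x"
      using x server.transport_0[OF x] queue.transport_0[OF x]
      by (simp_all add: b0_ext_def q0_ext_def q_def w_def)
  next
    show "ages_along Gs server.transport" "ages_along Gr queue.transport"
      by (rule server.ages_along_transport queue.ages_along_transport)+
    show "queue_truncation queue.transport q w"
      unfolding queue_truncation_def
      using truncation.w[OF tr] w_cum q_cum by (auto simp: q_def)
    show "boundary_conditions Gs gs lam server.transport queue.transport q"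
      unfolding boundary_conditions_def Let_def
    proof (intro allI impI)
      fix t :: real assume t: "0 \<le> t"
      \<comment> \<open>The minimum with an arrival rate is finite even where the service rate is
        not, so the conversion loses nothing.\<close>
      have "ennreal (enn2real (min (\<sigma> t) (ennreal (lam t)))) = min (\<sigma> t) (ennreal (lam t))"
        by (simp add: min_less_iff_disj)
      then show "(cumulative (server.transport t) \<infinity> < 1 \<longrightarrow> cumulative (q t) \<infinity> = 0) \<and>
          (cumulative (server.transport t) \<infinity> < 1 \<longrightarrow> server.transport t 0 = lam t) \<and>
          (cumulative (server.transport t) \<infinity> = 1 \<and> cumulative (q t) \<infinity> = 0 \<longrightarrow>
            ennreal (server.transport t 0) = min (density_rate Gs gs (server.transport t)) (ennreal (lam t))) \<and>
          (cumulative (server.transport t) \<infinity> = 1 \<and> cumulative (q t) \<infinity> > 0 \<and>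
            density_rate Gs gs (server.transport t) < \<infinity> \<longrightarrow>
            ennreal (server.transport t 0) = density_rate Gs gs (server.transport t)) \<and>
          queue.transport t 0 = lam t \<and>
          (cumulative (q t) \<infinity> > 0 \<longrightarrow> q t 0 = lam t) \<and>
          (cumulative (server.transport t) \<infinity> = 1 \<and> cumulative (q t) \<infinity> = 0 \<longrightarrow>
            q t 0 = lam t - enn2real (min (density_rate Gs gs (server.transport t)) (ennreal (lam t)))) \<and>
          (cumulative (server.transport t) \<infinity> < 1 \<longrightarrow> q t 0 = 0)"
        unfolding B_cum[OF t] q_cum[OF t] rate_b[OF t] b_0[OF t] q'_0[OF t] Qt
        by (cases "X t" "1::real" rule: linorder_cases) (auto simp: \<kappa>_def q_def \<sigma>r_def)
    qed
    show "flow_conservation Gr gr lam server.transport q"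
      unfolding flow_conservation_def Let_def
    proof (intro conjI allI impI)
      show "locally_integrable (\<lambda>s. ennreal (server.transport s 0))"
        by (rule locally_integrable_cong[OF locally_integrable_ennreal[OF \<kappa>_meas \<kappa>_nonneg \<kappa>_LBINT(1)]]) (simp_all add: b_0)
      show "locally_integrable (\<lambda>s. density_rate Gr gr (q s))"
        by (rule locally_integrable_cong[OF mv(4) rate_q])
      fix t :: real assume t: "0 \<le> t"
      have "time_integral (\<lambda>s. ennreal (server.transport s 0)) t = time_integral (\<lambda>s. ennreal (\<kappa> s)) t"
        by (rule time_integral_cong) (simp add: b_0)
      also have "\<dots> = (LBINT s:{0..t}. enn2real (ennreal (\<kappa> s)))"
        by (rule locally_integrable_enn2real(4)[OF locally_integrable_ennreal[OF \<kappa>_meas \<kappa>_nonneg \<kappa>_LBINT(1)] t])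
      also have "\<dots> = (LBINT s:{0..t}. \<kappa> s)"
        unfolding set_lebesgue_integral_def
        by (intro Bochner_Integration.integral_cong) (auto simp: indicator_def \<kappa>_nonneg)
      finally have entry: "time_integral (\<lambda>s. ennreal (server.transport s 0)) t = K t"
        using \<kappa>_LBINT(2)[OF t] by simp
      have "time_integral (\<lambda>s. density_rate Gr gr (q s)) t = time_integral \<rho> t"
        by (rule time_integral_cong[OF rate_q])
      then show "(LBINT s:{0..t}. lam s) + cumulative (q 0) \<infinity> = cumulative (q t) \<infinity> +
          time_integral (\<lambda>s. ennreal (server.transport s 0)) t + time_integral (\<lambda>s. density_rate Gr gr (q s)) t"
        using balance[OF t] entry t by (simp add: q_cum)
    qed
  qed
  moreover have "B t y = measure (\<nu> t) {x. 0 \<le> x \<and> ereal x \<le> y}" if "0 \<le> t" for t y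
    unfolding B_def \<nu>[OF that] by (rule measure_age_density(2)[OF dens_b[OF that], symmetric])
  moreover have "X t = B t \<infinity> + Q t \<infinity>" if "0 \<le> t" for t
    by (auto simp: B_def Q_def B_cum[OF that] q_cum[OF that] Qt)
  ultimately show ?thesis
    using \<eta> age(2) by blast
qed

end

section \<open>Transfer of existence and uniqueness\<close>

lemma (in lifetime) age_measure_eqI:
  assumes M: "age_measure G M" and N: "age_measure G N"
    and eq: "\<And>y::ereal. 0 \<le> y \<Longrightarrow> measure M {x. 0 \<le> x \<and> ereal x \<le> y} = measure N {x. 0 \<le> x \<and> ereal x \<le> y}"
  shows "M = N"
proof (rule measure_eqI_atMost)
  interpret M: finite_measure M using M by (simp add: age_measure_def)
  interpret N: finite_measure N using N by (simp add: age_measure_def)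
  have sets: "sets M = sets borel" "sets N = sets borel" using M N by (auto simp: age_measure_def)
  then show "sets M = sets borel" "sets N = sets borel" .
  fix t :: real
  show "emeasure M {..t} \<noteq> \<infinity>" by (simp add: M.emeasure_eq_measure)
  show "emeasure M {..t} = emeasure N {..t}"
  proof (cases "0 \<le> t")
    case False
    then have "emeasure L {..t} = 0" if "age_measure G L" for L
      using that by (intro emeasure_eq_0[OF _ age_measure_neg[OF that]]) (simp_all add: age_measure_def subset_eq)
    then show ?thesis using M N by simp
  next
    case True
    have Iic: "emeasure L {..t} = emeasure L {x. 0 \<le> x \<and> ereal x \<le> ereal t}" if L: "age_measure G L" for L
    proof (rule emeasure_eq_AE)
      have s: "sets L = sets borel" using L by (simp add: age_measure_def)
      have "{..<0} \<in> null_sets L" using age_measure_neg[OF L] s by (intro null_setsI) auto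
      then have "AE x in L. x \<notin> {..<0}" by (rule AE_not_in)
      then show "AE x in L. (x \<in> {..t}) = (x \<in> {x. 0 \<le> x \<and> ereal x \<le> ereal t})"
        by eventually_elim auto
      show "{..t} \<in> sets L" "{x. 0 \<le> x \<and> ereal x \<le> ereal t} \<in> sets L"
        unfolding s by (auto intro: cumulative_set_measurable)
    qed
    show ?thesis
      unfolding Iic[OF M] Iic[OF N] using eq[of "ereal t"] True
      by (simp add: M.emeasure_eq_measure N.emeasure_eq_measure)
  qed
qed

text \<open>Uniqueness on the two-parameter side concerns cumulative masses: the boundary conditions
  leave \<open>b t 0\<close> unconstrained at overloaded times of infinite service rate.\<close>

theorem theorem2p1:
  fixes lam Gs gs Gr gr q0 b0 :: "real \<Rightarrow> real"
    and \<eta>0 \<nu>0 :: "real measure" and X0 :: real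
  assumes lam_nonneg: "\<And>t. 0 \<le> t \<Longrightarrow> 0 \<le> lam t"
    and lam_integrable: "\<And>t. 0 \<le> t \<Longrightarrow> set_integrable lborel {0..t} lam"
    and service: "lifetime_distribution Gs gs"
    and patience: "lifetime_distribution Gr gr"
    and b0: "age_density Gs b0"
    and q0: "age_density Gr q0"
    and initial: "(\<eta>0, \<nu>0, X0) \<in> initial_states Gs Gr"
    and eta0: "\<eta>0 = density_measure q0"
    and nu0: "\<nu>0 = density_measure b0"
  shows
    "((\<exists>B Q. two_parameter_fluid_model Gs gs Gr gr lam q0 b0 B Q) \<and>
      (\<forall>B Q B' Q'. two_parameter_fluid_model Gs gs Gr gr lam q0 b0 B Q \<longrightarrow>
         two_parameter_fluid_model Gs gs Gr gr lam q0 b0 B' Q' \<longrightarrow>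
         (\<forall>t\<ge>0. \<forall>y\<ge>0. B t y = B' t y \<and> Q t y = Q' t y)))
     \<longleftrightarrow>
     ((\<exists>\<eta> \<nu> X. measure_valued_fluid_model Gs gs Gr gr lam \<eta>0 \<nu>0 X0 \<eta> \<nu> X) \<and>
      (\<forall>\<eta> \<nu> X \<eta>' \<nu>' X'. measure_valued_fluid_model Gs gs Gr gr lam \<eta>0 \<nu>0 X0 \<eta> \<nu> X \<longrightarrow>
         measure_valued_fluid_model Gs gs Gr gr lam \<eta>0 \<nu>0 X0 \<eta>' \<nu>' X' \<longrightarrow>
         (\<forall>t\<ge>0. \<eta> t = \<eta>' t \<and> \<nu> t = \<nu>' t \<and> X t = X' t)))"
    (is "(\<exists>B Q. ?W B Q) \<and> ?W_unique \<longleftrightarrow> (\<exists>\<eta> \<nu> X. ?M \<eta> \<nu> X) \<and> ?M_unique")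
proof -
  interpret fluid lam Gs gs Gr gr q0 b0 \<eta>0 \<nu>0 X0
    by unfold_locales (fact assms)+
  have ex: "(\<exists>B Q. ?W B Q) \<longleftrightarrow> (\<exists>\<eta> \<nu> X. ?M \<eta> \<nu> X)"
  proof (intro iffI; elim exE)
    fix B Q assume "?W B Q"
    from measure_valued_of_two_parameter[OF this] show "\<exists>\<eta> \<nu> X. ?M \<eta> \<nu> X"
      by (elim exE conjE) (intro exI)
  next
    fix \<eta> \<nu> X assume "?M \<eta> \<nu> X"
    from two_parameter_of_measure_valued[OF this] show "\<exists>B Q. ?W B Q"
      by (elim exE conjE) (intro exI)
  qed
  \<comment> \<open>Both models have the same potential queue by construction, so only \<nu> and
    \<open>X\<close> are to be compared, through the masses of the two associated two-parameter
    models.\<close>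
  have uniqueM: "?M_unique" if W: "?W_unique"
  proof (intro allI impI)
    fix \<eta> \<nu> X \<eta>' \<nu>' X' and t :: real
    assume M: "?M \<eta> \<nu> X" and M': "?M \<eta>' \<nu>' X'" and t: "0 \<le> t"
    from two_parameter_of_measure_valued[OF M] obtain B Q where BQ: "?W B Q"
      and "\<forall>t\<ge>0. \<eta> t = density_measure (queue.transport t) \<and> age_measure Gs (\<nu> t) \<and>
        (\<forall>y\<ge>0. B t y = measure (\<nu> t) {x. 0 \<le> x \<and> ereal x \<le> y}) \<and> X t = B t \<infinity> + Q t \<infinity>"
      by (elim exE conjE) (rule that)
    then have BQ_t: "\<eta> t = density_measure (queue.transport t)" "age_measure Gs (\<nu> t)"
      "\<forall>y\<ge>0. B t y = measure (\<nu> t) {x. 0 \<le> x \<and> ereal x \<le> y}" "X t = B t \<infinity> + Q t \<infinity>"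
      using t by simp_all
    from two_parameter_of_measure_valued[OF M'] obtain B' Q' where BQ': "?W B' Q'"
      and "\<forall>t\<ge>0. \<eta>' t = density_measure (queue.transport t) \<and> age_measure Gs (\<nu>' t) \<and>
        (\<forall>y\<ge>0. B' t y = measure (\<nu>' t) {x. 0 \<le> x \<and> ereal x \<le> y}) \<and> X' t = B' t \<infinity> + Q' t \<infinity>"
      by (elim exE conjE) (rule that)
    then have BQ'_t: "\<eta>' t = density_measure (queue.transport t)" "age_measure Gs (\<nu>' t)"
      "\<forall>y\<ge>0. B' t y = measure (\<nu>' t) {x. 0 \<le> x \<and> ereal x \<le> y}" "X' t = B' t \<infinity> + Q' t \<infinity>"
      using t by simp_all
    have eq: "B t y = B' t y" "Q t y = Q' t y" if "0 \<le> y" for y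
      using W[rule_format, OF BQ BQ' t that] by auto
    have "\<nu> t = \<nu>' t"
      using BQ_t(3) BQ'_t(3) eq(1) by (intro service.age_measure_eqI BQ_t(2) BQ'_t(2)) simp
    then show "\<eta> t = \<eta>' t \<and> \<nu> t = \<nu>' t \<and> X t = X' t"
      using BQ_t(1,4) BQ'_t(1,4) eq[of \<infinity>] by simp
  qed
  \<comment> \<open>The formulas for \<open>B\<close> and \<open>Q\<close> mention neither densities
    nor boundaries, so equal measures and equal states suffice.\<close>
  have uniqueW: "?W_unique" if M: "?M_unique"
  proof (intro allI impI)
    fix B Q B' Q' and t :: real and y :: ereal
    assume W: "?W B Q" and W': "?W B' Q'" and t: "0 \<le> t" and y: "0 \<le> y"
    from measure_valued_of_two_parameter[OF W] obtain \<eta> \<nu> X where MV: "?M \<eta> \<nu> X"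
      and "\<forall>t\<ge>0. \<forall>y\<ge>0. B t y = measure (\<nu> t) {x. 0 \<le> x \<and> ereal x \<le> y} \<and>
        Q t y = min (measure (\<eta> t) {x. 0 \<le> x \<and> ereal x \<le> y}) (queue_length X t)"
      by (elim exE conjE) (rule that)
    then have MV_t: "B t y = measure (\<nu> t) {x. 0 \<le> x \<and> ereal x \<le> y}"
      "Q t y = min (measure (\<eta> t) {x. 0 \<le> x \<and> ereal x \<le> y}) (queue_length X t)"
      using t y by blast+
    from measure_valued_of_two_parameter[OF W'] obtain \<eta>' \<nu>' X' where MV': "?M \<eta>' \<nu>' X'"
      and "\<forall>t\<ge>0. \<forall>y\<ge>0. B' t y = measure (\<nu>' t) {x. 0 \<le> x \<and> ereal x \<le> y} \<and>
        Q' t y = min (measure (\<eta>' t) {x. 0 \<le> x \<and> ereal x \<le> y}) (queue_length X' t)"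
      by (elim exE conjE) (rule that)
    then have MV'_t: "B' t y = measure (\<nu>' t) {x. 0 \<le> x \<and> ereal x \<le> y}"
      "Q' t y = min (measure (\<eta>' t) {x. 0 \<le> x \<and> ereal x \<le> y}) (queue_length X' t)"
      using t y by blast+
    have "\<eta> t = \<eta>' t" "\<nu> t = \<nu>' t" "X t = X' t"
      using M[rule_format, OF MV MV' t] by auto
    then show "B t y = B' t y \<and> Q t y = Q' t y"
      using MV_t MV'_t by (simp add: queue_length_def)
  qed
  show ?thesis
    by (rule conj_cong[OF ex iffI[OF uniqueM uniqueW]])
qed

end
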